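(* For every $\beta>0$ the following holds. There exist positive constants $C_1, C_2, D_1, D_2$ not depending on $\beta$, and positive constants $C^{l}(\beta), C^{u}(\beta), D^{l}(\beta), D^{u}(\beta), C_R(\beta), D_R(\beta)$ depending only on $\beta$, such that \[ C^{l}(\beta)\mathrm{e}^{-C_1x^2} \le \pi(Q_1(\infty) < -x) \le C^{u}(\beta)\mathrm{e}^{-C_2x^2} \quad\text{for all } x \ge C_R(\beta), \] \[ D^{l}(\beta)\mathrm{e}^{-D_1\beta y} \le \pi(Q_2(\infty) > y) \le D^{u}(\beta)\mathrm{e}^{-D_2\beta y}\quad\text{for all } y \ge D_R(\beta). \]
   Context: Fix $\beta>0$. For an initial state $(x,y)$ with $x\le 0$, $y\ge 0$, let $(Q_1,Q_2)$ be the continuous process on $[0,\infty)$ solving \[ Q_1(t) = x + \sqrt{2}W(t) - \beta t + \int_0^t(-Q_1(s)+Q_2(s))\,ds - L(t),\qquad Q_2(t) = y + L(t) - \int_0^t Q_2(s)\,ds, \] where $W$ is a standard Brownian motion and $L$ is the unique nondecreasing nonnegative càdlàg process with $L(0)=0$ such that $Q_1(t)\le 0$ for all $t$ and $\int_0^\infty \mathbf{1}_{[Q_1(t)<0]}\,dL(t)=0$. This is a Markov process which is ergodic with a unique stationary distribution $\pi$ on $(-\infty,0]\times(0,\infty)$; $(Q_1(\infty),Q_2(\infty))$ denotes a random vector with law $\pi$. *)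

theory Defs
  imports "HOL-Probability.Probability"
begin

definition brownian_motion ::
  "(real \<Rightarrow> real) measure \<Rightarrow> ((real \<Rightarrow> real) \<Rightarrow> real \<Rightarrow> real) \<Rightarrow> bool" where
  "brownian_motion M W \<longleftrightarrow>
     prob_space M \<and>
     (\<forall>t. (\<lambda>\<omega>. W \<omega> t) \<in> borel_measurable M) \<and>
     (\<forall>\<omega>\<in>space M. W \<omega> 0 = 0 \<and> continuous_on {0..} (W \<omega>)) \<and>
     (\<forall>s t. 0 \<le> s \<and> s < t \<longrightarrow>
        distributed M lborel (\<lambda>\<omega>. W \<omega> t - W \<omega> s)
          (\<lambda>x. ennreal (normal_density 0 (sqrt (t - s)) x))) \<and>
     (\<forall>(n::nat) (ts::nat \<Rightarrow> real). (\<forall>i<n. 0 \<le> ts i \<and> ts i < ts (Suc i)) \<longrightarrow>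
        prob_space.indep_vars M (\<lambda>_. borel)
          (\<lambda>i \<omega>. W \<omega> (ts (Suc i)) - W \<omega> (ts i)) {..<n})"

text \<open>Pathwise solution of the reflected system driven by a path w, started at (x,y).
  The condition that the integral of the indicator of [q1 < 0] against dL vanishes
  is rendered as: L is constant on every interval on which q1 is negative.\<close>
definition reflected_solution ::
  "real \<Rightarrow> (real \<Rightarrow> real) \<Rightarrow> real \<Rightarrow> real \<Rightarrow>
   (real \<Rightarrow> real) \<Rightarrow> (real \<Rightarrow> real) \<Rightarrow> (real \<Rightarrow> real) \<Rightarrow> bool" where
  "reflected_solution \<beta> w x y q1 q2 L \<longleftrightarrow>
     continuous_on {0..} q1 \<and> continuous_on {0..} q2 \<and>
     L 0 = 0 \<and> mono_on {0..} L \<and> (\<forall>t\<ge>0. 0 \<le> L t) \<and>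
     (\<forall>t\<ge>0. q1 t \<le> 0) \<and>
     (\<forall>t\<ge>0. q1 t = x + sqrt 2 * w t - \<beta> * t + integral {0..t} (\<lambda>s. - q1 s + q2 s) - L t) \<and>
     (\<forall>t\<ge>0. q2 t = y + L t - integral {0..t} q2) \<and>
     (\<forall>a b. 0 \<le> a \<and> a \<le> b \<and> (\<forall>s\<in>{a..b}. q1 s < 0) \<longrightarrow> L b = L a)"

definition transition_prob ::
  "real \<Rightarrow> (real \<Rightarrow> real) measure \<Rightarrow> ((real \<Rightarrow> real) \<Rightarrow> real \<Rightarrow> real) \<Rightarrow>
   real \<times> real \<Rightarrow> real \<Rightarrow> (real \<times> real) set \<Rightarrow> ennreal" where
  "transition_prob \<beta> M W z t A =
     emeasure M {\<omega>\<in>space M. \<exists>q1 q2 L.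
        reflected_solution \<beta> (W \<omega>) (fst z) (snd z) q1 q2 L \<and> (q1 t, q2 t) \<in> A}"

definition stationary_dist :: "real \<Rightarrow> (real \<times> real) measure \<Rightarrow> bool" where
  "stationary_dist \<beta> \<pi> \<longleftrightarrow>
     prob_space \<pi> \<and> sets \<pi> = sets borel \<and>
     (\<forall>M W. brownian_motion M W \<longrightarrow>
        (\<forall>t\<ge>0. \<forall>A\<in>sets borel.
           emeasure \<pi> A = (\<integral>\<^sup>+ z. transition_prob \<beta> M W z t A \<partial>\<pi>)))"

end

theory Submission
  imports Defs "HOL-Real_Asymp.Real_Asymp"
begin

text \<open>
  Write \<open>X = - q1 \<ge> 0\<close> and \<open>S = q1 + q2\<close>, so that \<open>dS = sqrt 2 dW + (X - \<beta>) dt\<close>. Testing stationarity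
  at a fixed time against bounded functions only needs pathwise a priori estimates valid for every
  solution; neither existence nor uniqueness of solutions, nor measurability of the solution map,
  enters. A Brownian motion must exist, though, as otherwise every law would be stationary; it is obtained from the
  Daniell-Kolmogorov theorem on the dyadic rationals and dyadic chaining, which also gives a
  Hoelder-type constant \<open>H\<close> of the path on \<open>[0, 1]\<close> with a Gaussian tail.

  Following \<open>X\<close> from its last zero gives \<open>X 1 \<le> X 0 / 2 + O(H + \<beta>)\<close>, and iterating the resulting
  inequality for the tail of \<open>X\<close> yields the Gaussian upper bound. If \<open>q2 0\<close> is large, then \<open>X\<close> is pushed to
  \<open>0\<close> so strongly that \<open>q2 1 - q2 0 \<le> sqrt 2 W 1 - \<beta> + o(1)\<close>; hence \<open>exp (\<beta> q2 / 2)\<close> contracts in mean off a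
  bounded set of values of \<open>q2\<close>, which bounds its stationary mean. For the lower bounds start in a compact set of mass
  at least \<open>1 / 2\<close>: a steep decrease of \<open>W\<close> over a short time makes \<open>X\<close> large, and
  \<open>q2 T \<ge> S 0 + sqrt 2 W T - \<beta> T\<close> with \<open>T = y / \<beta>\<close> makes \<open>q2\<close> exceed \<open>y\<close>.
\<close>

section \<open>Dyadic chaining and Gaussian tails\<close>

text \<open>Three obstacles shape the argument. The exponents must serve every
  \<open>\<beta>\<close>, so noise is measured by one variable \<open>H\<close> with a tail free of
  \<open>\<beta>\<close>. For \<open>q1\<close>, \<open>\<beta>\<close> then enters through
  thresholds only. For \<open>q2\<close> the exponent comes from the drift:
  \<open>exp (\<theta> * (sqrt 2 * W 1 - \<beta>))\<close> has mean
  \<open>exp (\<theta>^2 - \<beta> * \<theta>)\<close>, which is smallest at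
  \<open>\<theta> = \<beta> / 2\<close>. Next, stationarity directly yields upper bounds only,
  because a path without a solution or a nonmeasurable event adds nothing to a transition
  probability. A lower bound is therefore an upper bound for the complement, combined with the total
  mass 1 of \<open>\<pi>\<close>. Test functions must also be bounded, so the exponential of
  \<open>q2\<close> is truncated, and the truncated part has to cancel. Finally, the definition of
  stationarity puts no restriction on where \<open>\<pi>\<close> lives. That
  \<open>q1 \<le> 0\<close> and \<open>q2 \<ge> 0\<close> almost surely has to be derived first; for
  \<open>q2\<close> it rests on \<open>q2 t \<ge> exp (- t) * q2 0\<close>, which holds for either
  sign of \<open>q2 0\<close>.\<close>

text \<open>The ratio \<open>4/5\<close> only has to satisfy \<open>2 (4/5)^2 = 32/25 > 1\<close>: then the Gaussian tails of the
  \<open>2^n\<close> increments of level \<open>n\<close>, whose variance is \<open>2^-n\<close>, beyond \<open>A (4/5)^n\<close> are summable.\<close>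

context
  fixes f :: "real \<Rightarrow> real" and A :: real and N :: nat
  assumes A: "0 \<le> A"
    and step: "\<And>n k. k \<le> N * 2 ^ n \<Longrightarrow> \<bar>f (real (Suc k) / 2 ^ n) - f (real k / 2 ^ n)\<bar> \<le> A * (4/5) ^ n"
begin

lemma nat_floor_dyadic_le: "0 \<le> t \<Longrightarrow> t \<le> real N \<Longrightarrow> nat \<lfloor>t * 2 ^ n\<rfloor> \<le> N * 2 ^ n"
  by (metis floor_mono floor_of_nat nat_int nat_mono of_nat_mult of_nat_numeral of_nat_power
      mult_right_mono zero_le_numeral zero_le_power)

text \<open>Refining the grid replaces the index \<open>a\<close> below \<open>t\<close> by
  \<open>2 * a\<close> or \<open>Suc (2 * a)\<close>, so the two approximants agree or differ by one
  step of the finer level.\<close>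

lemma dyadic_step_Suc:
  assumes t: "0 \<le> t" "t \<le> real N"
  shows "\<bar>f (real (nat \<lfloor>t * 2 ^ Suc n\<rfloor>) / 2 ^ Suc n) - f (real (nat \<lfloor>t * 2 ^ n\<rfloor>) / 2 ^ n)\<bar> \<le> A * (4/5) ^ Suc n"
proof -
  define a where "a = nat \<lfloor>t * 2 ^ n\<rfloor>"
  have "a \<le> N * 2 ^ n" unfolding a_def using t by (rule nat_floor_dyadic_le)
  then have a: "2 * a \<le> N * 2 ^ Suc n" by simp
  have eq: "real (2 * a) / 2 ^ Suc n = real a / 2 ^ n" by simp
  have "real a \<le> t * 2 ^ n" "t * 2 ^ n < real a + 1"
    using t by (auto simp: a_def)
  then have "nat \<lfloor>t * 2 ^ Suc n\<rfloor> = 2 * a \<or> nat \<lfloor>t * 2 ^ Suc n\<rfloor> = Suc (2 * a)"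
    using t by simp linarith
  then show ?thesis
    unfolding a_def[symmetric] eq[symmetric] using step[OF a] A by auto
qed

text \<open>The factor 4 is \<open>(4/5) / (1 - 4/5)\<close>. Written as a difference, the bound
  grows by exactly \<open>A * (4/5) ^ Suc (n + m)\<close> per level, so the induction
  closes.\<close>

lemma dyadic_steps:
  assumes t: "0 \<le> t" "t \<le> real N"
  shows "\<bar>f (real (nat \<lfloor>t * 2 ^ (n + m)\<rfloor>) / 2 ^ (n + m)) - f (real (nat \<lfloor>t * 2 ^ n\<rfloor>) / 2 ^ n)\<bar>
     \<le> 4 * A * ((4/5) ^ n - (4/5) ^ (n + m))"
proof (induction m)
  case (Suc m)
  have "A * (4/5) ^ Suc (n + m) = 4 * A * ((4/5) ^ (n + m) - (4/5) ^ Suc (n + m))"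
    by (simp add: field_simps)
  then show ?case
    using Suc dyadic_step_Suc[OF t, of "n + m"] by (simp only: add_Suc_right) argo
qed simp

lemma dyadic_steps_le:
  assumes t: "0 \<le> t" "t \<le> real N" and "n \<le> m"
  shows "\<bar>f (real (nat \<lfloor>t * 2 ^ m\<rfloor>) / 2 ^ m) - f (real (nat \<lfloor>t * 2 ^ n\<rfloor>) / 2 ^ n)\<bar> \<le> 4 * A * (4/5) ^ n"
proof -
  have "4 * A * ((4/5) ^ n - (4/5) ^ m) \<le> 4 * A * (4/5) ^ n"
    using A by (intro mult_left_mono) auto
  with dyadic_steps[OF t, of n "m - n"] \<open>n \<le> m\<close> show ?thesis by auto
qed

lemma dyadic_convergent:
  assumes t: "0 \<le> t" "t \<le> real N"
  shows "convergent (\<lambda>n. f (real (nat \<lfloor>t * 2 ^ n\<rfloor>) / 2 ^ n))"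
proof (rule Cauchy_convergent, rule CauchyI')
  fix e :: real assume "0 < e"
  have "(\<lambda>n. 4 * A * (4/5) ^ n) \<longlonglongrightarrow> 4 * A * 0"
    by (intro tendsto_intros) auto
  then have "\<forall>\<^sub>F n in sequentially. 4 * A * (4/5) ^ n < e"
    using \<open>0 < e\<close> by (intro order_tendstoD) auto
  then obtain n0 where n0: "\<And>n. n \<ge> n0 \<Longrightarrow> 4 * A * (4/5) ^ n < e"
    by (auto simp: eventually_sequentially)
  show "\<exists>M. \<forall>m\<ge>M. \<forall>n>m. dist (f (real (nat \<lfloor>t * 2 ^ m\<rfloor>) / 2 ^ m)) (f (real (nat \<lfloor>t * 2 ^ n\<rfloor>) / 2 ^ n)) < e"
  proof (intro exI[of _ n0] allI impI)
    fix m n assume "n0 \<le> m" "m < n"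
    then show "dist (f (real (nat \<lfloor>t * 2 ^ m\<rfloor>) / 2 ^ m)) (f (real (nat \<lfloor>t * 2 ^ n\<rfloor>) / 2 ^ n)) < e"
      using n0[of m] dyadic_steps_le[OF t, of m n] by (auto simp: dist_real_def abs_minus_commute)
  qed
qed

text \<open>Here \<open>9 = 4 + 1 + 4\<close>: each limit is within \<open>4 * A * (4/5) ^ n\<close>
  of its approximant at level \<open>n\<close>, and the two approximants sit at equal or adjacent
  grid points.\<close>

lemma dyadic_modulus:
  assumes lim: "\<And>t. 0 \<le> t \<Longrightarrow> t \<le> real N \<Longrightarrow> (\<lambda>n. f (real (nat \<lfloor>t * 2 ^ n\<rfloor>) / 2 ^ n)) \<longlonglongrightarrow> g t"
    and "0 \<le> s" "s \<le> real N" "0 \<le> t" "t \<le> real N" "\<bar>t - s\<bar> \<le> 1 / 2 ^ n"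
  shows "\<bar>g t - g s\<bar> \<le> 9 * A * (4/5) ^ n"
proof -
  define F where "F t n = f (real (nat \<lfloor>t * 2 ^ n\<rfloor>) / 2 ^ n)" for t :: real and n :: nat
  have tail: "\<bar>g t - F t n\<bar> \<le> 4 * A * (4/5) ^ n" if t: "0 \<le> t" "t \<le> real N" for t
  proof (rule LIMSEQ_le_const2)
    show "(\<lambda>m. \<bar>F t m - F t n\<bar>) \<longlonglongrightarrow> \<bar>g t - F t n\<bar>"
      unfolding F_def by (intro tendsto_intros lim that)
    show "\<exists>M. \<forall>m\<ge>M. \<bar>F t m - F t n\<bar> \<le> 4 * A * (4/5) ^ n"
      unfolding F_def using dyadic_steps_le[OF t] by blast
  qed
  have near: "\<bar>F t n - F s n\<bar> \<le> A * (4/5) ^ n"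
    if st: "0 \<le> s" "s \<le> t" "t \<le> real N" "t - s \<le> 1 / 2 ^ n" for s t
  proof -
    define a where "a = nat \<lfloor>s * 2 ^ n\<rfloor>"
    have "a \<le> N * 2 ^ n" unfolding a_def using st by (intro nat_floor_dyadic_le) auto
    from step[OF this] have stp: "\<bar>f (real (Suc a) / 2 ^ n) - f (real a / 2 ^ n)\<bar> \<le> A * (4/5) ^ n" .
    have "t * 2 ^ n \<le> s * 2 ^ n + 1" "s * 2 ^ n \<le> t * 2 ^ n"
      using st by (auto simp: field_simps)
    moreover have "real a \<le> s * 2 ^ n" "s * 2 ^ n < real a + 1"
      using st by (auto simp: a_def)
    ultimately have "nat \<lfloor>t * 2 ^ n\<rfloor> = a \<or> nat \<lfloor>t * 2 ^ n\<rfloor> = Suc a"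
      using st by linarith
    then show ?thesis
      unfolding F_def a_def[symmetric] using stp A by auto
  qed
  have "\<bar>F t n - F s n\<bar> \<le> A * (4/5) ^ n"
  proof (cases "s \<le> t")
    case True
    then show ?thesis using near[of s t] assms by auto
  next
    case False
    then show ?thesis using near[of t s] assms by (auto simp: abs_minus_commute)
  qed
  then show ?thesis
    using tail[of t] tail[of s] assms by (simp add: abs_le_iff)
qed

end

text \<open>The terms decay doubly exponentially and so beat the \<open>2 ^ n\<close> increments of
  a level. Dividing by 4 rather than by the Gaussian 2 leaves half of the exponent for the decay in
  \<open>A\<close> in \<open>chaining_tail\<close>.\<close>

lemma summable_chaining:
  "summable (\<lambda>n. real (N * 2 ^ n + 1) * (2 * exp (- ((32/25) ^ n) / 4)))"
proof (rule summable_comparison_test_ev)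
  have "(\<lambda>n. real (N * 2 ^ n + 1) * (2 * exp (- ((32/25) ^ n) / 4)) * 2 ^ n) \<longlonglongrightarrow> 0"
    by real_asymp
  then have "\<forall>\<^sub>F n in sequentially. real (N * 2 ^ n + 1) * (2 * exp (- ((32/25) ^ n) / 4)) * 2 ^ n < 1"
    by (rule order_tendstoD) simp
  then show "\<forall>\<^sub>F n in sequentially. norm (real (N * 2 ^ n + 1) * (2 * exp (- ((32/25) ^ n) / 4))) \<le> (1/2) ^ n"
    by eventually_elim (auto simp: field_simps)
qed (simp add: summable_geometric)

section \<open>Moment generating function and two-sided tail bounds of a normal variable\<close>

context prob_space begin

lemma normal_exp_integral:
  assumes X: "distributed M lborel X (normal_density 0 \<sigma>)" and "0 < \<sigma>"
  shows "(\<integral>\<^sup>+ \<omega>. ennreal (exp (\<theta> * X \<omega>)) \<partial>M) = ennreal (exp (\<theta>\<^sup>2 * \<sigma>\<^sup>2 / 2))"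
proof -
  have "(\<integral>\<^sup>+ \<omega>. ennreal (exp (\<theta> * X \<omega>)) \<partial>M) = (\<integral>\<^sup>+ x. ennreal (normal_density 0 \<sigma> x) * ennreal (exp (\<theta> * x)) \<partial>lborel)"
    by (rule distributed_nn_integral[OF X, symmetric]) auto
  also have "\<dots> = (\<integral>\<^sup>+ x. ennreal (exp (\<theta>\<^sup>2 * \<sigma>\<^sup>2 / 2)) * ennreal (normal_density (\<theta> * \<sigma>\<^sup>2) \<sigma> x) \<partial>lborel)"
  proof (intro nn_integral_cong)
    fix x
    have "- x\<^sup>2 / (2 * \<sigma>\<^sup>2) + \<theta> * x = \<theta>\<^sup>2 * \<sigma>\<^sup>2 / 2 + (- (x - \<theta> * \<sigma>\<^sup>2)\<^sup>2 / (2 * \<sigma>\<^sup>2))"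
      using \<open>0 < \<sigma>\<close> by (simp add: field_simps power2_eq_square)
    then show "ennreal (normal_density 0 \<sigma> x) * ennreal (exp (\<theta> * x)) =
      ennreal (exp (\<theta>\<^sup>2 * \<sigma>\<^sup>2 / 2)) * ennreal (normal_density (\<theta> * \<sigma>\<^sup>2) \<sigma> x)"
      by (simp add: normal_density_def ennreal_mult[symmetric] exp_add[symmetric] mult_ac)
  qed
  also have "\<dots> = ennreal (exp (\<theta>\<^sup>2 * \<sigma>\<^sup>2 / 2)) * (\<integral>\<^sup>+ x. ennreal (normal_density (\<theta> * \<sigma>\<^sup>2) \<sigma> x) \<partial>lborel)"
    by (rule nn_integral_cmult) simp
  also have "(\<integral>\<^sup>+ x. ennreal (normal_density (\<theta> * \<sigma>\<^sup>2) \<sigma> x) \<partial>lborel) = 1"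
    using \<open>0 < \<sigma>\<close> by (subst nn_integral_eq_integral) auto
  finally show ?thesis by simp
qed

text \<open>Chernoff's bound at the optimal \<open>\<theta> = a / \<sigma>^2\<close>, once for each
  sign \<open>c\<close> of the variable; hence the factor 2.\<close>

lemma normal_upper_tail:
  assumes X: "distributed M lborel X (normal_density 0 \<sigma>)" and "0 < \<sigma>" "0 \<le> a"
  shows "prob {\<omega>\<in>space M. a < \<bar>X \<omega>\<bar>} \<le> 2 * exp (- a\<^sup>2 / (2 * \<sigma>\<^sup>2))"
proof -
  have [measurable]: "X \<in> borel_measurable M"
    using distributed_measurable[OF X] by simp
  have chernoff: "prob {\<omega>\<in>space M. a < c * X \<omega>} \<le> exp (- a\<^sup>2 / (2 * \<sigma>\<^sup>2))" if c: "c\<^sup>2 = 1" for c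
  proof -
    define \<theta> where "\<theta> = a / \<sigma>\<^sup>2"
    have \<theta>: "0 \<le> \<theta>" using assms by (simp add: \<theta>_def)
    have "ennreal (exp (\<theta> * a)) * emeasure M {\<omega>\<in>space M. a < c * X \<omega>}
       = (\<integral>\<^sup>+ \<omega>. ennreal (exp (\<theta> * a)) * indicator {\<omega>\<in>space M. a < c * X \<omega>} \<omega> \<partial>M)"
      by (subst nn_integral_cmult_indicator) auto
    also have "\<dots> \<le> (\<integral>\<^sup>+ \<omega>. ennreal (exp ((\<theta> * c) * X \<omega>)) \<partial>M)"
      using \<theta> by (intro nn_integral_mono) (auto split: split_indicator simp: mult.assoc intro!: ennreal_leI mult_left_mono)
    also have "\<dots> = ennreal (exp ((\<theta> * c)\<^sup>2 * \<sigma>\<^sup>2 / 2))"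
      by (rule normal_exp_integral[OF X \<open>0 < \<sigma>\<close>])
    finally have "exp (\<theta> * a) * prob {\<omega>\<in>space M. a < c * X \<omega>} \<le> exp (\<theta>\<^sup>2 * \<sigma>\<^sup>2 / 2)"
      by (simp add: emeasure_eq_measure ennreal_mult[symmetric] power_mult_distrib c)
    then have "prob {\<omega>\<in>space M. a < c * X \<omega>} \<le> exp (\<theta>\<^sup>2 * \<sigma>\<^sup>2 / 2 - \<theta> * a)"
      by (simp only: exp_diff pos_le_divide_eq exp_gt_zero mult.commute)
    also have "\<theta>\<^sup>2 * \<sigma>\<^sup>2 / 2 - \<theta> * a = - a\<^sup>2 / (2 * \<sigma>\<^sup>2)"
      using \<open>0 < \<sigma>\<close> by (simp add: \<theta>_def field_simps power2_eq_square)
    finally show ?thesis .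
  qed
  have "{\<omega>\<in>space M. a < \<bar>X \<omega>\<bar>} = {\<omega>\<in>space M. a < 1 * X \<omega>} \<union> {\<omega>\<in>space M. a < (-1) * X \<omega>}"
    by auto
  then have "prob {\<omega>\<in>space M. a < \<bar>X \<omega>\<bar>} \<le> prob {\<omega>\<in>space M. a < 1 * X \<omega>} + prob {\<omega>\<in>space M. a < (-1) * X \<omega>}"
    by (simp only:) (rule measure_Un_le; measurable)
  then show ?thesis
    using chernoff[of 1] chernoff[of "-1"] by simp
qed

text \<open>Only the interval from \<open>a\<close> to \<open>a + \<sigma>\<close> is counted, with
  the density replaced by its value at the right end. That end gives
  \<open>a / \<sigma> + 1\<close>, and \<open>sqrt (2 * pi) \<le> 3\<close> gives the divisor
  3.\<close>

lemma normal_lower_tail: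
  assumes X: "distributed M lborel X (normal_density 0 \<sigma>)" and "0 < \<sigma>" "0 \<le> a"
  shows "exp (- (a / \<sigma> + 1)\<^sup>2 / 2) / 3 \<le> prob {\<omega>\<in>space M. a < X \<omega>}"
proof -
  have [measurable]: "X \<in> borel_measurable M"
    using distributed_measurable[OF X] by simp
  define b where "b = a + \<sigma>"
  have ab: "0 \<le> a" "a < b" using assms by (auto simp: b_def)
  define c where "c = normal_density 0 \<sigma> b"
  have "ennreal (c * \<sigma>) = (\<integral>\<^sup>+ x. ennreal c * indicator {a<..b} x \<partial>lborel)"
    using ab by (simp add: nn_integral_cmult ennreal_mult'' b_def c_def)
  also have "\<dots> \<le> (\<integral>\<^sup>+ x. ennreal (normal_density 0 \<sigma> x) * indicator {a<..} x \<partial>lborel)"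
  proof (intro nn_integral_mono)
    fix x
    have "c \<le> normal_density 0 \<sigma> x" if "a < x" "x \<le> b"
    proof -
      have "x\<^sup>2 \<le> b\<^sup>2" using that ab by (intro power_mono) auto
      then show ?thesis using \<open>0 < \<sigma>\<close>
        by (auto simp: c_def normal_density_def intro!: mult_left_mono divide_right_mono)
    qed
    then show "ennreal c * indicator {a<..b} x \<le> ennreal (normal_density 0 \<sigma> x) * indicator {a<..} x"
      by (auto split: split_indicator intro!: ennreal_leI)
  qed
  also have "\<dots> = emeasure M (X -` {a<..} \<inter> space M)"
    by (rule distributed_emeasure[OF X, symmetric]) simp
  also have "X -` {a<..} \<inter> space M = {\<omega>\<in>space M. a < X \<omega>}" by auto
  finally have "c * \<sigma> \<le> prob {\<omega>\<in>space M. a < X \<omega>}"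
    by (simp add: emeasure_eq_measure)
  moreover have "exp (- (a / \<sigma> + 1)\<^sup>2 / 2) / 3 \<le> c * \<sigma>"
  proof -
    have e: "- b\<^sup>2 / (2 * \<sigma>\<^sup>2) = - (a / \<sigma> + 1)\<^sup>2 / 2"
      using \<open>0 < \<sigma>\<close> by (simp add: b_def field_simps power2_eq_square)
    have "sqrt (2 * pi * \<sigma>\<^sup>2) = sqrt (2 * pi) * \<sigma>" using \<open>0 < \<sigma>\<close> by (simp add: real_sqrt_mult)
    then have "c * \<sigma> = exp (- (a / \<sigma> + 1)\<^sup>2 / 2) / sqrt (2 * pi)"
      using \<open>0 < \<sigma>\<close> e by (simp add: c_def normal_density_def)
    moreover have "sqrt (2 * pi) \<le> 3"
      using pi_less_4 by (intro real_le_lsqrt) auto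
    ultimately show ?thesis by (auto simp only: intro!: divide_left_mono) auto
  qed
  ultimately show ?thesis by linarith
qed

end

section \<open>Projective limit of dyadic Gaussian walks\<close>

definition gauss_seq :: "(nat \<Rightarrow> real) measure" where
  "gauss_seq = PiM UNIV (\<lambda>_. std_normal_distribution)"

interpretation gauss_seq: product_prob_space "\<lambda>_::nat. std_normal_distribution" UNIV
  rewrites "PiM UNIV (\<lambda>_::nat. std_normal_distribution) = gauss_seq"
proof -
  interpret real_distribution std_normal_distribution by (rule real_dist_normal_dist)
  show "product_prob_space (\<lambda>_::nat. std_normal_distribution)" ..
qed (simp add: gauss_seq_def)

lemma sets_gauss_seq [measurable_cong]: "sets gauss_seq = sets (PiM UNIV (\<lambda>_. borel))"
  unfolding gauss_seq_def by (intro sets_PiM_cong) auto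

lemma gauss_seq_component: "distributed gauss_seq lborel (\<lambda>\<omega>. \<omega> i) std_normal_density"
proof -
  have "distr gauss_seq lborel (\<lambda>\<omega>. \<omega> i) = std_normal_distribution"
    using gauss_seq.PiM_component[of i] distr_cong[OF refl, of lborel std_normal_distribution gauss_seq "\<lambda>\<omega>. \<omega> i" "\<lambda>\<omega>. \<omega> i"]
    by auto
  then show ?thesis
    unfolding distributed_def by (auto simp: measurable_lborel2)
qed

lemma gauss_seq_indep: "gauss_seq.P.indep_vars (\<lambda>_. borel) (\<lambda>i \<omega>. \<omega> i) UNIV"
proof -
  have "distr gauss_seq (PiM UNIV (\<lambda>_. borel)) (\<lambda>\<omega>. \<lambda>i\<in>UNIV. \<omega> i) = PiM UNIV (\<lambda>i. distr gauss_seq borel (\<lambda>\<omega>. \<omega> i))"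
  proof -
    have "distr gauss_seq borel (\<lambda>\<omega>. \<omega> i) = std_normal_distribution" for i
      using gauss_seq.PiM_component[of i] distr_cong[OF refl, of borel std_normal_distribution gauss_seq "\<lambda>\<omega>. \<omega> i" "\<lambda>\<omega>. \<omega> i"]
      by auto
    moreover have "distr gauss_seq (PiM UNIV (\<lambda>_. borel)) (\<lambda>\<omega>. \<lambda>i\<in>UNIV. \<omega> i) = distr gauss_seq gauss_seq (\<lambda>\<omega>. \<omega>)"
      by (intro distr_cong) (auto simp: sets_gauss_seq restrict_def)
    ultimately show ?thesis
      by (simp add: gauss_seq_def distr_id)
  qed
  then show ?thesis
    by (subst gauss_seq.P.indep_vars_iff_distr_eq_PiM) auto
qed

lemma gauss_seq_sum_indep:
  assumes "disjoint_family_on K L"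
  shows "gauss_seq.P.indep_vars (\<lambda>_. borel) (\<lambda>j \<omega>. c * (\<Sum>i\<in>K j. \<omega> i)) L"
proof -
  have "gauss_seq.P.indep_vars (\<lambda>_. borel)
     (\<lambda>j \<omega>. (\<lambda>x. c * (\<Sum>i\<in>K j. x i)) (restrict (\<lambda>i. \<omega> i) (K j))) L"
    by (rule gauss_seq.P.indep_vars_compose2[OF gauss_seq.P.indep_vars_restrict[OF gauss_seq_indep]])
       (use assms in \<open>auto intro!: borel_measurable_times borel_measurable_sum measurable_component_singleton\<close>)
  then show ?thesis by simp
qed

lemma gauss_seq_sum_normal:
  assumes "finite K" "K \<noteq> {}" "c \<noteq> 0"
  shows "distributed gauss_seq lborel (\<lambda>\<omega>. c * (\<Sum>i\<in>K. \<omega> i)) (normal_density 0 (\<bar>c\<bar> * sqrt (card K)))"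
proof -
  have "distributed gauss_seq lborel (\<lambda>\<omega>. \<Sum>i\<in>K. \<omega> i) (normal_density (\<Sum>i\<in>K. 0) (sqrt (\<Sum>i\<in>K. 1\<^sup>2)))"
    using assms gauss_seq.P.indep_vars_subset[OF gauss_seq_indep, of K]
    by (intro gauss_seq.P.sum_indep_normal) (auto intro: gauss_seq_component)
  from gauss_seq.P.normal_density_affine[OF this, of c 0] show ?thesis
    using assms by (simp add: card_gt_0_iff)
qed

text \<open>Merging pairs of steps turns the walk of mesh \<open>2^-(n+1)\<close>, watched on the coarser grid, into the
  walk of mesh \<open>2^-n\<close>; its invariance of the Gaussian law is the projectivity of the dyadic marginals.\<close>

definition merge_pairs :: "(nat \<Rightarrow> real) \<Rightarrow> nat \<Rightarrow> real" where
  "merge_pairs \<omega> j = 1 / sqrt 2 * (\<Sum>i\<in>{2*j, Suc (2*j)}. \<omega> i)"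

lemma distr_merge_pairs: "distr gauss_seq gauss_seq merge_pairs = gauss_seq"
proof -
  have ind: "gauss_seq.P.indep_vars (\<lambda>_. borel) (\<lambda>j \<omega>. 1 / sqrt 2 * (\<Sum>i\<in>{2*j, Suc (2*j)}. \<omega> i)) UNIV"
    by (rule gauss_seq_sum_indep) (auto simp: disjoint_family_on_def; presburger)
  have law: "distr gauss_seq borel (\<lambda>\<omega>. 1 / sqrt 2 * (\<Sum>i\<in>{2*j, Suc (2*j)}. \<omega> i)) = std_normal_distribution" for j
  proof -
    have "card {2*j, Suc (2*j)} = 2" by simp
    then have "distributed gauss_seq lborel (\<lambda>\<omega>. 1 / sqrt 2 * (\<Sum>i\<in>{2*j, Suc (2*j)}. \<omega> i)) std_normal_density"
      using gauss_seq_sum_normal[of "{2*j, Suc (2*j)}" "1 / sqrt 2"] by simp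
    then have "distr gauss_seq lborel (\<lambda>\<omega>. 1 / sqrt 2 * (\<Sum>i\<in>{2*j, Suc (2*j)}. \<omega> i)) = std_normal_distribution"
      by (rule distributed_distr_eq_density)
    then show ?thesis
      by (subst distr_cong[OF refl, of _ lborel]) auto
  qed
  have "distr gauss_seq (PiM UNIV (\<lambda>_. borel)) (\<lambda>\<omega>. \<lambda>j\<in>UNIV. 1 / sqrt 2 * (\<Sum>i\<in>{2*j, Suc (2*j)}. \<omega> i)) = gauss_seq"
    using ind law by (subst (asm) gauss_seq.P.indep_vars_iff_distr_eq_PiM) (auto simp: gauss_seq_def)
  then show ?thesis
    by (subst distr_cong[OF refl, of _ "PiM UNIV (\<lambda>_. borel)"])
       (auto simp: sets_gauss_seq merge_pairs_def[abs_def])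
qed

definition walk :: "nat \<Rightarrow> (nat \<Rightarrow> real) \<Rightarrow> real \<Rightarrow> real" where
  "walk n \<omega> t = 1 / sqrt (2 ^ n) * (\<Sum>i<nat \<lfloor>t * 2 ^ n\<rfloor>. \<omega> i)"

definition grid :: "nat \<Rightarrow> real set" where
  "grid n = range (\<lambda>k::nat. real k / 2 ^ n)"

lemma measurable_walk [measurable]: "(\<lambda>\<omega>. walk n \<omega> t) \<in> borel_measurable gauss_seq"
  unfolding walk_def by measurable

lemma grid_mono: "n \<le> m \<Longrightarrow> grid n \<subseteq> grid m"
proof (unfold grid_def, safe)
  fix k :: nat assume "n \<le> m"
  then have "real k / 2 ^ n = real (k * 2 ^ (m - n)) / 2 ^ m"
    by (simp add: field_simps flip: power_add)
  then show "real k / 2 ^ n \<in> range (\<lambda>k::nat. real k / 2 ^ m)" by blast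
qed

lemma walk_Suc:
  assumes "t \<in> grid n"
  shows "walk (Suc n) \<omega> t = walk n (merge_pairs \<omega>) t"
proof -
  obtain k :: nat where k: "t = real k / 2 ^ n" using assms by (auto simp: grid_def)
  have "t * 2 ^ n = of_int (int k)" "t * 2 ^ Suc n = of_int (int (2 * k))"
    by (auto simp: k)
  then have 1: "nat \<lfloor>t * 2 ^ n\<rfloor> = k" "nat \<lfloor>t * 2 ^ Suc n\<rfloor> = 2 * k"
    by (metis floor_of_int nat_int)+
  have 2: "(\<Sum>i<2 * k. \<omega> i) = (\<Sum>j<k. \<omega> (2*j) + \<omega> (Suc (2*j)))"
    by (induction k) auto
  show ?thesis
    unfolding walk_def 1 2 merge_pairs_def
    by (simp add: sum_distrib_left[symmetric] real_sqrt_mult sum_divide_distrib[symmetric])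
qed

lemma distr_walk_Suc:
  assumes "J \<subseteq> grid n"
  shows "distr gauss_seq (PiM J (\<lambda>_. borel)) (\<lambda>\<omega>. restrict (walk (Suc n) \<omega>) J) =
         distr gauss_seq (PiM J (\<lambda>_. borel)) (\<lambda>\<omega>. restrict (walk n \<omega>) J)"
proof -
  have [measurable]: "merge_pairs \<in> measurable gauss_seq gauss_seq"
    unfolding measurable_cong_sets[OF refl sets_gauss_seq] merge_pairs_def[abs_def]
    by (rule measurable_PiM_single') auto
  have "distr gauss_seq (PiM J (\<lambda>_. borel)) (\<lambda>\<omega>. restrict (walk n \<omega>) J) =
        distr (distr gauss_seq gauss_seq merge_pairs) (PiM J (\<lambda>_. borel)) (\<lambda>\<omega>. restrict (walk n \<omega>) J)"
    by (simp add: distr_merge_pairs)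
  also have "\<dots> = distr gauss_seq (PiM J (\<lambda>_. borel)) ((\<lambda>\<omega>. restrict (walk n \<omega>) J) \<circ> merge_pairs)"
    by (rule distr_distr) (auto intro!: measurable_restrict)
  also have "(\<lambda>\<omega>. restrict (walk n \<omega>) J) \<circ> merge_pairs = (\<lambda>\<omega>. restrict (walk (Suc n) \<omega>) J)"
    using assms by (auto simp: fun_eq_iff walk_Suc restrict_def)
  finally show ?thesis ..
qed

lemma distr_walk_le:
  assumes "J \<subseteq> grid n" "n \<le> m"
  shows "distr gauss_seq (PiM J (\<lambda>_. borel)) (\<lambda>\<omega>. restrict (walk m \<omega>) J) =
         distr gauss_seq (PiM J (\<lambda>_. borel)) (\<lambda>\<omega>. restrict (walk n \<omega>) J)"
  using assms(2)
proof (induction m rule: dec_induct)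
  case (step m)
  have "J \<subseteq> grid m" using grid_mono[of n m] assms step by blast
  from distr_walk_Suc[OF this] step.IH show ?case by (rule trans)
qed simp

text \<open>By \<open>distr_walk_le\<close> every level whose grid contains \<open>J\<close> gives
  the same law; \<open>LEAST\<close> merely selects one. If no grid contains \<open>J\<close>, the
  level is unspecified, but the result is still a probability measure.\<close>

definition walk_law :: "real set \<Rightarrow> (real \<Rightarrow> real) measure" where
  "walk_law J = distr gauss_seq (PiM J (\<lambda>_. borel)) (\<lambda>\<omega>. restrict (walk (LEAST n. J \<subseteq> grid n) \<omega>) J)"

lemma walk_law_eq:
  assumes "J \<subseteq> grid n"
  shows "walk_law J = distr gauss_seq (PiM J (\<lambda>_. borel)) (\<lambda>\<omega>. restrict (walk n \<omega>) J)"
  unfolding walk_law_def using distr_walk_le[OF LeastI[of "\<lambda>n. J \<subseteq> grid n", OF assms] Least_le, OF assms]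
  by simp

lemma finite_subset_grid:
  assumes "finite J" "J \<subseteq> (\<Union>n. grid n)"
  obtains n where "J \<subseteq> grid n"
proof -
  have "\<exists>n. J \<subseteq> grid n" using assms
  proof (induction J)
    case (insert x J)
    then obtain n m where "J \<subseteq> grid n" "x \<in> grid m" by auto
    then have "insert x J \<subseteq> grid (max n m)"
      using grid_mono[of n "max n m"] grid_mono[of m "max n m"] by auto
    then show ?case by blast
  qed auto
  then show ?thesis using that by blast
qed

text \<open>Finitely many dyadic times lie in one common grid, and there the marginals on
  \<open>H\<close> and on \<open>J\<close> are images of the same walk. This is the required
  consistency.\<close>

interpretation walk_limit: polish_projective "\<Union>n. grid n" walk_law
proof (rule polish_projective.intro, rule projective_family.intro)
  fix J H :: "real set" assume *: "J \<subseteq> H" "finite H" "H \<subseteq> (\<Union>n. grid n)"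
  obtain n where n: "H \<subseteq> grid n" using finite_subset_grid[of H] * by blast
  have "distr (walk_law H) (PiM J (\<lambda>_. borel)) (\<lambda>f. restrict f J) =
     distr gauss_seq (PiM J (\<lambda>_. borel)) ((\<lambda>f. restrict f J) \<circ> (\<lambda>\<omega>. restrict (walk n \<omega>) H))"
    unfolding walk_law_eq[OF n]
    by (rule distr_distr) (auto intro!: measurable_restrict measurable_component_singleton simp: subsetD[OF *(1)])
  also have "((\<lambda>f. restrict f J) \<circ> (\<lambda>\<omega>. restrict (walk n \<omega>) H)) = (\<lambda>\<omega>. restrict (walk n \<omega>) J)"
    using * by (auto simp: fun_eq_iff restrict_def)
  finally show "walk_law J = distr (walk_law H) (PiM J (\<lambda>_. borel)) (\<lambda>f. restrict f J)"
    using walk_law_eq[of J n] n * by (metis subset_trans)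
next
  fix J :: "real set"
  show "prob_space (walk_law J)"
    unfolding walk_law_def by (rule gauss_seq.P.prob_space_distr) (auto intro!: measurable_restrict)
qed

lemma distr_walk_limit:
  assumes "finite J" "J \<subseteq> grid n"
  shows "distr walk_limit.lim (PiM J (\<lambda>_. borel)) (\<lambda>f. restrict f J) =
    distr gauss_seq (PiM J (\<lambda>_. borel)) (\<lambda>\<omega>. restrict (walk n \<omega>) J)"
proof -
  have J: "J \<subseteq> (\<Union>n. grid n)" using assms by auto
  have [measurable]: "(\<lambda>f. restrict f J) \<in> measurable walk_limit.lim (PiM J (\<lambda>_. borel))"
    unfolding measurable_cong_sets[OF walk_limit.sets_lim refl]
    by (rule measurable_restrict_subset[OF J])
  have "distr walk_limit.lim (PiM J (\<lambda>_. borel)) (\<lambda>f. restrict f J) = walk_law J"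
  proof (rule measure_eqI)
    fix A assume "A \<in> sets (distr walk_limit.lim (PiM J (\<lambda>_. borel)) (\<lambda>f. restrict f J))"
    then have A: "A \<in> sets (PiM J (\<lambda>_. borel))" by simp
    then show "emeasure (distr walk_limit.lim (PiM J (\<lambda>_. borel)) (\<lambda>f. restrict f J)) A = emeasure (walk_law J) A"
      using walk_limit.emeasure_lim_emb[OF J assms(1) A]
      by (simp add: emeasure_distr prod_emb_def space_PiM)
  qed (simp add: walk_law_def)
  then show ?thesis by (simp add: walk_law_eq[OF assms(2)])
qed

section \<open>Almost sure limits\<close>

text \<open>Expectations of products of bounded continuous functions factorise for
  \<open>X n\<close>, and dominated convergence passes this on to \<open>Y\<close>. Approximating
  indicators of half-lines by continuous steps then gives the product rule on a generator of the
  Borel sets.\<close>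

lemma (in prob_space) indep_vars_AE_limit:
  fixes Y :: "'i \<Rightarrow> 'a \<Rightarrow> real"
  assumes "finite I"
    and indep: "\<And>n. indep_vars (\<lambda>_. borel) (X n) I"
    and [measurable]: "\<And>i. i \<in> I \<Longrightarrow> Y i \<in> borel_measurable M"
    and lim: "AE \<omega> in M. \<forall>i\<in>I. (\<lambda>n. X n i \<omega>) \<longlonglongrightarrow> Y i \<omega>"
  shows "indep_vars (\<lambda>_. borel) Y I"
proof (cases "I = {}")
  case True
  then show ?thesis by (simp add: indep_vars_def indep_sets_def)
next
  case False
  have X_meas [measurable]: "X n i \<in> borel_measurable M" if "i \<in> I" for n i
    using indep[of n] that by (auto simp: indep_vars_def)
  have cont: "(\<integral>\<omega>. (\<Prod>i\<in>I. h i (Y i \<omega>)) \<partial>M) = (\<Prod>i\<in>I. \<integral>\<omega>. h i (Y i \<omega>) \<partial>M)"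
    if h: "\<And>i. i \<in> I \<Longrightarrow> continuous_on UNIV (h i)" and b: "\<And>i x. \<bar>h i x\<bar> \<le> 1"
    for h :: "'i \<Rightarrow> real \<Rightarrow> real"
  proof -
    have [measurable]: "h i \<in> borel_measurable borel" if "i \<in> I" for i
      using h[OF that] by (rule borel_measurable_continuous_onI)
    have ti: "(\<lambda>n. h i (X n i \<omega>)) \<longlonglongrightarrow> h i (Y i \<omega>)" if "(\<lambda>n. X n i \<omega>) \<longlonglongrightarrow> Y i \<omega>" "i \<in> I" for i \<omega>
      using continuous_on_tendsto_compose[OF h[OF that(2)] that(1)] by simp
    have pb: "\<bar>\<Prod>i\<in>I. h i (g i)\<bar> \<le> 1" for g
      by (simp add: abs_prod prod_le_1 b)
    have "(\<lambda>n. \<integral>\<omega>. (\<Prod>i\<in>I. h i (X n i \<omega>)) \<partial>M) \<longlonglongrightarrow> (\<integral>\<omega>. (\<Prod>i\<in>I. h i (Y i \<omega>)) \<partial>M)"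
    proof (rule integral_dominated_convergence[where w="\<lambda>_. 1"])
      show "AE \<omega> in M. (\<lambda>n. \<Prod>i\<in>I. h i (X n i \<omega>)) \<longlonglongrightarrow> (\<Prod>i\<in>I. h i (Y i \<omega>))"
        using lim by eventually_elim (intro tendsto_prod ti, auto)
    qed (auto simp: pb)
    moreover have "(\<lambda>n. \<Prod>i\<in>I. \<integral>\<omega>. h i (X n i \<omega>) \<partial>M) \<longlonglongrightarrow> (\<Prod>i\<in>I. \<integral>\<omega>. h i (Y i \<omega>) \<partial>M)"
    proof (rule tendsto_prod, rule integral_dominated_convergence[where w="\<lambda>_. 1"])
      fix i assume "i \<in> I"
      show "AE \<omega> in M. (\<lambda>n. h i (X n i \<omega>)) \<longlonglongrightarrow> h i (Y i \<omega>)"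
        using lim by eventually_elim (use \<open>i \<in> I\<close> in \<open>intro ti, auto\<close>)
    qed (auto simp: b)
    moreover have "(\<integral>\<omega>. (\<Prod>i\<in>I. h i (X n i \<omega>)) \<partial>M) = (\<Prod>i\<in>I. \<integral>\<omega>. h i (X n i \<omega>) \<partial>M)" for n
    proof (rule indep_vars_lebesgue_integral)
      show "indep_vars (\<lambda>_. borel) (\<lambda>i \<omega>. h i (X n i \<omega>)) I"
        by (rule indep_vars_compose2[OF indep]) auto
      show "integrable M (\<lambda>\<omega>. h i (X n i \<omega>))" if "i \<in> I" for i
        using that by (intro integrable_const_bound[of _ 1]) (auto simp: b)
    qed fact
    ultimately show ?thesis using LIMSEQ_unique by auto
  qed
  \<comment> \<open>\<open>UNIV\<close> joins the half-lines because
    \<open>indep_vars_finite\<close> wants the whole space in the generator.\<close>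
  let ?E = "insert UNIV (range atMost) :: real set set"
  have key: "prob (\<Inter>j\<in>I. Y j -` A j \<inter> space M) = (\<Prod>j\<in>I. prob (Y j -` A j \<inter> space M))"
    if A: "A \<in> (\<Pi> i\<in>I. ?E)" for A
  proof -
    have "\<exists>h. (\<forall>m. continuous_on UNIV (h m)) \<and> (\<forall>m x. \<bar>h m x\<bar> \<le> 1) \<and> (\<forall>x. (\<lambda>m. h m x) \<longlonglongrightarrow> indicat_real (A i) x)"
      if "i \<in> I" for i
    proof (cases "A i = UNIV")
      case True
      then show ?thesis by (intro exI[of _ "\<lambda>_ _. 1"]) auto
    next
      case False
      moreover have "A i \<in> ?E" using A that by (rule Pi_mem)
      ultimately obtain a where a: "A i = {..a}" by blast
      define h where "h m = cts_step a (a + 1 / real (Suc m))" for m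
      have "(\<lambda>m. h m x) \<longlonglongrightarrow> indicat_real {..a} x" for x
      proof (cases "x \<le> a")
        case True
        then show ?thesis by (simp add: h_def cts_step_def)
      next
        case False
        then have "\<forall>\<^sub>F m in sequentially. 1 / real (Suc m) < x - a"
          by (intro order_tendstoD(2)[OF LIMSEQ_Suc[OF lim_1_over_n]]) auto
        then have "\<forall>\<^sub>F m in sequentially. h m x = indicat_real {..a} x"
          by eventually_elim (use False in \<open>auto simp: h_def cts_step_def\<close>)
        then show ?thesis by (rule tendsto_eventually)
      qed
      moreover have "continuous_on UNIV (h m)" for m
        unfolding h_def by (intro uniformly_continuous_imp_continuous cts_step_uniformly_continuous) auto
      moreover have "\<bar>h m x\<bar> \<le> 1" for m x
      proof -
        have "\<bar>cts_step a b x\<bar> \<le> 1" if "a < b" for b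
          using that by (auto simp: cts_step_def divide_le_eq)
        then show ?thesis by (simp add: h_def)
      qed
      ultimately show ?thesis unfolding a by blast
    qed
    then obtain h where h: "\<And>i m. i \<in> I \<Longrightarrow> continuous_on UNIV (h i m)"
      "\<And>i m x. i \<in> I \<Longrightarrow> \<bar>h i m x\<bar> \<le> (1::real)" "\<And>i x. i \<in> I \<Longrightarrow> (\<lambda>m. h i m x) \<longlonglongrightarrow> indicat_real (A i) x"
      by metis
    have [measurable]: "h i m \<in> borel_measurable borel" if "i \<in> I" for i m
      using h(1)[OF that] by (rule borel_measurable_continuous_onI)
    have [measurable]: "A i \<in> sets borel" if "i \<in> I" for i
    proof -
      have "A i \<in> ?E" using A that by (rule Pi_mem)
      then show ?thesis by auto
    qed
    have "(\<lambda>m. \<integral>\<omega>. (\<Prod>i\<in>I. h i m (Y i \<omega>)) \<partial>M) \<longlonglongrightarrow> (\<integral>\<omega>. (\<Prod>i\<in>I. indicat_real (A i) (Y i \<omega>)) \<partial>M)"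
    proof (rule integral_dominated_convergence[where w="\<lambda>_. 1"])
      show "AE \<omega> in M. (\<lambda>m. \<Prod>i\<in>I. h i m (Y i \<omega>)) \<longlonglongrightarrow> (\<Prod>i\<in>I. indicat_real (A i) (Y i \<omega>))"
        using h by (auto intro!: tendsto_prod)
      show "AE \<omega> in M. norm (\<Prod>i\<in>I. h i m (Y i \<omega>)) \<le> 1" for m
        by (auto simp: abs_prod h intro!: prod_le_1)
    qed auto
    moreover have "(\<lambda>m. \<Prod>i\<in>I. \<integral>\<omega>. h i m (Y i \<omega>) \<partial>M) \<longlonglongrightarrow> (\<Prod>i\<in>I. \<integral>\<omega>. indicat_real (A i) (Y i \<omega>) \<partial>M)"
      by (rule tendsto_prod, rule integral_dominated_convergence[where w="\<lambda>_. 1"]) (auto simp: h)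
    moreover have "(\<integral>\<omega>. (\<Prod>i\<in>I. h i m (Y i \<omega>)) \<partial>M) = (\<Prod>i\<in>I. \<integral>\<omega>. h i m (Y i \<omega>) \<partial>M)" for m
    proof -
      \<comment> \<open>\<open>cont\<close> asks for a bound at every index, but the chosen
        \<open>h\<close> is controlled on \<open>I\<close> only; elsewhere it is replaced by
        0.\<close>
      define h' where "h' i x = (if i \<in> I then h i m x else 0)" for i x
      have "(\<integral>\<omega>. (\<Prod>i\<in>I. h' i (Y i \<omega>)) \<partial>M) = (\<Prod>i\<in>I. \<integral>\<omega>. h' i (Y i \<omega>) \<partial>M)"
        by (rule cont) (auto simp: h'_def[abs_def] h)
      then show ?thesis by (simp add: h'_def cong: prod.cong)
    qed
    ultimately have "(\<integral>\<omega>. (\<Prod>i\<in>I. indicat_real (A i) (Y i \<omega>)) \<partial>M) = (\<Prod>i\<in>I. \<integral>\<omega>. indicat_real (A i) (Y i \<omega>) \<partial>M)"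
      using LIMSEQ_unique by auto
    moreover have "(\<integral>\<omega>. (\<Prod>i\<in>I. indicat_real (A i) (Y i \<omega>)) \<partial>M) = prob (\<Inter>j\<in>I. Y j -` A j \<inter> space M)"
    proof -
      have m: "(\<Inter>j\<in>I. Y j -` A j \<inter> space M) \<in> sets M"
        using \<open>finite I\<close> False by (intro sets.finite_INT) auto
      have "(\<Prod>i\<in>I. indicat_real (A i) (Y i \<omega>)) = indicator (\<Inter>j\<in>I. Y j -` A j \<inter> space M) \<omega>" if "\<omega> \<in> space M" for \<omega>
        using that \<open>finite I\<close> by (auto simp: indicator_def prod_zero_iff)
      then have "(\<integral>\<omega>. (\<Prod>i\<in>I. indicat_real (A i) (Y i \<omega>)) \<partial>M) = (\<integral>\<omega>. indicator (\<Inter>j\<in>I. Y j -` A j \<inter> space M) \<omega> \<partial>M)"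
        by (intro Bochner_Integration.integral_cong) auto
      then show ?thesis using m by simp
    qed
    moreover have "(\<integral>\<omega>. indicat_real (A i) (Y i \<omega>) \<partial>M) = prob (Y i -` A i \<inter> space M)" if "i \<in> I" for i
    proof -
      have "(\<integral>\<omega>. indicat_real (A i) (Y i \<omega>) \<partial>M) = (\<integral>\<omega>. indicat_real (Y i -` A i \<inter> space M) \<omega> \<partial>M)"
        by (intro Bochner_Integration.integral_cong) (auto simp: indicator_def)
      also have "\<dots> = prob (Y i -` A i \<inter> space M)"
        using that by simp
      finally show ?thesis .
    qed
    ultimately show ?thesis by simp
  qed
  show ?thesis
  proof (subst indep_vars_finite[where E="\<lambda>_. ?E"])
    show "sets borel = sigma_sets (space borel) ?E"
    proof
      show "sets borel \<subseteq> sigma_sets (space borel) ?E"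
        unfolding borel_eq_atMost by (simp add: sigma_sets_mono' subset_insertI)
      show "sigma_sets (space borel) ?E \<subseteq> sets borel"
        using sets.sigma_sets_subset[of ?E borel] by (simp add: image_subset_iff)
    qed
    show "Int_stable ?E"
      by (auto simp: Int_stable_def)
  qed (use False \<open>finite I\<close> key in auto)
qed

lemma iexp_normal:
  assumes "prob_space M" and X: "distributed M lborel X (normal_density 0 \<sigma>)" and "0 < \<sigma>"
  shows "(\<integral>\<omega>. iexp (u * X \<omega>) \<partial>M) = complex_of_real (exp (- (u\<^sup>2 * \<sigma>\<^sup>2) / 2))"
proof -
  interpret prob_space M by fact
  have [measurable]: "X \<in> borel_measurable M"
    using distributed_measurable[OF X] by simp
  have "distributed M lborel (\<lambda>\<omega>. 0 + 1 / \<sigma> * X \<omega>) (normal_density (0 + 1 / \<sigma> * 0) (\<bar>1 / \<sigma>\<bar> * \<sigma>))"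
    using \<open>0 < \<sigma>\<close> by (intro normal_density_affine[OF X]) auto
  then have "distributed M lborel (\<lambda>\<omega>. X \<omega> / \<sigma>) std_normal_density"
    using \<open>0 < \<sigma>\<close> by simp
  from distributed_distr_eq_density[OF this]
  have "char (distr M lborel (\<lambda>\<omega>. X \<omega> / \<sigma>)) (u * \<sigma>) = complex_of_real (exp (- ((u * \<sigma>)\<^sup>2) / 2))"
    by (simp add: char_std_normal_distribution)
  moreover have "char (distr M lborel (\<lambda>\<omega>. X \<omega> / \<sigma>)) (u * \<sigma>) = (\<integral>\<omega>. iexp (u * X \<omega>) \<partial>M)"
    unfolding char_def using \<open>0 < \<sigma>\<close> by (subst integral_distr) auto
  ultimately show ?thesis by (simp add: power_mult_distrib)
qed

text \<open>Characteristic functions converge by dominated convergence, and their limit is that of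
  the normal law with deviation \<open>\<tau>\<close>; uniqueness then identifies the law of
  \<open>Y\<close>.\<close>

lemma (in prob_space) normal_AE_limit:
  fixes X :: "nat \<Rightarrow> 'a \<Rightarrow> real"
  assumes X: "\<And>n. distributed M lborel (X n) (normal_density 0 (\<sigma> n))" "\<And>n. 0 < \<sigma> n"
    and lim: "AE \<omega> in M. (\<lambda>n. X n \<omega>) \<longlonglongrightarrow> Y \<omega>" "\<sigma> \<longlonglongrightarrow> \<tau>" "0 < \<tau>"
    and [measurable]: "Y \<in> borel_measurable M"
  shows "distributed M lborel Y (normal_density 0 \<tau>)"
proof -
  have [measurable]: "X n \<in> borel_measurable M" for n
    using distributed_measurable[OF X(1)] by simp
  let ?N = "density lborel (normal_density 0 \<tau>)"
  have N: "prob_space ?N" using \<open>0 < \<tau>\<close> by (rule prob_space_normal_density)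
  have "distributed ?N lborel (\<lambda>x. x) (normal_density 0 \<tau>)"
    by (auto simp: distributed_def intro!: distr_id2)
  note char_N = iexp_normal[OF N this \<open>0 < \<tau>\<close>]
  have "distr M borel Y = ?N"
  proof (rule Levy_uniqueness)
    show "real_distribution (distr M borel Y)"
      by (rule real_distribution_distr) simp
    show "real_distribution ?N"
      using N by (simp add: real_distribution_def real_distribution_axioms_def)
    show "char (distr M borel Y) = char ?N"
    proof
      fix u
      have "(\<lambda>n. \<integral>\<omega>. iexp (u * X n \<omega>) \<partial>M) \<longlonglongrightarrow> (\<integral>\<omega>. iexp (u * Y \<omega>) \<partial>M)"
      proof (rule integral_dominated_convergence[where w="\<lambda>_. 1"])
        show "AE \<omega> in M. (\<lambda>n. iexp (u * X n \<omega>)) \<longlonglongrightarrow> iexp (u * Y \<omega>)"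
          using lim(1) by eventually_elim (intro tendsto_intros)
      qed auto
      moreover have "(\<lambda>n. \<integral>\<omega>. iexp (u * X n \<omega>) \<partial>M) \<longlonglongrightarrow> complex_of_real (exp (- (u\<^sup>2 * \<tau>\<^sup>2) / 2))"
        unfolding iexp_normal[OF prob_space_axioms X] by (intro tendsto_intros lim) simp
      ultimately have "(\<integral>\<omega>. iexp (u * Y \<omega>) \<partial>M) = complex_of_real (exp (- (u\<^sup>2 * \<tau>\<^sup>2) / 2))"
        by (rule LIMSEQ_unique)
      then show "char (distr M borel Y) u = char ?N u"
        unfolding char_def char_N by (subst integral_distr) auto
    qed
  qed
  then show ?thesis
    by (auto simp: distributed_def cong: distr_cong)
qed

lemma (in prob_space) chaining_tail:
  fixes \<Delta> :: "nat \<Rightarrow> nat \<Rightarrow> 'a \<Rightarrow> real"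
  assumes \<Delta>: "\<And>n k. distributed M lborel (\<Delta> n k) (normal_density 0 (sqrt (1 / 2 ^ n)))"
    and A: "1 \<le> A"
  shows "prob {\<omega>\<in>space M. \<exists>n k. k \<le> N * 2 ^ n \<and> A * (4/5) ^ n < \<bar>\<Delta> n k \<omega>\<bar>}
    \<le> (\<Sum>n. real (N * 2 ^ n + 1) * (2 * exp (- ((32/25) ^ n) / 4))) * exp (- A\<^sup>2 / 4)"
proof -
  have [measurable]: "\<Delta> n k \<in> borel_measurable M" for n k
    using distributed_measurable[OF \<Delta>] by simp
  define B where "B n = (\<Union>k\<in>{..N * 2 ^ n}. {\<omega>\<in>space M. A * (4/5) ^ n < \<bar>\<Delta> n k \<omega>\<bar>})" for n
  have [measurable]: "B n \<in> sets M" for n unfolding B_def by measurable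
  let ?b = "\<lambda>n. real (N * 2 ^ n + 1) * (2 * exp (- ((32/25) ^ n) / 4))"
  have Bn: "prob (B n) \<le> ?b n * exp (- A\<^sup>2 / 4)" for n
  proof -
    have "prob (B n) \<le> (\<Sum>k\<in>{..N * 2 ^ n}. prob {\<omega>\<in>space M. A * (4/5) ^ n < \<bar>\<Delta> n k \<omega>\<bar>})"
      unfolding B_def by (rule finite_measure_subadditive_finite) auto
    also have "\<dots> \<le> (\<Sum>k\<in>{..N * 2 ^ n}. 2 * exp (- ((32/25) ^ n) / 4) * exp (- A\<^sup>2 / 4))"
    proof (rule sum_mono)
      fix k
      have "prob {\<omega>\<in>space M. A * (4/5) ^ n < \<bar>\<Delta> n k \<omega>\<bar>} \<le> 2 * exp (- (A * (4/5) ^ n)\<^sup>2 / (2 * (sqrt (1 / 2 ^ n))\<^sup>2))"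
        using A by (intro normal_upper_tail[OF \<Delta>]) auto
      also have "- (A * (4/5) ^ n)\<^sup>2 / (2 * (sqrt (1 / 2 ^ n))\<^sup>2) = - (A\<^sup>2 * (32/25) ^ n / 2)"
      proof -
        have "((4/5) ^ n)\<^sup>2 * 2 ^ n = (32/25::real) ^ n"
          by (simp add: power2_eq_square flip: power_mult_distrib)
        then show ?thesis by (simp add: power_mult_distrib)
      qed
      \<comment> \<open>Both \<open>A^2\<close> and \<open>(32/25) ^ n\<close> are at least 1, so
        half of their product dominates the average of a half of each: one part pays for the sum
        over \<open>n\<close>, the other is the decay in \<open>A\<close>.\<close>
      also have "2 * exp (- (A\<^sup>2 * (32/25) ^ n / 2)) \<le> 2 * exp (- ((32/25) ^ n) / 4 + - A\<^sup>2 / 4)"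
      proof -
        have p: "1 \<le> (32/25::real) ^ n" by (rule one_le_power) simp
        have "1 \<le> A\<^sup>2" using A by (rule one_le_power)
        then have "1 * (32/25) ^ n \<le> A\<^sup>2 * (32/25) ^ n" by (rule mult_right_mono) simp
        moreover have "A\<^sup>2 * 1 \<le> A\<^sup>2 * (32/25) ^ n" using p by (intro mult_left_mono) auto
        ultimately have "- (A\<^sup>2 * (32/25) ^ n / 2) \<le> - ((32/25) ^ n) / 4 + - A\<^sup>2 / 4" by linarith
        then show ?thesis by (simp only: exp_le_cancel_iff mult_le_cancel_left_pos zero_less_numeral)
      qed
      also have "\<dots> = 2 * exp (- ((32/25) ^ n) / 4) * exp (- A\<^sup>2 / 4)" by (simp only: exp_add mult.assoc)
      finally show "prob {\<omega>\<in>space M. A * (4/5) ^ n < \<bar>\<Delta> n k \<omega>\<bar>} \<le> 2 * exp (- ((32/25) ^ n) / 4) * exp (- A\<^sup>2 / 4)" .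
    qed
    finally show ?thesis by (simp add: algebra_simps)
  qed
  have sm: "summable (\<lambda>n. ?b n * exp (- A\<^sup>2 / 4))"
    by (rule summable_mult2[OF summable_chaining])
  have sB: "summable (\<lambda>n. prob (B n))"
    by (rule summable_comparison_test'[OF sm, of 0]) (use Bn in auto)
  have "{\<omega>\<in>space M. \<exists>n k. k \<le> N * 2 ^ n \<and> A * (4/5) ^ n < \<bar>\<Delta> n k \<omega>\<bar>} = (\<Union>n. B n)"
    by (auto simp: B_def)
  then have "prob {\<omega>\<in>space M. \<exists>n k. k \<le> N * 2 ^ n \<and> A * (4/5) ^ n < \<bar>\<Delta> n k \<omega>\<bar>} \<le> (\<Sum>n. prob (B n))"
    using finite_measure_subadditive_countably[OF _ sB] by (simp add: image_subset_iff)
  also have "\<dots> \<le> (\<Sum>n. ?b n * exp (- A\<^sup>2 / 4))"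
    by (rule suminf_le[OF Bn sB sm])
  also have "\<dots> = (\<Sum>n. ?b n) * exp (- A\<^sup>2 / 4)"
    by (rule suminf_mult2[OF summable_chaining, symmetric])
  finally show ?thesis .
qed

text \<open>If no natural \<open>A\<close> works, then the event of \<open>chaining_tail\<close>
  occurs for every \<open>A\<close>, and its probability tends to 0. Restricting to natural
  \<open>A\<close> keeps the statement a countable combination of events.\<close>

lemma (in prob_space) chaining_AE:
  fixes \<Delta> :: "nat \<Rightarrow> nat \<Rightarrow> 'a \<Rightarrow> real"
  assumes \<Delta>: "\<And>n k. distributed M lborel (\<Delta> n k) (normal_density 0 (sqrt (1 / 2 ^ n)))"
  shows "AE \<omega> in M. \<exists>A::nat. \<forall>n k. k \<le> N * 2 ^ n \<longrightarrow> \<bar>\<Delta> n k \<omega>\<bar> \<le> real A * (4/5) ^ n"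
proof -
  have [measurable]: "\<Delta> n k \<in> borel_measurable M" for n k
    using distributed_measurable[OF \<Delta>] by simp
  let ?P = "\<lambda>\<omega>. \<exists>A::nat. \<forall>n k. k \<le> N * 2 ^ n \<longrightarrow> \<bar>\<Delta> n k \<omega>\<bar> \<le> real A * (4/5) ^ n"
  define C where "C = (\<Sum>n. real (N * 2 ^ n + 1) * (2 * exp (- ((32/25) ^ n) / 4)))"
  have [measurable]: "Measurable.pred M ?P" by measurable
  define p where "p = prob {\<omega>\<in>space M. \<not> ?P \<omega>}"
  have p: "p \<le> C * exp (- (real A)\<^sup>2 / 4)" if "1 \<le> A" for A :: nat
  proof -
    have "p \<le> prob {\<omega>\<in>space M. \<exists>n k. k \<le> N * 2 ^ n \<and> real A * (4/5) ^ n < \<bar>\<Delta> n k \<omega>\<bar>}"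
      unfolding p_def
    proof (rule finite_measure_mono)
      show "{\<omega>\<in>space M. \<not> ?P \<omega>} \<subseteq> {\<omega>\<in>space M. \<exists>n k. k \<le> N * 2 ^ n \<and> real A * (4/5) ^ n < \<bar>\<Delta> n k \<omega>\<bar>}"
        by (force simp: not_le)
    qed measurable
    also have "\<dots> \<le> C * exp (- (real A)\<^sup>2 / 4)"
      unfolding C_def using that by (intro chaining_tail \<Delta>) auto
    finally show ?thesis .
  qed
  have "(\<lambda>A::nat. C * exp (- (real A)\<^sup>2 / 4)) \<longlonglongrightarrow> 0"
    by real_asymp
  then have "p \<le> 0"
    by (rule LIMSEQ_le_const) (use p in blast)
  then have "prob {\<omega>\<in>space M. \<not> ?P \<omega>} = 0"
    unfolding p_def by (simp only: measure_le_0_iff)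
  then show ?thesis
    by (intro AE_I[OF subset_refl]) (simp only: emeasure_eq_measure ennreal_0, measurable)
qed

section \<open>Existence of Brownian motion\<close>

abbreviation dyadic_law :: "(real \<Rightarrow> real) measure" where
  "dyadic_law \<equiv> walk_limit.lim"

lemma grid_mem [simp]: "real k / 2 ^ n \<in> grid n"
  by (simp add: grid_def)

lemma measurable_gauss_seq_sum [measurable]: "(\<lambda>\<omega>. sum \<omega> K) \<in> borel_measurable gauss_seq"
proof -
  have "(\<lambda>\<omega>. \<Sum>i\<in>K. \<omega> i) \<in> borel_measurable gauss_seq" by measurable
  then show ?thesis by simp
qed

text \<open>The syntactic form \<open>real k / 2 ^ n\<close> certifies that the time is dyadic. This
  is why \<open>limit_path\<close> spells the time 0 as \<open>real 0 / 2 ^ 0\<close>.\<close>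

lemma measurable_dyadic_law [measurable]: "(\<lambda>\<omega>. \<omega> (real k / 2 ^ n)) \<in> borel_measurable dyadic_law"
  unfolding measurable_cong_sets[OF walk_limit.sets_lim refl]
  by (rule measurable_component_singleton) (use grid_mem in blast)

lemma walk_increment:
  assumes "k \<le> l"
  shows "walk n \<omega> (real l / 2 ^ n) - walk n \<omega> (real k / 2 ^ n) = 1 / sqrt (2 ^ n) * (\<Sum>i\<in>{k..<l}. \<omega> i)"
proof -
  have "(\<Sum>i<l. \<omega> i) = (\<Sum>i<k. \<omega> i) + (\<Sum>i\<in>{k..<l}. \<omega> i)"
    using sum.atLeastLessThan_concat[of 0 k l \<omega>] assms by (simp add: atLeast0LessThan)
  then show ?thesis by (simp add: walk_def algebra_simps add_divide_distrib)
qed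

text \<open>The increments depend on finitely many coordinates of a single grid, so they may be
  computed on the walk of mesh \<open>2^-n\<close>, where they are sums over consecutive blocks of
  the Gaussian sequence.\<close>

lemma dyadic_law_increments:
  fixes k :: "nat \<Rightarrow> nat"
  assumes k: "\<And>i. i < m \<Longrightarrow> k i \<le> k (Suc i)"
  shows "distr dyadic_law (PiM {..<m} (\<lambda>_. borel)) (\<lambda>\<omega>. \<lambda>i\<in>{..<m}. \<omega> (real (k (Suc i)) / 2 ^ n) - \<omega> (real (k i) / 2 ^ n)) =
    distr gauss_seq (PiM {..<m} (\<lambda>_. borel)) (\<lambda>\<omega>. \<lambda>i\<in>{..<m}. 1 / sqrt (2 ^ n) * (\<Sum>j\<in>{k i..<k (Suc i)}. \<omega> j))"
proof -
  define J where "J = (\<lambda>i. real (k i) / 2 ^ n) ` {..m}"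
  have J: "finite J" "J \<subseteq> grid n" by (auto simp: J_def)
  have J': "J \<subseteq> (\<Union>n. grid n)" using J by blast
  define F :: "(real \<Rightarrow> real) \<Rightarrow> nat \<Rightarrow> real" where
    "F x = (\<lambda>i\<in>{..<m}. x (real (k (Suc i)) / 2 ^ n) - x (real (k i) / 2 ^ n))" for x
  have F [measurable]: "F \<in> measurable (PiM J (\<lambda>_. borel)) (PiM {..<m} (\<lambda>_. borel))"
    unfolding F_def[abs_def]
    by (intro measurable_restrict borel_measurable_diff measurable_component_singleton) (auto simp: J_def)
  have Fr: "F (restrict x J) = F x" for x
    by (auto simp: F_def J_def fun_eq_iff restrict_def)
  have [measurable]: "(\<lambda>f. restrict f J) \<in> measurable dyadic_law (PiM J (\<lambda>_. borel))"
    unfolding measurable_cong_sets[OF walk_limit.sets_lim refl]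
    by (rule measurable_restrict_subset[OF J'])
  have [measurable]: "(\<lambda>\<omega>. restrict (walk n \<omega>) J) \<in> measurable gauss_seq (PiM J (\<lambda>_. borel))"
    by (auto intro!: measurable_restrict)
  have "distr (distr dyadic_law (PiM J (\<lambda>_. borel)) (\<lambda>f. restrict f J)) (PiM {..<m} (\<lambda>_. borel)) F =
    distr (distr gauss_seq (PiM J (\<lambda>_. borel)) (\<lambda>\<omega>. restrict (walk n \<omega>) J)) (PiM {..<m} (\<lambda>_. borel)) F"
    by (simp add: distr_walk_limit[OF J])
  then have "distr dyadic_law (PiM {..<m} (\<lambda>_. borel)) F = distr gauss_seq (PiM {..<m} (\<lambda>_. borel)) (\<lambda>\<omega>. F (walk n \<omega>))"
    by (simp add: distr_distr comp_def Fr)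
  also have "(\<lambda>\<omega>. F (walk n \<omega>)) = (\<lambda>\<omega>. \<lambda>i\<in>{..<m}. 1 / sqrt (2 ^ n) * (\<Sum>j\<in>{k i..<k (Suc i)}. \<omega> j))"
    by (auto simp: F_def fun_eq_iff restrict_def walk_increment[OF k])
  finally show ?thesis unfolding F_def[abs_def] .
qed

lemma dyadic_law_increment_distr:
  assumes "k \<le> l"
  shows "distr dyadic_law borel (\<lambda>\<omega>. \<omega> (real l / 2 ^ n) - \<omega> (real k / 2 ^ n)) =
    distr gauss_seq borel (\<lambda>\<omega>. 1 / sqrt (2 ^ n) * (\<Sum>j\<in>{k..<l}. \<omega> j))"
proof -
  let ?k = "\<lambda>i. if i = 0 then k else l"
  let ?D = "\<lambda>\<omega>::real \<Rightarrow> real. \<lambda>i\<in>{..<1}. \<omega> (real (?k (Suc i)) / 2 ^ n) - \<omega> (real (?k i) / 2 ^ n) :: real"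
  let ?G = "\<lambda>\<omega>::nat \<Rightarrow> real. \<lambda>i\<in>{..<1}. 1 / sqrt (2 ^ n) * (\<Sum>j\<in>{?k i..<?k (Suc i)}. \<omega> j) :: real"
  have "distr dyadic_law (PiM {..<1} (\<lambda>_. borel)) ?D = distr gauss_seq (PiM {..<1} (\<lambda>_. borel)) ?G"
    by (rule dyadic_law_increments) (use assms in auto)
  then have "distr (distr dyadic_law (PiM {..<1} (\<lambda>_. borel)) ?D) borel (\<lambda>x. x 0) =
    distr (distr gauss_seq (PiM {..<1} (\<lambda>_. borel)) ?G) borel (\<lambda>x. x 0)" by simp
  moreover have "(\<lambda>x. x 0) \<in> borel_measurable (PiM {..<1::nat} (\<lambda>_. borel))"
    by (rule measurable_component_singleton) simp
  moreover have "?D \<in> measurable dyadic_law (PiM {..<1} (\<lambda>_. borel))"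
    by (intro measurable_restrict borel_measurable_diff measurable_dyadic_law)
  moreover have "?G \<in> measurable gauss_seq (PiM {..<1} (\<lambda>_. borel))"
    by (intro measurable_restrict borel_measurable_times borel_measurable_const measurable_gauss_seq_sum)
  ultimately show ?thesis
    by (simp add: distr_distr comp_def)
qed

lemma dyadic_law_increment_normal:
  assumes "k < l"
  shows "distributed dyadic_law lborel (\<lambda>\<omega>. \<omega> (real l / 2 ^ n) - \<omega> (real k / 2 ^ n))
    (normal_density 0 (sqrt (real (l - k) / 2 ^ n)))"
proof -
  have "distributed gauss_seq lborel (\<lambda>\<omega>. 1 / sqrt (2 ^ n) * (\<Sum>j\<in>{k..<l}. \<omega> j))
    (normal_density 0 (\<bar>1 / sqrt (2 ^ n)\<bar> * sqrt (card {k..<l})))"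
    using assms by (intro gauss_seq_sum_normal) auto
  also have "\<bar>1 / sqrt (2 ^ n)\<bar> * sqrt (card {k..<l}) = sqrt (real (l - k) / 2 ^ n)"
    by (simp add: real_sqrt_divide)
  finally show ?thesis
    using dyadic_law_increment_distr[of k l n] assms
    by (simp add: distributed_def cong: distr_cong)
qed

text \<open>Disjoint blocks of the Gaussian sequence have independent sums, and the equality of
  joint laws carries this over. Monotonicity of \<open>k\<close> is weak because two times may share
  a dyadic floor at a coarse level.\<close>

lemma dyadic_law_increments_indep:
  fixes k :: "nat \<Rightarrow> nat"
  assumes k: "\<And>i. i < m \<Longrightarrow> k i \<le> k (Suc i)"
  shows "walk_limit.P.indep_vars (\<lambda>_. borel) (\<lambda>i \<omega>. \<omega> (real (k (Suc i)) / 2 ^ n) - \<omega> (real (k i) / 2 ^ n)) {..<m}"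
proof (cases "m = 0")
  case True
  then show ?thesis by (simp add: walk_limit.P.indep_vars_def walk_limit.P.indep_sets_def)
next
  case False
  have mono: "k i \<le> k j" if "i \<le> j" "j \<le> m" for i j
    using that(1)
  proof (induction j rule: dec_induct)
    case (step l)
    then show ?case using k[of l] that by linarith
  qed simp
  have "disjoint_family_on (\<lambda>i. {k i..<k (Suc i)}) {..<m}"
    unfolding disjoint_family_on_def
  proof (intro ballI impI)
    fix i j assume "i \<in> {..<m}" "j \<in> {..<m}" "i \<noteq> j"
    then consider "Suc i \<le> j" "j \<le> m" | "Suc j \<le> i" "i \<le> m" by force
    then show "{k i..<k (Suc i)} \<inter> {k j..<k (Suc j)} = {}"
      by cases (use mono[of "Suc i" j] mono[of "Suc j" i] in auto)
  qed
  from gauss_seq_sum_indep[OF this, of "1 / sqrt (2 ^ n)"]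
  have "distr gauss_seq (PiM {..<m} (\<lambda>_. borel)) (\<lambda>\<omega>. \<lambda>i\<in>{..<m}. 1 / sqrt (2 ^ n) * (\<Sum>j\<in>{k i..<k (Suc i)}. \<omega> j)) =
    (\<Pi>\<^sub>M i\<in>{..<m}. distr gauss_seq borel (\<lambda>\<omega>. 1 / sqrt (2 ^ n) * (\<Sum>j\<in>{k i..<k (Suc i)}. \<omega> j)))"
    by (subst (asm) gauss_seq.P.indep_vars_iff_distr_eq_PiM) (use False in \<open>simp_all add: lessThan_empty_iff\<close>)
  also have "\<dots> = (\<Pi>\<^sub>M i\<in>{..<m}. distr dyadic_law borel (\<lambda>\<omega>. \<omega> (real (k (Suc i)) / 2 ^ n) - \<omega> (real (k i) / 2 ^ n)))"
    by (intro PiM_cong) (auto simp: dyadic_law_increment_distr k)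
  finally show ?thesis
    using dyadic_law_increments[of m k n, OF k] False
    by (subst walk_limit.P.indep_vars_iff_distr_eq_PiM) auto
qed

text \<open>A countable combination of conditions on dyadic coordinates, hence an event of the
  projective limit, yet strong enough to extend the dyadic values to a continuous path. The constant
  may depend on the horizon \<open>N\<close>.\<close>

definition regular_path :: "(real \<Rightarrow> real) \<Rightarrow> bool" where
  "regular_path \<omega> \<longleftrightarrow> (\<forall>N::nat. \<exists>A::nat. \<forall>n k. k \<le> N * 2 ^ n \<longrightarrow>
     \<bar>\<omega> (real (Suc k) / 2 ^ n) - \<omega> (real k / 2 ^ n)\<bar> \<le> real A * (4/5) ^ n)"

lemma measurable_regular_path [measurable]: "Measurable.pred dyadic_law regular_path"
  unfolding regular_path_def[abs_def] by measurable

lemma AE_regular_path: "AE \<omega> in dyadic_law. regular_path \<omega>"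
proof -
  have "distributed dyadic_law lborel (\<lambda>\<omega>. \<omega> (real (Suc k) / 2 ^ n) - \<omega> (real k / 2 ^ n))
      (normal_density 0 (sqrt (1 / 2 ^ n)))" for n k
    using dyadic_law_increment_normal[of k "Suc k" n] by simp
  from walk_limit.P.chaining_AE[where \<Delta> = "\<lambda>n k \<omega>. \<omega> (real (Suc k) / 2 ^ n) - \<omega> (real k / 2 ^ n)", OF this] show ?thesis
    unfolding regular_path_def by (subst AE_all_countable) blast
qed

definition dyadic_floor :: "nat \<Rightarrow> real \<Rightarrow> real" where
  "dyadic_floor n t = real (nat \<lfloor>t * 2 ^ n\<rfloor>) / 2 ^ n"

text \<open>The increment from \<open>\<omega> 0\<close> makes the path start at \<open>0\<close> surely, not only almost surely.\<close>

definition limit_path :: "(real \<Rightarrow> real) \<Rightarrow> real \<Rightarrow> real" where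
  "limit_path \<omega> t = (if regular_path \<omega> \<and> 0 \<le> t then lim (\<lambda>n. \<omega> (dyadic_floor n t) - \<omega> (real 0 / 2 ^ 0)) else 0)"

lemma regular_path_steps:
  assumes "regular_path \<omega>"
  obtains A where "0 \<le> A" "\<And>n k. k \<le> N * 2 ^ n \<Longrightarrow>
    \<bar>(\<omega> (real (Suc k) / 2 ^ n) - \<omega> 0) - (\<omega> (real k / 2 ^ n) - \<omega> 0)\<bar> \<le> A * (4/5) ^ n"
proof -
  obtain A :: nat where "\<forall>n k. k \<le> N * 2 ^ n \<longrightarrow> \<bar>\<omega> (real (Suc k) / 2 ^ n) - \<omega> (real k / 2 ^ n)\<bar> \<le> real A * (4/5) ^ n"
    using assms unfolding regular_path_def by blast
  then show ?thesis by (intro that[of "real A"]) auto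
qed

lemma limit_path_tendsto:
  assumes \<omega>: "regular_path \<omega>" and t: "0 \<le> t"
  shows "(\<lambda>n. \<omega> (dyadic_floor n t) - \<omega> 0) \<longlonglongrightarrow> limit_path \<omega> t"
proof -
  define N where "N = nat \<lceil>t\<rceil>"
  obtain A where A: "0 \<le> A" "\<And>n k. k \<le> N * 2 ^ n \<Longrightarrow>
    \<bar>(\<omega> (real (Suc k) / 2 ^ n) - \<omega> 0) - (\<omega> (real k / 2 ^ n) - \<omega> 0)\<bar> \<le> A * (4/5) ^ n"
    using regular_path_steps[OF \<omega>, where N = N] by metis
  have "t \<le> real N" unfolding N_def by linarith
  with dyadic_convergent[of A N "\<lambda>t. \<omega> t - \<omega> 0" t, OF A] t
  show ?thesis using \<omega>
    by (simp add: limit_path_def dyadic_floor_def convergent_LIMSEQ_iff)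
qed

lemma continuous_limit_path: "continuous_on {0..} (limit_path \<omega>)"
proof (cases "regular_path \<omega>")
  case \<omega>: True
  show ?thesis
  proof (rule continuous_onI)
    fix s e :: real assume "s \<in> {0..}" "0 < e"
    \<comment> \<open>The horizon exceeds \<open>s\<close> by one unit, so every \<open>t\<close>
      within \<open>1 / 2 ^ n \<le> 1\<close> of \<open>s\<close> still lies below it.\<close>
    define N where "N = nat \<lceil>s + 1\<rceil>"
    obtain A where A: "0 \<le> A" "\<And>n k. k \<le> N * 2 ^ n \<Longrightarrow>
      \<bar>(\<omega> (real (Suc k) / 2 ^ n) - \<omega> 0) - (\<omega> (real k / 2 ^ n) - \<omega> 0)\<bar> \<le> A * (4/5) ^ n"
      using regular_path_steps[OF \<omega>, where N = N] by metis
    have N: "s + 1 \<le> real N" unfolding N_def by linarith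
    have "(\<lambda>n. 9 * A * (4/5) ^ n) \<longlonglongrightarrow> 9 * A * 0"
      by (intro tendsto_intros) auto
    then have "\<forall>\<^sub>F n in sequentially. 9 * A * (4/5) ^ n < e"
      using \<open>0 < e\<close> by (intro order_tendstoD) auto
    then obtain n where n: "9 * A * (4/5) ^ n < e"
      by (auto simp: eventually_sequentially)
    show "\<exists>d>0. \<forall>t\<in>{0..}. dist t s < d \<longrightarrow> dist (limit_path \<omega> t) (limit_path \<omega> s) \<le> e"
    proof (intro exI[of _ "1 / 2 ^ n"] conjI ballI impI)
      fix t :: real assume t: "t \<in> {0..}" "dist t s < 1 / 2 ^ n"
      have "1 / 2 ^ n \<le> (1::real)" by simp
      moreover have "t - s < 1 / 2 ^ n" using t by (simp add: dist_real_def)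
      ultimately have "t \<le> real N" using N by linarith
      then have "\<bar>limit_path \<omega> t - limit_path \<omega> s\<bar> \<le> 9 * A * (4/5) ^ n"
        using t N \<open>s \<in> {0..}\<close> limit_path_tendsto[OF \<omega>]
        by (intro dyadic_modulus[of A N "\<lambda>t. \<omega> t - \<omega> 0", OF A])
           (auto simp: dist_real_def dyadic_floor_def)
      then show "dist (limit_path \<omega> t) (limit_path \<omega> s) \<le> e"
        using n by (simp add: dist_real_def)
    qed simp
  qed
next
  case False
  then show ?thesis by (simp add: limit_path_def[abs_def])
qed

lemma limit_path_zero: "limit_path \<omega> 0 = 0"
proof (cases "regular_path \<omega>")
  case True
  from limit_path_tendsto[OF this, of 0] show ?thesis
    by (simp add: dyadic_floor_def LIMSEQ_const_iff)
qed (simp add: limit_path_def)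

lemma measurable_limit_path [measurable]: "(\<lambda>\<omega>. limit_path \<omega> t) \<in> borel_measurable dyadic_law"
  unfolding limit_path_def dyadic_floor_def by measurable

lemma limit_path_increment:
  assumes "0 \<le> s" "0 \<le> t"
  shows "AE \<omega> in dyadic_law. (\<lambda>n. \<omega> (dyadic_floor n t) - \<omega> (dyadic_floor n s)) \<longlonglongrightarrow> limit_path \<omega> t - limit_path \<omega> s"
  using AE_regular_path
proof eventually_elim
  case (elim \<omega>)
  from tendsto_diff[OF limit_path_tendsto[OF elim assms(2)] limit_path_tendsto[OF elim assms(1)]]
  show ?case by simp
qed

lemma nat_floor_mono: "0 \<le> s \<Longrightarrow> s \<le> t \<Longrightarrow> nat \<lfloor>s * 2 ^ n\<rfloor> \<le> nat \<lfloor>t * 2 ^ n\<rfloor>" for s t :: real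
  by (intro nat_mono floor_mono mult_right_mono) auto

lemma dyadic_floor_tendsto:
  assumes "0 \<le> t"
  shows "(\<lambda>n. dyadic_floor n t) \<longlonglongrightarrow> t"
proof (rule tendsto_sandwich)
  have "t * 2 ^ n - 1 \<le> real (nat \<lfloor>t * 2 ^ n\<rfloor>)" "real (nat \<lfloor>t * 2 ^ n\<rfloor>) \<le> t * 2 ^ n" for n
    using assms by (auto simp: of_nat_floor)
  then show "\<forall>\<^sub>F n in sequentially. t - (1/2) ^ n \<le> dyadic_floor n t"
    and "\<forall>\<^sub>F n in sequentially. dyadic_floor n t \<le> t"
    by (simp_all add: dyadic_floor_def pos_le_divide_eq pos_divide_le_eq left_diff_distrib power_divide)
  have "(\<lambda>n. t - (1/2) ^ n) \<longlonglongrightarrow> t - 0"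
    by (intro tendsto_intros) auto
  then show "(\<lambda>n. t - (1/2) ^ n) \<longlonglongrightarrow> t" by simp
qed simp

text \<open>Increments between dyadic floors are normal and independent by construction and converge
  almost surely to the increments of the path; both properties survive such limits.\<close>

theorem brownian_motion_exists: "brownian_motion dyadic_law limit_path"
  unfolding brownian_motion_def
proof (intro conjI allI impI ballI)
  show "prob_space dyadic_law" by (rule walk_limit.P.prob_space_axioms)
  show "(\<lambda>\<omega>. limit_path \<omega> t) \<in> borel_measurable dyadic_law" for t by simp
  show "limit_path \<omega> 0 = 0" "continuous_on {0..} (limit_path \<omega>)" for \<omega>
    by (rule limit_path_zero continuous_limit_path)+
next
  fix s t :: real assume st: "0 \<le> s \<and> s < t"
  define d where "d n = dyadic_floor n t - dyadic_floor n s" for n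
  have d: "d \<longlonglongrightarrow> t - s"
    unfolding d_def using st by (intro tendsto_diff dyadic_floor_tendsto) auto
  then have "\<forall>\<^sub>F n in sequentially. 0 < d n" using st by (intro order_tendstoD) auto
  \<comment> \<open>At coarse levels the two floors may coincide and the increment degenerates;
    shifting by \<open>n0\<close> keeps all standard deviations positive.\<close>
  then obtain n0 where n0: "\<And>n. n0 \<le> n \<Longrightarrow> 0 < d n" by (auto simp: eventually_sequentially)
  show "distributed dyadic_law lborel (\<lambda>\<omega>. limit_path \<omega> t - limit_path \<omega> s) (\<lambda>x. ennreal (normal_density 0 (sqrt (t - s)) x))"
  proof (rule walk_limit.P.normal_AE_limit)
    show "0 < sqrt (d (n + n0))" for n using n0[of "n + n0"] by simp
    show "(\<lambda>n. sqrt (d (n + n0))) \<longlonglongrightarrow> sqrt (t - s)"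
      by (intro tendsto_intros LIMSEQ_ignore_initial_segment[OF d])
    show "AE \<omega> in dyadic_law. (\<lambda>n. \<omega> (dyadic_floor (n + n0) t) - \<omega> (dyadic_floor (n + n0) s)) \<longlonglongrightarrow> limit_path \<omega> t - limit_path \<omega> s"
      using limit_path_increment[of s t] st by (auto elim!: eventually_mono intro: LIMSEQ_ignore_initial_segment)
    show "distributed dyadic_law lborel (\<lambda>\<omega>. \<omega> (dyadic_floor (n + n0) t) - \<omega> (dyadic_floor (n + n0) s))
        (\<lambda>x. ennreal (normal_density 0 (sqrt (d (n + n0))) x))" for n
    proof -
      have "nat \<lfloor>s * 2 ^ (n + n0)\<rfloor> < nat \<lfloor>t * 2 ^ (n + n0)\<rfloor>"
        using n0[of "n + n0"] by (simp add: d_def dyadic_floor_def divide_less_cancel)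
      from dyadic_law_increment_normal[OF this, of "n + n0"] this show ?thesis
        by (simp add: d_def dyadic_floor_def of_nat_diff diff_divide_distrib)
    qed
  qed (use st in auto)
next
  fix m :: nat and ts :: "nat \<Rightarrow> real" assume ts: "\<forall>i<m. 0 \<le> ts i \<and> ts i < ts (Suc i)"
  show "walk_limit.P.indep_vars (\<lambda>_. borel) (\<lambda>i \<omega>. limit_path \<omega> (ts (Suc i)) - limit_path \<omega> (ts i)) {..<m}"
  proof (rule walk_limit.P.indep_vars_AE_limit)
    show "walk_limit.P.indep_vars (\<lambda>_. borel) (\<lambda>i \<omega>. \<omega> (dyadic_floor n (ts (Suc i))) - \<omega> (dyadic_floor n (ts i))) {..<m}" for n
      unfolding dyadic_floor_def
      by (rule dyadic_law_increments_indep) (use ts in \<open>simp add: nat_floor_mono less_imp_le\<close>)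
    show "AE \<omega> in dyadic_law. \<forall>i\<in>{..<m}. (\<lambda>n. \<omega> (dyadic_floor n (ts (Suc i))) - \<omega> (dyadic_floor n (ts i)))
       \<longlonglongrightarrow> limit_path \<omega> (ts (Suc i)) - limit_path \<omega> (ts i)"
    proof (rule AE_finite_allI)
      fix i assume "i \<in> {..<m}"
      with ts show "AE \<omega> in dyadic_law. (\<lambda>n. \<omega> (dyadic_floor n (ts (Suc i))) - \<omega> (dyadic_floor n (ts i)))
       \<longlonglongrightarrow> limit_path \<omega> (ts (Suc i)) - limit_path \<omega> (ts i)"
        by (intro limit_path_increment) (auto intro: order.trans less_imp_le)
    qed simp
  qed auto
qed

section \<open>Modulus of continuity of Brownian motion\<close>

text \<open>Slice by integers: on \<open>j + 1 < X \<le> j + 2\<close> the integrand is at most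
  \<open>exp (a * (j + 2))\<close>, which the Gaussian tail beats. Values up to 1, where no tail
  bound is available, are covered by the constant \<open>exp a\<close>.\<close>

lemma (in prob_space) integrable_exp_gaussian_tail:
  fixes X :: "'a \<Rightarrow> real"
  assumes [measurable]: "X \<in> borel_measurable M"
    and tail: "\<And>A. 1 \<le> A \<Longrightarrow> prob {\<omega>\<in>space M. A < X \<omega>} \<le> C * exp (- A\<^sup>2 / 4)"
    and "0 \<le> a"
  shows "integrable M (\<lambda>\<omega>. exp (a * X \<omega>))"
proof (rule integrableI_nonneg)
  let ?c = "\<lambda>j::nat. exp (a * real (j + 2))"
  let ?E = "\<lambda>j::nat. {\<omega>\<in>space M. real (j + 1) < X \<omega>}"
  have C: "0 \<le> C"
  proof -
    have "0 \<le> C * exp (- 1\<^sup>2 / 4)" using tail[of 1] measure_nonneg[of M] by (meson order.trans order.refl)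
    then show ?thesis by (simp add: zero_le_mult_iff)
  qed
  have "summable (\<lambda>j. ?c j * (C * exp (- (real (j + 1))\<^sup>2 / 4)))"
  proof (rule summable_comparison_test_ev)
    have "(\<lambda>j. exp (a * real (j + 2)) * exp (- (real (j + 1))\<^sup>2 / 4) * 2 ^ j) \<longlonglongrightarrow> 0"
    proof (cases "a = 0")
      case False
      then have "0 < a" using \<open>0 \<le> a\<close> by simp
      then show ?thesis by real_asymp
    qed (simp, real_asymp)
    from tendsto_mult_right_zero[OF this, of C]
    have "(\<lambda>j. ?c j * (C * exp (- (real (j + 1))\<^sup>2 / 4)) * 2 ^ j) \<longlonglongrightarrow> 0"
      by (simp add: mult_ac)
    then have "\<forall>\<^sub>F j in sequentially. ?c j * (C * exp (- (real (j + 1))\<^sup>2 / 4)) * 2 ^ j < 1"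
      by (rule order_tendstoD) simp
    then show "\<forall>\<^sub>F j in sequentially. norm (?c j * (C * exp (- (real (j + 1))\<^sup>2 / 4))) \<le> (1/2) ^ j"
      by eventually_elim (use C in \<open>auto simp: field_simps abs_mult\<close>)
  qed (simp add: summable_geometric)
  then have fin: "(\<Sum>j. ennreal (?c j * (C * exp (- (real (j + 1))\<^sup>2 / 4)))) < \<infinity>"
    using C by (subst suminf_ennreal2) auto
  have "(\<integral>\<^sup>+ \<omega>. ennreal (exp (a * X \<omega>)) \<partial>M) \<le> (\<integral>\<^sup>+ \<omega>. ennreal (exp a) + (\<Sum>j. ennreal (?c j) * indicator (?E j) \<omega>) \<partial>M)"
  proof (rule nn_integral_mono)
    fix \<omega> assume \<omega>: "\<omega> \<in> space M"
    show "ennreal (exp (a * X \<omega>)) \<le> ennreal (exp a) + (\<Sum>j. ennreal (?c j) * indicator (?E j) \<omega>)"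
    proof (cases "X \<omega> \<le> 1")
      case True
      then have "exp (a * X \<omega>) \<le> exp a" using \<open>0 \<le> a\<close> by (simp add: mult_left_le)
      then show ?thesis by (simp add: add_increasing2 ennreal_leI)
    next
      case False
      define j where "j = nat (\<lceil>X \<omega>\<rceil> - 2)"
      have j: "real (j + 1) < X \<omega>" "X \<omega> \<le> real (j + 2)"
        using False unfolding j_def by linarith+
      have "ennreal (exp (a * X \<omega>)) \<le> ennreal (?c j) * indicator (?E j) \<omega>"
        using j \<omega> \<open>0 \<le> a\<close> by (auto intro!: ennreal_leI mult_left_mono)
      also have "\<dots> \<le> (\<Sum>j. ennreal (?c j) * indicator (?E j) \<omega>)"
      proof -
        have "f j \<le> suminf f" for f :: "nat \<Rightarrow> ennreal"
          using sum_le_suminf[of f "{j}"] by simp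
        from this[of "\<lambda>j. ennreal (?c j) * indicator (?E j) \<omega>"] show ?thesis .
      qed
      finally show ?thesis by (simp add: add_increasing)
    qed
  qed
  also have "\<dots> = ennreal (exp a) + (\<Sum>j. ennreal (?c j) * emeasure M (?E j))"
    by (subst nn_integral_add) (auto simp: nn_integral_suminf nn_integral_cmult_indicator emeasure_space_1)
  also have "\<dots> \<le> ennreal (exp a) + (\<Sum>j. ennreal (?c j * (C * exp (- (real (j + 1))\<^sup>2 / 4))))"
  proof (intro add_left_mono suminf_le)
    fix j
    have "emeasure M (?E j) \<le> ennreal (C * exp (- (real (j + 1))\<^sup>2 / 4))"
      unfolding emeasure_eq_measure by (intro ennreal_leI tail) simp
    then show "ennreal (?c j) * emeasure M (?E j) \<le> ennreal (?c j * (C * exp (- (real (j + 1))\<^sup>2 / 4)))"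
      by (subst ennreal_mult') (auto intro!: mult_left_mono)
  qed auto
  also have "\<dots> < \<infinity>" using fin by simp
  finally show "(\<integral>\<^sup>+ \<omega>. ennreal (exp (a * X \<omega>)) \<partial>M) < \<infinity>" .
qed auto

definition modulus_const :: real where
  "modulus_const = (\<Sum>n. real (1 * 2 ^ n + 1) * (2 * exp (- ((32/25) ^ n) / 4)))"

text \<open>Hoelder continuity on the unit interval with exponent the base-2 logarithm of
  \<open>5/4\<close>, stated scale by scale; 9 and \<open>4/5\<close> are the constants of
  \<open>dyadic_modulus\<close>.\<close>

definition path_modulus :: "(real \<Rightarrow> real) \<Rightarrow> real \<Rightarrow> bool" where
  "path_modulus w h \<longleftrightarrow> 0 \<le> h \<and>
    (\<forall>n s t. 0 \<le> s \<longrightarrow> s \<le> 1 \<longrightarrow> 0 \<le> t \<longrightarrow> t \<le> 1 \<longrightarrow> \<bar>t - s\<bar> \<le> 1 / 2 ^ n \<longrightarrow> \<bar>w t - w s\<bar> \<le> 9 * h * (4/5) ^ n)"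

lemma brownian_increment:
  assumes "brownian_motion M W" "0 \<le> s" "s < t"
  shows "distributed M lborel (\<lambda>\<omega>. W \<omega> t - W \<omega> s) (normal_density 0 (sqrt (t - s)))"
  using assms by (simp add: brownian_motion_def)

text \<open>\<open>H\<close> is the supremum of the dyadic increments divided by
  \<open>(4/5) ^ n\<close>. By continuity each path is the limit of its own dyadic values, so
  \<open>dyadic_modulus\<close> applies to it directly.\<close>

lemma brownian_modulus:
  assumes BM: "brownian_motion M W"
  obtains H where "H \<in> borel_measurable M"
    "\<And>A. 1 \<le> A \<Longrightarrow> measure M {\<omega>\<in>space M. A < H \<omega>} \<le> modulus_const * exp (- A\<^sup>2 / 4)"
    "AE \<omega> in M. path_modulus (W \<omega>) (H \<omega>)"
proof -
  interpret prob_space M using BM by (simp add: brownian_motion_def)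
  have [measurable]: "(\<lambda>\<omega>. W \<omega> t) \<in> borel_measurable M" for t
    using BM by (simp add: brownian_motion_def)
  have cont: "continuous_on {0..} (W \<omega>)" if "\<omega> \<in> space M" for \<omega>
    using BM that by (simp add: brownian_motion_def)
  define \<Delta> where "\<Delta> n k \<omega> = W \<omega> (real (Suc k) / 2 ^ n) - W \<omega> (real k / 2 ^ n)" for n k \<omega>
  have [measurable]: "\<Delta> n k \<in> borel_measurable M" for n k
    unfolding \<Delta>_def[abs_def] by measurable
  have \<Delta>: "distributed M lborel (\<Delta> n k) (normal_density 0 (sqrt (1 / 2 ^ n)))" for n k
  proof -
    have "distributed M lborel (\<lambda>\<omega>. W \<omega> (real (Suc k) / 2 ^ n) - W \<omega> (real k / 2 ^ n))
      (normal_density 0 (sqrt (real (Suc k) / 2 ^ n - real k / 2 ^ n)))"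
      by (rule brownian_increment[OF BM]) (simp_all add: divide_strict_right_mono)
    also have "real (Suc k) / 2 ^ n - real k / 2 ^ n = 1 / 2 ^ n"
      by (simp add: diff_divide_distrib[symmetric])
    finally show ?thesis unfolding \<Delta>_def[abs_def] .
  qed
  define good where "good \<omega> \<longleftrightarrow> (\<exists>A::nat. \<forall>n k. k \<le> 1 * 2 ^ n \<longrightarrow> \<bar>\<Delta> n k \<omega>\<bar> \<le> real A * (4/5) ^ n)" for \<omega>
  have [measurable]: "Measurable.pred M good" unfolding good_def[abs_def] by measurable
  \<comment> \<open>Off \<open>good\<close> the quotients are set to 0, so that the family is
    bounded at every point, as measurability of a real supremum requires.\<close>
  define F where "F p \<omega> = (if good \<omega> then \<bar>\<Delta> (fst p) (snd p) \<omega>\<bar> / (4/5) ^ fst p else 0)" for p \<omega>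
  have [measurable]: "F p \<in> borel_measurable M" for p unfolding F_def[abs_def] by measurable
  define I where "I = {p::nat \<times> nat. snd p \<le> 1 * 2 ^ fst p}"
  have I: "(0, 0) \<in> I" by (simp add: I_def)
  have bdd: "bdd_above ((\<lambda>p. F p \<omega>) ` I)" for \<omega>
  proof (cases "good \<omega>")
    case True
    then obtain A :: nat where "\<forall>n k. k \<le> 1 * 2 ^ n \<longrightarrow> \<bar>\<Delta> n k \<omega>\<bar> \<le> real A * (4/5) ^ n"
      unfolding good_def by blast
    then show ?thesis
      by (intro bdd_aboveI2[of _ _ "real A"]) (auto simp: F_def I_def pos_divide_le_eq)
  next
    case False
    then show ?thesis by (intro bdd_aboveI2[of _ _ 0]) (auto simp: F_def)
  qed
  define H where "H \<omega> = (SUP p\<in>I. F p \<omega>)" for \<omega>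
  have [measurable]: "H \<in> borel_measurable M"
    unfolding H_def[abs_def] by (intro borel_measurable_cSUP bdd) auto
  show ?thesis
  proof (rule that)
    fix A :: real assume A: "1 \<le> A"
    have "{\<omega>\<in>space M. A < H \<omega>} \<subseteq> {\<omega>\<in>space M. \<exists>n k. k \<le> 1 * 2 ^ n \<and> A * (4/5) ^ n < \<bar>\<Delta> n k \<omega>\<bar>}"
    proof safe
      fix \<omega> assume "A < H \<omega>"
      then obtain p where p: "p \<in> I" "A < F p \<omega>"
        unfolding H_def using less_cSUP_iff[OF _ bdd] I by blast
      then have "A * (4/5) ^ fst p < \<bar>\<Delta> (fst p) (snd p) \<omega>\<bar>"
        using A by (auto simp: F_def pos_less_divide_eq split: if_splits)
      then show "\<exists>n k. k \<le> 1 * 2 ^ n \<and> A * (4/5) ^ n < \<bar>\<Delta> n k \<omega>\<bar>"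
        using p(1) unfolding I_def by blast
    qed
    then have "prob {\<omega>\<in>space M. A < H \<omega>} \<le> prob {\<omega>\<in>space M. \<exists>n k. k \<le> 1 * 2 ^ n \<and> A * (4/5) ^ n < \<bar>\<Delta> n k \<omega>\<bar>}"
      by (intro finite_measure_mono) measurable
    also have "\<dots> \<le> modulus_const * exp (- A\<^sup>2 / 4)"
      unfolding modulus_const_def by (rule chaining_tail[OF \<Delta> A])
    finally show "prob {\<omega>\<in>space M. A < H \<omega>} \<le> modulus_const * exp (- A\<^sup>2 / 4)" .
  next
    have "AE \<omega> in M. good \<omega>"
      unfolding good_def by (rule chaining_AE[OF \<Delta>])
    then show "AE \<omega> in M. path_modulus (W \<omega>) (H \<omega>)"
    proof (rule AE_mp, intro AE_I2 impI)
      fix \<omega> assume \<omega>: "\<omega> \<in> space M" "good \<omega>"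
      have F_le: "F p \<omega> \<le> H \<omega>" if "p \<in> I" for p
        unfolding H_def using that by (intro cSUP_upper bdd)
      have H: "0 \<le> H \<omega>" using F_le[OF I] \<omega> by (simp add: F_def) 
      have step: "\<bar>W \<omega> (real (Suc k) / 2 ^ n) - W \<omega> (real k / 2 ^ n)\<bar> \<le> H \<omega> * (4/5) ^ n" if "k \<le> 1 * 2 ^ n" for n k
        using F_le[of "(n, k)"] that \<omega> by (simp add: F_def I_def \<Delta>_def pos_divide_le_eq)
      have lim: "(\<lambda>n. W \<omega> (real (nat \<lfloor>t * 2 ^ n\<rfloor>) / 2 ^ n)) \<longlonglongrightarrow> W \<omega> t" if "0 \<le> t" for t
      proof (rule continuous_on_tendsto_compose[OF cont[OF \<omega>(1)]])
        show "(\<lambda>n. real (nat \<lfloor>t * 2 ^ n\<rfloor>) / 2 ^ n) \<longlonglongrightarrow> t"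
          using dyadic_floor_tendsto[OF that] by (simp add: dyadic_floor_def)
      qed (use that in auto)
      show "path_modulus (W \<omega>) (H \<omega>)"
        unfolding path_modulus_def
        using H dyadic_modulus[of "H \<omega>" 1 "W \<omega>" "W \<omega>", OF H step lim] by auto
    qed
  qed fact
qed

section \<open>Pathwise estimates\<close>

context
  fixes \<beta> x y :: real and w q1 q2 L :: "real \<Rightarrow> real"
  assumes sol: "reflected_solution \<beta> w x y q1 q2 L" and w0: "w 0 = 0"
begin

lemma sol_facts:
  shows "continuous_on {0..} q1" "continuous_on {0..} q2" "L 0 = 0" "mono_on {0..} L"
    and sol_L_nonneg: "\<And>t. 0 \<le> t \<Longrightarrow> 0 \<le> L t"
    and sol_q1_nonpos: "\<And>t. 0 \<le> t \<Longrightarrow> q1 t \<le> 0"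
    and sol_q1_int: "\<And>t. 0 \<le> t \<Longrightarrow> q1 t = x + sqrt 2 * w t - \<beta> * t + integral {0..t} (\<lambda>s. - q1 s + q2 s) - L t"
    and sol_q2_eq: "\<And>t. 0 \<le> t \<Longrightarrow> q2 t = y + L t - integral {0..t} q2"
    and sol_flat: "\<And>a b. 0 \<le> a \<Longrightarrow> a \<le> b \<Longrightarrow> (\<And>u. u \<in> {a..b} \<Longrightarrow> q1 u < 0) \<Longrightarrow> L b = L a"
proof -
  have "\<forall>t\<ge>0. 0 \<le> L t" "\<forall>t\<ge>0. q1 t \<le> 0"
    "\<forall>t\<ge>0. q1 t = x + sqrt 2 * w t - \<beta> * t + integral {0..t} (\<lambda>s. - q1 s + q2 s) - L t"
    "\<forall>t\<ge>0. q2 t = y + L t - integral {0..t} q2"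
    "\<forall>a b. 0 \<le> a \<and> a \<le> b \<and> (\<forall>s\<in>{a..b}. q1 s < 0) \<longrightarrow> L b = L a"
    using sol unfolding reflected_solution_def by - (elim conjE, assumption)+
  then show "\<And>t. 0 \<le> t \<Longrightarrow> 0 \<le> L t" "\<And>t. 0 \<le> t \<Longrightarrow> q1 t \<le> 0"
    "\<And>t. 0 \<le> t \<Longrightarrow> q1 t = x + sqrt 2 * w t - \<beta> * t + integral {0..t} (\<lambda>s. - q1 s + q2 s) - L t"
    "\<And>t. 0 \<le> t \<Longrightarrow> q2 t = y + L t - integral {0..t} q2"
    "\<And>a b. 0 \<le> a \<Longrightarrow> a \<le> b \<Longrightarrow> (\<And>u. u \<in> {a..b} \<Longrightarrow> q1 u < 0) \<Longrightarrow> L b = L a"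
    by simp_all
  show "continuous_on {0..} q1" "continuous_on {0..} q2" "L 0 = 0" "mono_on {0..} L"
    using sol unfolding reflected_solution_def by - (elim conjE, assumption)+
qed

lemma sol_start: "q1 0 = x" "q2 0 = y"
  using sol_q1_int[of 0] sol_q2_eq[of 0] sol_facts(3) w0 by auto

lemma sol_continuous: "0 \<le> a \<Longrightarrow> continuous_on {a..b} q1" "0 \<le> a \<Longrightarrow> continuous_on {a..b} q2"
  using sol_facts(1,2) by (auto elim!: continuous_on_subset)

lemma sol_integrable: "0 \<le> a \<Longrightarrow> q1 integrable_on {a..b}" "0 \<le> a \<Longrightarrow> q2 integrable_on {a..b}"
  using sol_continuous by (auto intro: integrable_continuous_real)

lemma sol_q1_eq:
  "0 \<le> t \<Longrightarrow> q1 t = x + sqrt 2 * w t - \<beta> * t - integral {0..t} q1 + integral {0..t} q2 - L t"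
  using sol_q1_int[of t] integral_diff[OF sol_integrable(2,1)[of 0 t]] by simp

lemma sol_sum: "0 \<le> t \<Longrightarrow> q1 t + q2 t = x + y + sqrt 2 * w t - \<beta> * t - integral {0..t} q1"
  using sol_q1_eq[of t] sol_q2_eq[of t] by simp

lemma sol_integral_q1_nonpos: "0 \<le> t \<Longrightarrow> integral {0..t} q1 \<le> 0"
  using integral_le[OF sol_integrable(1)[of 0 t] integrable_const_ivl[of 0 0 t]] sol_q1_nonpos by auto

text \<open>Since \<open>L\<close> need not be differentiable, the integrating factor is applied to
  \<open>v\<close>, the integral of \<open>q2\<close>, which satisfies
  \<open>v' + v = y + L t \<le> y + L T\<close>. Integrating up to \<open>T\<close> gives
  \<open>v T \<le> (y + L T) * (1 - exp (- T))\<close>, and \<open>q2 T\<close> is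
  \<open>y + L T - v T\<close>.\<close>

lemma sol_q2_lower:
  assumes "0 \<le> T"
  shows "exp (- T) * y \<le> q2 T"
proof -
  define v where "v t = integral {0..t} q2" for t
  define c where "c = y + L T"
  have dv: "(v has_real_derivative q2 t) (at t within {0..T})" if "t \<in> {0..T}" for t
    unfolding v_def has_real_derivative_iff_has_vector_derivative
    using that by (intro integral_has_vector_derivative sol_continuous) auto
  have "(\<lambda>t. exp t * v t - c * (exp t - 1)) T \<le> (\<lambda>t. exp t * v t - c * (exp t - 1)) 0"
  proof (rule DERIV_nonpos_imp_decreasing_open[OF assms])
    fix t assume t: "0 < t" "t < T"
    have "(v has_real_derivative q2 t) (at t)"
      using dv[of t] t at_within_interior[of t "{0..T}"] by simp
    then have "((\<lambda>t. exp t * v t - c * (exp t - 1)) has_real_derivative (exp t * v t + q2 t * exp t - c * exp t)) (at t)"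
      by (auto intro!: derivative_eq_intros)
    moreover have "exp t * v t + q2 t * exp t - c * exp t = exp t * (L t - L T)"
    proof -
      have "v t + q2 t - c = L t - L T"
        using sol_q2_eq[of t] t by (simp add: v_def c_def)
      from arg_cong[OF this, of "\<lambda>u. exp t * u"] show ?thesis by (simp add: algebra_simps)
    qed
    moreover have "L t \<le> L T"
      using sol_facts(4) t by (auto simp: monotone_on_def)
    ultimately show "\<exists>D. ((\<lambda>t. exp t * v t - c * (exp t - 1)) has_real_derivative D) (at t) \<and> D \<le> 0"
      by (metis diff_le_0_iff_le exp_ge_zero mult_nonneg_nonpos)
  next
    have "continuous_on {0..T} v"
      by (rule DERIV_continuous_on[OF dv])
    then show "continuous_on {0..T} (\<lambda>t. exp t * v t - c * (exp t - 1))"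
      by (intro continuous_intros)
  qed
  then have "v T \<le> c * (1 - exp (- T))"
    by (simp add: v_def exp_minus field_simps)
  then have "exp (- T) * c \<le> q2 T"
    using sol_q2_eq[OF assms] by (simp add: v_def c_def algebra_simps)
  moreover have "0 \<le> L T" using assms by (rule sol_L_nonneg)
  ultimately show ?thesis
    by (smt (verit) c_def exp_ge_zero mult_left_mono)
qed

lemma sol_L_continuous: "0 \<le> b \<Longrightarrow> continuous_on {0..b} L"
proof -
  assume "0 \<le> b"
  have "continuous_on {0..b} (\<lambda>t. q2 t - y + integral {0..t} q2)"
    by (intro continuous_intros sol_continuous indefinite_integral_continuous_1 sol_integrable) auto
  moreover have "q2 t - y + integral {0..t} q2 = L t" if "t \<in> {0..b}" for t
    using sol_q2_eq[of t] that by simp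
  ultimately show ?thesis by (rule continuous_on_eq)
qed

text \<open>The flatness condition covers closed intervals on which \<open>q1\<close> is negative,
  whereas an excursion may vanish at both ends. Continuity of \<open>L\<close>, read off from the
  equation of \<open>q2\<close>, closes the gap.\<close>

lemma sol_L_excursion:
  assumes "0 \<le> s" "s \<le> t" and neg: "\<And>u. s < u \<Longrightarrow> u < t \<Longrightarrow> q1 u < 0"
  shows "L t = L s"
proof (cases "s = t")
  case False
  then have st: "s < t" using assms by simp
  define c where "c = (s + t) / 2"
  have c: "s < c" "c < t" using st by (auto simp: c_def)
  have const: "L b = L a" if "s < a" "a \<le> b" "b < t" for a b
    by (rule sol_flat) (use that assms in auto)
  have Lc: "continuous_on {s..t} L"
    using sol_L_continuous[of t] assms by (auto elim!: continuous_on_subset)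
  have cl: "closure {s<..<t} = {s..t}" using st by (rule closure_greaterThanLessThan)
  have "L u = L c" if "u \<in> {s<..<t}" for u
    using const[of c u] const[of u c] c that by (cases "u \<le> c") auto
  then have "L u = L c" if "u \<in> {s..t}" for u
    using continuous_constant_on_closure[of "{s<..<t}" L "L c" u] Lc that unfolding cl by blast
  from this[of s] this[of t] show ?thesis using st by simp
qed simp

text \<open>\<open>L\<close> is frozen during an excursion, and \<open>q2\<close> drives
  \<open>- q1\<close> down at rate at least \<open>m\<close>. The nonnegative term
  \<open>- integral {s..t} q1\<close> is kept on the left: it is the restoring force behind both the
  contraction of \<open>q1\<close> and the bound on \<open>q2\<close>.\<close>

lemma sol_excursion:
  assumes st: "0 \<le> s" "s \<le> t" and neg: "\<And>u. s < u \<Longrightarrow> u < t \<Longrightarrow> q1 u < 0"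
    and m: "\<And>u. s \<le> u \<Longrightarrow> u \<le> t \<Longrightarrow> m \<le> q2 u"
  shows "- q1 t - integral {s..t} q1 \<le> - q1 s + sqrt 2 * \<bar>w t - w s\<bar> - (m - \<beta>) * (t - s)"
proof -
  have "integral {0..s} q + integral {s..t} q = integral {0..t} q" if "q \<in> {q1, q2}" for q
    using that st sol_integrable[of 0 t] by (intro Henstock_Kurzweil_Integration.integral_combine) auto
  then have i: "integral {0..s} q1 + integral {s..t} q1 = integral {0..t} q1"
    "integral {0..s} q2 + integral {s..t} q2 = integral {0..t} q2" by auto
  have "m * (t - s) \<le> integral {s..t} q2"
    using integral_le[OF integrable_const_ivl[of m s t] sol_integrable(2)[of s t]] st m
    by (simp add: mult.commute)
  moreover have "- (sqrt 2 * (w t - w s)) \<le> sqrt 2 * \<bar>w t - w s\<bar>"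
    using abs_ge_minus_self[of "sqrt 2 * (w t - w s)"] by (simp only: abs_mult abs_of_nonneg[of "sqrt 2"] real_sqrt_ge_zero zero_le_numeral)
  ultimately show ?thesis
    using sol_q1_eq[of t] sol_q1_eq[of s] sol_L_excursion[OF st neg] i st by (simp add: algebra_simps)
qed

lemma sol_last_zero:
  assumes "0 \<le> \<sigma>" "\<sigma> \<le> t" "q1 \<sigma> = 0"
  obtains s where "\<sigma> \<le> s" "s \<le> t" "q1 s = 0" "\<And>u. s < u \<Longrightarrow> u \<le> t \<Longrightarrow> q1 u < 0"
proof -
  define Z where "Z = {u\<in>{\<sigma>..t}. q1 u = 0}"
  have "closed Z" unfolding Z_def
    using continuous_closed_preimage_constant[OF sol_continuous(1)[OF assms(1), of t] closed_real_atLeastAtMost] by simp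
  moreover have "bounded Z" by (rule bounded_subset[of "{\<sigma>..t}"]) (auto simp: Z_def)
  ultimately have "compact Z" by (simp add: compact_eq_bounded_closed)
  moreover have "\<sigma> \<in> Z" using assms by (simp add: Z_def)
  ultimately obtain s where s: "s \<in> Z" "\<And>u. u \<in> Z \<Longrightarrow> u \<le> s"
    using compact_attains_sup[of Z] by auto
  show ?thesis
  proof (rule that[of s])
    fix u assume u: "s < u" "u \<le> t"
    then have "q1 u \<noteq> 0" using s(2)[of u] s(1) by (auto simp: Z_def)
    moreover have "q1 u \<le> 0" using s(1) u assms by (intro sol_q1_nonpos) (auto simp: Z_def)
    ultimately show "q1 u < 0" by simp
  qed (use s in \<open>auto simp: Z_def\<close>)
qed

lemma sol_first_zero:
  assumes "0 \<le> t" "q1 t = 0"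
  obtains s where "0 \<le> s" "s \<le> t" "q1 s = 0" "\<And>u. 0 \<le> u \<Longrightarrow> u < s \<Longrightarrow> q1 u < 0"
proof -
  define Z where "Z = {u\<in>{0..t}. q1 u = 0}"
  have "closed Z" unfolding Z_def
    using continuous_closed_preimage_constant[OF sol_continuous(1)[of 0 t] closed_real_atLeastAtMost] by simp
  moreover have "bounded Z" by (rule bounded_subset[of "{0..t}"]) (auto simp: Z_def)
  ultimately have "compact Z" by (simp add: compact_eq_bounded_closed)
  moreover have "t \<in> Z" using assms by (simp add: Z_def)
  ultimately obtain s where s: "s \<in> Z" "\<And>u. u \<in> Z \<Longrightarrow> s \<le> u"
    using compact_attains_inf[of Z] by auto
  show ?thesis
  proof (rule that[of s])
    fix u assume u: "0 \<le> u" "u < s"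
    then have "q1 u \<noteq> 0" using s(2)[of u] s(1) by (auto simp: Z_def)
    moreover have "q1 u \<le> 0" using u by (intro sol_q1_nonpos) auto
    ultimately show "q1 u < 0" by simp
  qed (use s in \<open>auto simp: Z_def\<close>)
qed

section \<open>Excursion estimates from a lower bound \<open>m\<close> on \<open>q2\<close> and a
  bound \<open>\<eta>\<close> on noise minus drift\<close>

context
  fixes m \<eta> T :: real
  assumes m: "\<And>u. 0 \<le> u \<Longrightarrow> u \<le> T \<Longrightarrow> m \<le> q2 u"
    and \<eta>: "\<And>s t. 0 \<le> s \<Longrightarrow> s \<le> t \<Longrightarrow> t \<le> T \<Longrightarrow> sqrt 2 * \<bar>w t - w s\<bar> - (m - \<beta>) * (t - s) \<le> \<eta>"
    and T: "0 \<le> T"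
begin

lemma eta_nonneg: "0 \<le> \<eta>" using \<eta>[of 0 0] T by simp

lemma sol_excursion_eta:
  assumes "0 \<le> s" "s \<le> t" "t \<le> T" "\<And>u. s < u \<Longrightarrow> u < t \<Longrightarrow> q1 u < 0"
  shows "- q1 t - integral {s..t} q1 \<le> - q1 s + \<eta>"
  using sol_excursion[of s t m] \<eta>[of s t] m assms by fastforce

lemma sol_integral_nonpos: "0 \<le> s \<Longrightarrow> integral {s..t} q1 \<le> 0"
  using integral_le[OF sol_integrable(1)[of s t] integrable_const_ivl[of 0 s t]] sol_q1_nonpos by auto

lemma sol_after_zero:
  assumes "0 \<le> \<sigma>" "\<sigma> \<le> t" "t \<le> T" "q1 \<sigma> = 0"
  shows "- q1 t \<le> \<eta>"
proof -
  obtain s where s: "\<sigma> \<le> s" "s \<le> t" "q1 s = 0" "\<And>u. s < u \<Longrightarrow> u \<le> t \<Longrightarrow> q1 u < 0"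
    using sol_last_zero[OF assms(1,2,4)] by blast
  then show ?thesis
    using sol_excursion_eta[of s t] sol_integral_nonpos[of s t] assms by force
qed

lemma sol_q1_bound:
  assumes "0 \<le> t" "t \<le> T"
  shows "- q1 t \<le> - x + \<eta>"
proof (cases "\<exists>\<sigma>\<in>{0..t}. q1 \<sigma> = 0")
  case True
  then show ?thesis using sol_after_zero[of _ t] assms sol_q1_nonpos[of 0] sol_start by fastforce
next
  case False
  then have "q1 u < 0" if "0 \<le> u" "u \<le> t" for u
    using sol_q1_nonpos[of u] that by (metis atLeastAtMost_iff order_le_less)
  then show ?thesis
    using sol_excursion_eta[of 0 t] sol_integral_nonpos[of 0 t] assms sol_start by force
qed


lemma sol_q1_integral_bound: "- integral {0..T} q1 \<le> T * (- x + \<eta>)"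
proof -
  have "integral {0..T} (\<lambda>_. x - \<eta>) \<le> integral {0..T} q1"
    using sol_q1_bound by (intro integral_le integrable_const_ivl sol_integrable) force+
  then show ?thesis using T by (simp add: algebra_simps)
qed

text \<open>Write \<open>X = - q1\<close>. After a zero, \<open>X 1 \<le> \<eta>\<close>. Without a
  zero, \<open>X 1 \<le> X u + \<eta>\<close> for every \<open>u\<close>, so the integral of
  \<open>X\<close> is at least \<open>X 1 - \<eta>\<close>; inserting this into the excursion bound
  gives \<open>2 * X 1 \<le> X 0 + 2 * \<eta>\<close>.\<close>

lemma sol_q1_contraction:
  assumes "T = 1"
  shows "- q1 1 \<le> - x / 2 + \<eta>"
proof (cases "\<exists>\<sigma>\<in>{0..1}. q1 \<sigma> = 0")
  case True
  then show ?thesis using sol_after_zero[of _ 1] assms sol_q1_nonpos[of 0] sol_start by force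
next
  case False
  then have neg: "q1 u < 0" if "0 \<le> u" "u \<le> 1" for u
    using sol_q1_nonpos[of u] that by (metis atLeastAtMost_iff order_le_less)
  have "q1 u \<le> q1 1 + \<eta>" if "0 \<le> u" "u \<le> 1" for u
    using sol_excursion_eta[of u 1] sol_integral_nonpos[of u 1] neg that assms by force
  then have "integral {0..1} q1 \<le> integral {0..1::real} (\<lambda>_. q1 1 + \<eta>)"
    by (intro integral_le integrable_const_ivl sol_integrable) auto
  moreover have "- q1 1 - integral {0..1} q1 \<le> - q1 0 + \<eta>"
    using neg assms by (intro sol_excursion_eta) auto
  ultimately show ?thesis by (simp add: sol_start)
qed

text \<open>By \<open>sol_sum\<close> the excess over \<open>y + sqrt 2 * w 1 - \<beta>\<close> is
  the integral of \<open>X = - q1\<close> plus \<open>X 1 - X 0\<close>. Up to the first zero the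
  integral is at most \<open>X 0 + \<eta>\<close>, which cancels \<open>X 0\<close>; the integral
  after it and \<open>X 1\<close> cost one more \<open>\<eta>\<close> each. Thus the bound does not
  involve \<open>x\<close>.\<close>

lemma sol_q2_bound:
  assumes "T = 1"
  shows "q2 1 \<le> y + sqrt 2 * w 1 - \<beta> + 3 * \<eta>"
proof -
  have "- integral {0..1} q1 - q1 1 + x \<le> 3 * \<eta>"
  proof (cases "\<exists>\<sigma>\<in>{0..1}. q1 \<sigma> = 0")
    case True
    then obtain \<tau> where "\<tau> \<in> {0..1}" "q1 \<tau> = 0" by blast
    then obtain s where s: "0 \<le> s" "s \<le> 1" "q1 s = 0" "\<And>u. 0 \<le> u \<Longrightarrow> u < s \<Longrightarrow> q1 u < 0"
      using sol_first_zero[of \<tau>] by (metis atLeastAtMost_iff order_trans)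
    have 1: "- integral {0..s} q1 \<le> - x + \<eta>"
      using sol_excursion_eta[of 0 s] s assms sol_start by force
    have after: "- q1 u \<le> \<eta>" if "s \<le> u" "u \<le> 1" for u
      using sol_after_zero[of s u] s that assms by simp
    have "integral {s..1} (\<lambda>_. - \<eta>) \<le> integral {s..1} q1"
      using after s by (intro integral_le integrable_const_ivl sol_integrable) force+
    then have "- integral {s..1} q1 \<le> (1 - s) * \<eta>" using s by simp
    also have "\<dots> \<le> \<eta>" using s eta_nonneg by (simp add: mult_left_le_one_le)
    finally have 2: "- integral {s..1} q1 \<le> \<eta>" .
    have "integral {0..s} q1 + integral {s..1} q1 = integral {0..1} q1"
      using s sol_integrable[of 0 1] by (intro Henstock_Kurzweil_Integration.integral_combine) auto
    then show ?thesis using 1 2 after[of 1] s by simp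
  next
    case False
    then have neg: "q1 u < 0" if "0 \<le> u" "u \<le> 1" for u
      using sol_q1_nonpos[of u] that by (metis atLeastAtMost_iff order_le_less)
    then show ?thesis
      using sol_excursion_eta[of 0 1] assms eta_nonneg sol_start by force
  qed
  then show ?thesis using sol_sum[of 1] by simp
qed

end

end

section \<open>Integrating against a stationary distribution\<close>

text \<open>The integrands need not be measurable here: nothing is known about the measurability of transition
  probabilities in the initial state, and the integral is then a lower integral.\<close>

lemma nn_integral_superadditive:
  "integral\<^sup>N M f + integral\<^sup>N M g \<le> (\<integral>\<^sup>+ x. f x + g x \<partial>M)"
proof -
  have *: "integral\<^sup>S M u + integral\<^sup>S M v \<le> (\<integral>\<^sup>+ x. f x + g x \<partial>M)"
    if u: "simple_function M u" "u \<le> f" and v: "simple_function M v" "v \<le> g" for u v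
  proof -
    have "integral\<^sup>S M u + integral\<^sup>S M v = (\<integral>\<^sup>+ x. u x + v x \<partial>M)"
      using u v by (simp add: nn_integral_eq_simple_integral[symmetric] nn_integral_add borel_measurable_simple_function)
    also have "\<dots> \<le> (\<integral>\<^sup>+ x. f x + g x \<partial>M)"
      using u v by (intro nn_integral_mono add_mono) (auto simp: le_fun_def)
    finally show ?thesis .
  qed
  have ne: "{g'. simple_function M g' \<and> g' \<le> h} \<noteq> {}" for h :: "'a \<Rightarrow> ennreal"
    by (auto intro!: exI[of _ "\<lambda>_. 0"] simp: le_fun_def)
  have "integral\<^sup>N M f + integral\<^sup>N M g =
    (SUP u\<in>{u. simple_function M u \<and> u \<le> f}. SUP v\<in>{v. simple_function M v \<and> v \<le> g}. integral\<^sup>S M u + integral\<^sup>S M v)"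
    unfolding nn_integral_def
    by (simp add: ennreal_SUP_add_left[OF ne, symmetric] ennreal_SUP_add_right[OF ne, symmetric])
  also have "\<dots> \<le> (\<integral>\<^sup>+ x. f x + g x \<partial>M)"
    by (intro SUP_least) (use * in auto)
  finally show ?thesis .
qed

lemma nn_integral_sum_superadditive:
  assumes "finite J"
  shows "(\<Sum>j\<in>J. integral\<^sup>N M (f j)) \<le> (\<integral>\<^sup>+ x. (\<Sum>j\<in>J. f j x) \<partial>M)"
  using assms
proof (induction J)
  case (insert j J)
  have "(\<Sum>j\<in>insert j J. integral\<^sup>N M (f j)) \<le> integral\<^sup>N M (f j) + (\<integral>\<^sup>+ x. (\<Sum>j\<in>J. f j x) \<partial>M)"
    using insert by (simp add: add_left_mono)
  also have "\<dots> \<le> (\<integral>\<^sup>+ x. f j x + (\<Sum>j\<in>J. f j x) \<partial>M)"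
    by (rule nn_integral_superadditive)
  finally show ?case using insert by simp
qed simp

lemma nn_integral_cmult_le:
  assumes "0 \<le> c"
  shows "ennreal c * integral\<^sup>N M f \<le> (\<integral>\<^sup>+ x. ennreal c * f x \<partial>M)"
proof -
  have "ennreal c * integral\<^sup>N M f = (SUP u\<in>{u. simple_function M u \<and> u \<le> f}. ennreal c * integral\<^sup>S M u)"
    unfolding nn_integral_def by (rule SUP_mult_left_ennreal)
  also have "\<dots> \<le> (\<integral>\<^sup>+ x. ennreal c * f x \<partial>M)"
  proof (rule SUP_least, safe)
    fix u assume u: "simple_function M u" "u \<le> f"
    then have "ennreal c * integral\<^sup>S M u = (\<integral>\<^sup>+ x. ennreal c * u x \<partial>M)"
      by (simp add: nn_integral_eq_simple_integral[symmetric] nn_integral_cmult borel_measurable_simple_function)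
    also have "\<dots> \<le> (\<integral>\<^sup>+ x. ennreal c * f x \<partial>M)"
      using u by (intro nn_integral_mono mult_left_mono) (auto simp: le_fun_def)
    finally show "ennreal c * integral\<^sup>S M u \<le> (\<integral>\<^sup>+ x. ennreal c * f x \<partial>M)" .
  qed
  finally show ?thesis .
qed

text \<open>If \<open>j\<close> is the largest true level, the sum has at most \<open>Suc j\<close>
  nonzero terms, and the condition at \<open>j\<close> itself says that \<open>Suc j\<close> terms
  \<open>d\<close> fit below \<open>v\<close>.\<close>

lemma level_sum_le:
  fixes v d :: real and P :: "nat \<Rightarrow> bool"
  assumes "0 < d" "\<And>j. j < k \<Longrightarrow> P j \<Longrightarrow> real (Suc j) * d \<le> v" "0 \<le> v"
  shows "(\<Sum>j<k. d * of_bool (P j)) \<le> v"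
  using assms(2)
proof (induction k)
  case (Suc k)
  show ?case
  proof (cases "P k")
    case True
    have "(\<Sum>j<Suc k. d * of_bool (P j)) \<le> (\<Sum>j<Suc k. d)"
      using \<open>0 < d\<close> by (intro sum_mono) auto
    also have "\<dots> \<le> v" using Suc.prems[of k] True by simp
    finally show ?thesis .
  next
    case False
    then show ?thesis using Suc by simp
  qed
qed (use assms in simp)

text \<open>A nonmeasurable event has transition probability \<open>0\<close> by convention, which is harmless for upper
  bounds; several solutions could share a path, so \<open>f\<close> is decomposed into its nested superlevel sets.\<close>

lemma stationary_integral_le:
  assumes st: "stationary_dist \<beta> \<pi>" and BM: "brownian_motion M W" and t: "0 \<le> t"
    and f [measurable]: "f \<in> borel_measurable borel" and f0: "\<And>z. 0 \<le> f z" and fB: "\<And>z. f z \<le> B"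
    and bound: "AE z in \<pi>. \<exists>F\<in>borel_measurable M.
       (AE \<omega> in M. 0 \<le> F \<omega> \<and> (\<forall>q1 q2 L. reflected_solution \<beta> (W \<omega>) (fst z) (snd z) q1 q2 L \<longrightarrow> f (q1 t, q2 t) \<le> F \<omega>)) \<and>
       (\<integral>\<^sup>+ \<omega>. ennreal (F \<omega>) \<partial>M) \<le> g z"
  shows "(\<integral>\<^sup>+ z. ennreal (f z) \<partial>\<pi>) \<le> integral\<^sup>N \<pi> g"
proof -
  interpret P: prob_space \<pi> using st by (simp add: stationary_dist_def)
  have sets_\<pi> [measurable_cong]: "sets \<pi> = sets borel" using st by (simp add: stationary_dist_def)
  have step: "(\<integral>\<^sup>+ z. ennreal (f z) \<partial>\<pi>) \<le> integral\<^sup>N \<pi> g + ennreal d" if d: "0 < d" for d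
  proof -
    \<comment> \<open>\<open>k\<close> levels of height \<open>d\<close> reach the bound
      \<open>B\<close>, so the layers \<open>A j\<close> with \<open>j < k\<close> recover
      \<open>f\<close> up to an error of at most \<open>d\<close>.\<close>
    define k where "k = nat \<lceil>B / d\<rceil>"
    have k: "B \<le> real k * d"
      using d unfolding k_def by (metis of_nat_ceiling pos_divide_le_eq)
    define A where "A j = {z. real (Suc j) * d < f z}" for j
    have A [measurable]: "A j \<in> sets borel" for j
      unfolding A_def by measurable
    have low: "f z \<le> (\<Sum>j<k. d * indicator (A j) z) + d" for z
    proof -
      define i where "i = nat (\<lceil>f z / d\<rceil> - 1)"
      have i1: "f z \<le> real (Suc i) * d" "j < i \<Longrightarrow> real (Suc j) * d < f z" for j
      proof -
        have "f z / d \<le> real (Suc i)" unfolding i_def by linarith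
        then show "f z \<le> real (Suc i) * d" using d by (simp add: pos_divide_le_eq)
        have "j < i \<Longrightarrow> real (Suc j) < f z / d" unfolding i_def by linarith
        then show "j < i \<Longrightarrow> real (Suc j) * d < f z" using d by (simp add: pos_less_divide_eq)
      qed
      have "i \<le> k"
      proof (rule ccontr)
        assume "\<not> i \<le> k"
        then have "real (Suc k) * d < f z" using i1(2)[of k] by simp
        then show False using fB[of z] k d by (simp add: algebra_simps)
      qed
      have "real i * d = (\<Sum>j<i. d * indicator (A j) z)"
        using i1(2) by (simp add: A_def)
      also have "\<dots> \<le> (\<Sum>j<k. d * indicator (A j) z)"
        using \<open>i \<le> k\<close> d by (intro sum_mono2) auto
      finally show ?thesis using i1(1) by (simp add: algebra_simps)
    qed
    have "(\<integral>\<^sup>+ z. ennreal (f z) \<partial>\<pi>) \<le> (\<integral>\<^sup>+ z. (\<Sum>j<k. ennreal d * indicator (A j) z) + ennreal d \<partial>\<pi>)"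
    proof (rule nn_integral_mono)
      fix z
      have "ennreal (f z) \<le> ennreal ((\<Sum>j<k. d * indicator (A j) z) + d)"
        using low by (rule ennreal_leI)
      also have "\<dots> = ennreal (\<Sum>j<k. d * indicator (A j) z) + ennreal d"
        using d by (intro ennreal_plus sum_nonneg) auto
      also have "ennreal (\<Sum>j<k. d * indicator (A j) z) = (\<Sum>j<k. ennreal (d * indicator (A j) z))"
        using d by (intro sum_ennreal[symmetric]) auto
      also have "\<dots> = (\<Sum>j<k. ennreal d * indicator (A j) z)"
        by (intro sum.cong refl) (auto split: split_indicator)
      finally show "ennreal (f z) \<le> (\<Sum>j<k. ennreal d * indicator (A j) z) + ennreal d" .
    qed
    also have "\<dots> = (\<Sum>j<k. ennreal d * emeasure \<pi> (A j)) + ennreal d"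
    proof -
      have "(\<integral>\<^sup>+ z. (\<Sum>j<k. ennreal d * indicator (A j) z) \<partial>\<pi>) = (\<Sum>j<k. ennreal d * emeasure \<pi> (A j))"
        by (subst nn_integral_sum) (simp_all add: nn_integral_cmult_indicator sets_\<pi>)
      moreover have "(\<integral>\<^sup>+ z. ennreal d \<partial>\<pi>) = ennreal d" by (simp add: P.emeasure_space_1)
      ultimately show ?thesis by (subst nn_integral_add) (simp_all only:, measurable)
    qed
    also have "(\<Sum>j<k. ennreal d * emeasure \<pi> (A j)) = (\<Sum>j<k. ennreal d * (\<integral>\<^sup>+ z. transition_prob \<beta> M W z t (A j) \<partial>\<pi>))"
      using st BM t A unfolding stationary_dist_def by (intro sum.cong) auto
    also have "\<dots> \<le> (\<Sum>j<k. \<integral>\<^sup>+ z. ennreal d * transition_prob \<beta> M W z t (A j) \<partial>\<pi>)"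
      using d by (intro sum_mono nn_integral_cmult_le) simp
    also have "\<dots> \<le> (\<integral>\<^sup>+ z. (\<Sum>j<k. ennreal d * transition_prob \<beta> M W z t (A j)) \<partial>\<pi>)"
      by (rule nn_integral_sum_superadditive) simp
    also have "\<dots> \<le> integral\<^sup>N \<pi> g"
    proof (rule nn_integral_mono_AE)
      show "AE z in \<pi>. (\<Sum>j<k. ennreal d * transition_prob \<beta> M W z t (A j)) \<le> g z"
        using bound
      proof eventually_elim
        case (elim z)
        then obtain F where F [measurable]: "F \<in> borel_measurable M"
          and FA: "AE \<omega> in M. 0 \<le> F \<omega> \<and> (\<forall>q1 q2 L. reflected_solution \<beta> (W \<omega>) (fst z) (snd z) q1 q2 L \<longrightarrow> f (q1 t, q2 t) \<le> F \<omega>)"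
          and Fg: "(\<integral>\<^sup>+ \<omega>. ennreal (F \<omega>) \<partial>M) \<le> g z" by blast
        define E where "E j = {\<omega>\<in>space M. \<exists>q1 q2 L. reflected_solution \<beta> (W \<omega>) (fst z) (snd z) q1 q2 L \<and> (q1 t, q2 t) \<in> A j}" for j
        define J where "J = {j\<in>{..<k}. E j \<in> sets M}"
        have fin: "finite J" by (simp add: J_def)
        have "(\<Sum>j<k. ennreal d * transition_prob \<beta> M W z t (A j)) = (\<Sum>j\<in>J. ennreal d * emeasure M (E j))"
          unfolding transition_prob_def E_def[symmetric] J_def
          by (rule sum.mono_neutral_right) (auto simp: emeasure_notin_sets)
        also have "\<dots> = (\<integral>\<^sup>+ \<omega>. (\<Sum>j\<in>J. ennreal d * indicator (E j) \<omega>) \<partial>M)"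
          using fin by (subst nn_integral_sum) (auto simp: J_def nn_integral_cmult_indicator)
        also have "\<dots> \<le> (\<integral>\<^sup>+ \<omega>. ennreal (F \<omega>) \<partial>M)"
        proof (rule nn_integral_mono_AE)
          show "AE \<omega> in M. (\<Sum>j\<in>J. ennreal d * indicator (E j) \<omega>) \<le> ennreal (F \<omega>)"
            using FA
          proof eventually_elim
            case (elim \<omega>)
            have le: "real (Suc j) * d \<le> F \<omega>" if \<omega>j: "\<omega> \<in> E j" for j
            proof -
              obtain q1 q2 L where "reflected_solution \<beta> (W \<omega>) (fst z) (snd z) q1 q2 L" "(q1 t, q2 t) \<in> A j"
                using \<omega>j unfolding E_def by blast
              then show ?thesis using elim unfolding A_def by force
            qed
            have "(\<Sum>j\<in>J. ennreal d * indicator (E j) \<omega>) = ennreal (\<Sum>j\<in>J. d * of_bool (\<omega> \<in> E j))"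
            proof -
              have "(\<Sum>j\<in>J. ennreal d * indicator (E j) \<omega>) = (\<Sum>j\<in>J. ennreal (d * of_bool (\<omega> \<in> E j)))"
                by (intro sum.cong refl) (auto split: split_indicator)
              also have "\<dots> = ennreal (\<Sum>j\<in>J. d * of_bool (\<omega> \<in> E j))"
                using d by (intro sum_ennreal) auto
              finally show ?thesis .
            qed
            also have "\<dots> \<le> ennreal (\<Sum>j<k. d * of_bool (\<omega> \<in> E j))"
              using d by (intro ennreal_leI sum_mono2) (auto simp: J_def)
            also have "\<dots> \<le> ennreal (F \<omega>)"
              using d le elim by (intro ennreal_leI level_sum_le) auto
            finally show ?case .
          qed
        qed
        also have "\<dots> \<le> g z" by (rule Fg)
        finally show ?case .
      qed
    qed
    finally show ?thesis by (simp add: add_right_mono)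
  qed
  show ?thesis
    by (rule ennreal_le_epsilon) (use step in auto)
qed

lemma stationary_measure_le:
  assumes st: "stationary_dist \<beta> \<pi>" and BM: "brownian_motion M W" and t: "0 \<le> t"
    and A [measurable]: "A \<in> sets borel"
    and bound: "AE z in \<pi>. \<exists>G\<in>sets M. ennreal (measure M G) \<le> g z \<and>
      (AE \<omega> in M. \<forall>q1 q2 L. reflected_solution \<beta> (W \<omega>) (fst z) (snd z) q1 q2 L \<longrightarrow> (q1 t, q2 t) \<in> A \<longrightarrow> \<omega> \<in> G)"
  shows "emeasure \<pi> A \<le> integral\<^sup>N \<pi> g"
proof -
  interpret M: prob_space M using BM by (simp add: brownian_motion_def)
  have sets_\<pi>: "sets \<pi> = sets borel" using st by (simp add: stationary_dist_def)
  have "emeasure \<pi> A = (\<integral>\<^sup>+ z. ennreal (indicator A z) \<partial>\<pi>)"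
    by (simp add: sets_\<pi> ennreal_indicator)
  also have "\<dots> \<le> integral\<^sup>N \<pi> g"
  proof (rule stationary_integral_le[OF st BM t, where B = 1])
    show "AE z in \<pi>. \<exists>F\<in>borel_measurable M.
       (AE \<omega> in M. 0 \<le> F \<omega> \<and> (\<forall>q1 q2 L. reflected_solution \<beta> (W \<omega>) (fst z) (snd z) q1 q2 L \<longrightarrow> indicator A (q1 t, q2 t) \<le> F \<omega>)) \<and>
       (\<integral>\<^sup>+ \<omega>. ennreal (F \<omega>) \<partial>M) \<le> g z"
      using bound
    proof eventually_elim
      case (elim z)
      then obtain G where G: "G \<in> sets M" "ennreal (measure M G) \<le> g z"
        "AE \<omega> in M. \<forall>q1 q2 L. reflected_solution \<beta> (W \<omega>) (fst z) (snd z) q1 q2 L \<longrightarrow> (q1 t, q2 t) \<in> A \<longrightarrow> \<omega> \<in> G"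
        by blast
      show ?case
      proof (intro bexI[of _ "indicator G"] conjI)
        show "AE \<omega> in M. 0 \<le> indicat_real G \<omega> \<and> (\<forall>q1 q2 L. reflected_solution \<beta> (W \<omega>) (fst z) (snd z) q1 q2 L \<longrightarrow> indicator A (q1 t, q2 t) \<le> indicat_real G \<omega>)"
          using G(3) by eventually_elim (auto simp: indicator_def)
        show "(\<integral>\<^sup>+ \<omega>. ennreal (indicator G \<omega>) \<partial>M) \<le> g z"
          using G by (simp add: ennreal_indicator M.emeasure_eq_measure)
      qed (use G in auto)
    qed
  qed (auto simp: indicator_def)
  finally show ?thesis .
qed

text \<open>The upper bound is applied to \<open>- A\<close>, which is reached from \<open>K\<close>
  with probability at most \<open>1 - p\<close>. As \<open>\<pi>\<close> has mass 1, at least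
  \<open>p * measure \<pi> K\<close> remains for \<open>A\<close>.\<close>

lemma stationary_measure_ge:
  assumes st: "stationary_dist \<beta> \<pi>" and BM: "brownian_motion M W" and t: "0 \<le> t"
    and A [measurable]: "A \<in> sets borel" and K [measurable]: "K \<in> sets borel" and K_half: "1 / 2 \<le> measure \<pi> K"
    and p: "0 \<le> p" "p \<le> 1"
    and bound: "\<And>z. z \<in> K \<Longrightarrow> \<exists>E\<in>sets M. p \<le> measure M E \<and>
      (AE \<omega> in M. \<omega> \<in> E \<longrightarrow> (\<forall>q1 q2 L. reflected_solution \<beta> (W \<omega>) (fst z) (snd z) q1 q2 L \<longrightarrow> (q1 t, q2 t) \<in> A))"
  shows "p / 2 \<le> measure \<pi> A"
proof -
  interpret M: prob_space M using BM by (simp add: brownian_motion_def)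
  interpret P: prob_space \<pi> using st by (simp add: stationary_dist_def)
  have sets_\<pi> [measurable_cong]: "sets \<pi> = sets borel" using st by (simp add: stationary_dist_def)
  have sp: "space \<pi> = UNIV" using sets_eq_imp_space_eq[OF sets_\<pi>] by simp
  have "emeasure \<pi> (- A) \<le> (\<integral>\<^sup>+ z. ennreal (1 - p * indicator K z) \<partial>\<pi>)"
  proof (rule stationary_measure_le[OF st BM t])
    show "- A \<in> sets borel" by measurable
    show "AE z in \<pi>. \<exists>G\<in>sets M. ennreal (measure M G) \<le> ennreal (1 - p * indicator K z) \<and>
      (AE \<omega> in M. \<forall>q1 q2 L. reflected_solution \<beta> (W \<omega>) (fst z) (snd z) q1 q2 L \<longrightarrow> (q1 t, q2 t) \<in> - A \<longrightarrow> \<omega> \<in> G)"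
    proof (intro AE_I2)
      fix z
      show "\<exists>G\<in>sets M. ennreal (measure M G) \<le> ennreal (1 - p * indicator K z) \<and>
      (AE \<omega> in M. \<forall>q1 q2 L. reflected_solution \<beta> (W \<omega>) (fst z) (snd z) q1 q2 L \<longrightarrow> (q1 t, q2 t) \<in> - A \<longrightarrow> \<omega> \<in> G)"
      proof (cases "z \<in> K")
        case True
        from bound[OF this] obtain E where E: "E \<in> sets M" "p \<le> measure M E"
          "AE \<omega> in M. \<omega> \<in> E \<longrightarrow> (\<forall>q1 q2 L. reflected_solution \<beta> (W \<omega>) (fst z) (snd z) q1 q2 L \<longrightarrow> (q1 t, q2 t) \<in> A)"
          by blast
        show ?thesis
        proof (intro bexI[of _ "space M - E"] conjI)
          show "ennreal (measure M (space M - E)) \<le> ennreal (1 - p * indicator K z)"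
            using E True by (intro ennreal_leI) (simp add: M.prob_compl)
          show "AE \<omega> in M. \<forall>q1 q2 L. reflected_solution \<beta> (W \<omega>) (fst z) (snd z) q1 q2 L \<longrightarrow> (q1 t, q2 t) \<in> - A \<longrightarrow> \<omega> \<in> space M - E"
            using E(3) AE_space by eventually_elim blast
        qed (use E in auto)
      next
        case False
        show ?thesis
        proof (intro bexI[of _ "space M"] conjI)
          show "AE \<omega> in M. \<forall>q1 q2 L. reflected_solution \<beta> (W \<omega>) (fst z) (snd z) q1 q2 L \<longrightarrow> (q1 t, q2 t) \<in> - A \<longrightarrow> \<omega> \<in> space M"
            using AE_space by eventually_elim blast
        qed (use False in \<open>auto simp: M.prob_space\<close>)
      qed
    qed
  qed
  also have "\<dots> = ennreal (\<integral> z. 1 - p * indicator K z \<partial>\<pi>)"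
    using p by (intro nn_integral_eq_integral P.integrable_const_bound[where B = 1]) (auto simp: indicator_def)
  also have "(\<integral> z. 1 - p * indicator K z \<partial>\<pi>) = 1 - p * measure \<pi> K"
    by (subst Bochner_Integration.integral_diff) (auto simp: P.prob_space sets_\<pi> P.emeasure_eq_measure)
  finally have "measure \<pi> (- A) \<le> 1 - p * measure \<pi> K"
    using p by (subst (asm) P.emeasure_eq_measure, subst (asm) ennreal_le_iff) (auto intro!: mult_le_one)
  moreover have "measure \<pi> (- A) = 1 - measure \<pi> A"
    using P.prob_compl[of A] by (simp add: sets_\<pi> sp Compl_eq_Diff_UNIV)
  moreover have "p * (1 / 2) \<le> p * measure \<pi> K"
    using p K_half by (intro mult_left_mono)
  ultimately show ?thesis by simp
qed

section \<open>Tightness and support of a stationary law, and noise bounds from the path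
  modulus\<close>

lemma (in prob_space) prob_tail_tendsto_0:
  fixes X :: "'a \<Rightarrow> real"
  assumes [measurable]: "X \<in> borel_measurable M"
  shows "(\<lambda>n::nat. prob {z\<in>space M. real n < X z}) \<longlonglongrightarrow> 0"
proof -
  have "(\<lambda>n::nat. prob {z\<in>space M. real n < X z}) \<longlonglongrightarrow> prob (\<Inter>n::nat. {z\<in>space M. real n < X z})"
    by (rule finite_Lim_measure_decseq) (auto simp: decseq_def)
  also have "(\<Inter>n::nat. {z\<in>space M. real n < X z}) = {}"
  proof safe
    fix z assume z: "z \<in> (\<Inter>n::nat. {z\<in>space M. real n < X z})"
    obtain n :: nat where "X z \<le> real n" using real_arch_simple by blast
    moreover have "real n < X z" using z by blast
    ultimately show "z \<in> {}" by simp
  qed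
  finally show ?thesis by simp
qed

lemma borel_coordinate_sets [simp]:
  fixes a :: real
  shows "{z::real \<times> real. fst z < a} \<in> sets borel" "{z::real \<times> real. a < fst z} \<in> sets borel"
    "{z::real \<times> real. snd z < a} \<in> sets borel" "{z::real \<times> real. a < snd z} \<in> sets borel"
  by (intro borel_open open_Collect_less continuous_intros)+

lemma borel_measurable_coordinates:
  assumes "sets M = sets (borel :: (real \<times> real) measure)"
  shows "fst \<in> borel_measurable M" "snd \<in> borel_measurable M"
  unfolding measurable_cong_sets[OF assms refl]
  by (intro borel_measurable_continuous_onI continuous_intros)+

text \<open>For \<open>q1\<close> time 0 suffices: every solution has \<open>q1 0 \<le> 0\<close>,
  so no start leads to a positive value. For \<open>q2\<close>, a value below \<open>- a\<close> at
  time \<open>t\<close> requires a start below \<open>- a * exp t\<close>; letting \<open>t\<close>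
  grow, the mass of such starts tends to 0.\<close>

lemma stationary_support:
  assumes st: "stationary_dist \<beta> \<pi>"
  shows "AE z in \<pi>. fst z \<le> 0 \<and> 0 \<le> snd z"
proof -
  note BM = brownian_motion_exists
  interpret P: prob_space \<pi> using st by (simp add: stationary_dist_def)
  have sets_\<pi>: "sets \<pi> = sets borel" using st by (simp add: stationary_dist_def)
  note [measurable] = borel_measurable_coordinates[OF sets_\<pi>]
  have sp: "space \<pi> = UNIV" using sets_eq_imp_space_eq[OF sets_\<pi>] by simp
  have w0: "limit_path \<omega> 0 = 0" for \<omega> by (rule limit_path_zero)
  have "emeasure \<pi> {z. 0 < fst z} \<le> (\<integral>\<^sup>+ z. 0 \<partial>\<pi>)"
  proof (rule stationary_measure_le[OF st BM order_refl])
    show "AE z in \<pi>. \<exists>G\<in>sets dyadic_law. ennreal (measure dyadic_law G) \<le> 0 \<and>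
      (AE \<omega> in dyadic_law. \<forall>q1 q2 L. reflected_solution \<beta> (limit_path \<omega>) (fst z) (snd z) q1 q2 L \<longrightarrow> (q1 0, q2 0) \<in> {z. 0 < fst z} \<longrightarrow> \<omega> \<in> G)"
      using sol_q1_nonpos w0 by (intro AE_I2 bexI[of _ "{}"] conjI) (auto simp: not_less)
  qed simp
  then have "AE z in \<pi>. \<not> 0 < fst z"
    by (subst AE_iff_measurable[where N = "{z. 0 < fst z}"]) (auto simp: sp sets_\<pi>)
  moreover have "AE z in \<pi>. \<not> snd z < - (1 / real (Suc k))" for k
  proof -
    define a where "a = 1 / real (Suc k)"
    have a: "0 < a" by (simp add: a_def)
    have le: "P.prob {z. snd z < - a} \<le> P.prob {z\<in>space \<pi>. real n < - snd z}" for n :: nat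
    proof -
      \<comment> \<open>Chosen so that \<open>a * exp t \<ge> a * (1 + t) \<ge> n\<close>, which
        turns the condition on the start into a tail event with an integer threshold.\<close>
      define t where "t = real n / a"
      have t: "0 \<le> t" using a by (simp add: t_def)
      have "1 + t \<le> exp t" by (rule exp_ge_add_one_self)
      then have "real n \<le> a * exp t" using a by (simp add: t_def field_simps)
      have "emeasure \<pi> {z. snd z < - a} \<le> (\<integral>\<^sup>+ z. indicator {z\<in>space \<pi>. real n < - snd z} z \<partial>\<pi>)"
      proof (rule stationary_measure_le[OF st BM t])
        show "AE z in \<pi>. \<exists>G\<in>sets dyadic_law. ennreal (measure dyadic_law G) \<le> indicator {z\<in>space \<pi>. real n < - snd z} z \<and>
          (AE \<omega> in dyadic_law. \<forall>q1 q2 L. reflected_solution \<beta> (limit_path \<omega>) (fst z) (snd z) q1 q2 L \<longrightarrow> (q1 t, q2 t) \<in> {z. snd z < - a} \<longrightarrow> \<omega> \<in> G)"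
        proof (intro AE_I2)
          fix z
          show "\<exists>G\<in>sets dyadic_law. ennreal (measure dyadic_law G) \<le> indicator {z\<in>space \<pi>. real n < - snd z} z \<and>
          (AE \<omega> in dyadic_law. \<forall>q1 q2 L. reflected_solution \<beta> (limit_path \<omega>) (fst z) (snd z) q1 q2 L \<longrightarrow> (q1 t, q2 t) \<in> {z. snd z < - a} \<longrightarrow> \<omega> \<in> G)"
          proof (cases "real n < - snd z")
            case True
            then show ?thesis
              by (intro bexI[of _ "space dyadic_law"] conjI AE_I2) (auto simp: sp walk_limit.P.prob_space)
          next
            case False
            have "\<not> q2 t < - a" if "reflected_solution \<beta> (limit_path \<omega>) (fst z) (snd z) q1 q2 L" for \<omega> q1 q2 L
            proof -
              have "- (a * exp t) \<le> snd z" using False \<open>real n \<le> a * exp t\<close> by linarith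
              then have "exp (- t) * (- (a * exp t)) \<le> exp (- t) * snd z" by (intro mult_left_mono) auto
              moreover have "exp (- t) * (- (a * exp t)) = - a" by (simp add: exp_minus field_simps)
              ultimately have "- a \<le> exp (- t) * snd z" by (simp only:)
              also have "\<dots> \<le> q2 t" by (rule sol_q2_lower[OF that w0 t])
              finally show ?thesis by simp
            qed
            then show ?thesis
              by (intro bexI[of _ "{}"] conjI AE_I2) auto
          qed
        qed
      qed simp
      moreover have "{z\<in>space \<pi>. real n < - snd z} \<in> sets \<pi>" by measurable
      ultimately show ?thesis by (simp only: nn_integral_indicator P.emeasure_eq_measure) simp
    qed
    have "(\<lambda>n::nat. P.prob {z\<in>space \<pi>. real n < - snd z}) \<longlonglongrightarrow> 0"
      by (rule P.prob_tail_tendsto_0) measurable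
    then have "P.prob {z. snd z < - a} \<le> 0"
      by (rule LIMSEQ_le_const) (use le in blast)
    then have "emeasure \<pi> {z. snd z < - a} = 0"
      by (simp add: P.emeasure_eq_measure measure_le_0_iff)
    then show ?thesis
      unfolding a_def[symmetric] by (subst AE_iff_measurable[where N = "{z. snd z < - a}"]) (auto simp: sp sets_\<pi>)
  qed
  then have "AE z in \<pi>. \<forall>k. \<not> snd z < - (1 / real (Suc k))"
    by (subst AE_all_countable) blast
  ultimately show ?thesis
  proof eventually_elim
    case (elim z)
    have "0 \<le> snd z"
    proof (rule ccontr)
      assume "\<not> 0 \<le> snd z"
      then obtain k where "1 / real (Suc k) < - snd z"
        using reals_Archimedean[of "- snd z"] by (auto simp: inverse_eq_divide)
      then show False using elim(2) by (auto dest: spec[of _ k])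
    qed
    then show ?case using elim by auto
  qed
qed

text \<open>The instance \<open>m = 0\<close> of the quantity bounded by \<open>\<eta>\<close>: with
  only \<open>q2 \<ge> 0\<close> known, the term \<open>\<beta> * (t - s)\<close> works upwards and
  costs at most \<open>\<beta>\<close>.\<close>

lemma path_modulus_noise:
  assumes "path_modulus w h" "0 \<le> \<beta>" "0 \<le> s" "s \<le> t" "t \<le> 1 / 2 ^ n"
  shows "sqrt 2 * \<bar>w t - w s\<bar> - (0 - \<beta>) * (t - s) \<le> 9 * sqrt 2 * h * (4/5) ^ n + \<beta>"
proof -
  have n: "1 / 2 ^ n \<le> (1::real)" by simp
  have "\<bar>w t - w s\<bar> \<le> 9 * h * (4/5) ^ n"
    using assms n unfolding path_modulus_def
    by (elim conjE allE[of _ n] allE[of _ s] allE[of _ t]) linarith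
  then have "sqrt 2 * \<bar>w t - w s\<bar> \<le> sqrt 2 * (9 * h * (4/5) ^ n)" by (rule mult_left_mono) simp
  moreover have "\<beta> * (t - s) \<le> \<beta> * 1" using assms n by (intro mult_left_mono) linarith+
  ultimately have "sqrt 2 * \<bar>w t - w s\<bar> + \<beta> * (t - s) \<le> sqrt 2 * (9 * h * (4/5) ^ n) + \<beta>"
    by linarith
  then show ?thesis by (simp only: diff_0 mult_minus_left diff_minus_eq_add mult_ac)
qed

section \<open>Upper tail of the first coordinate\<close>

lemma sqrt_2_bounds: "7 / 5 \<le> sqrt (2::real)" "sqrt (2::real) \<le> 13 / 9"
  by (rule real_le_rsqrt real_le_lsqrt; simp add: power2_eq_square)+

text \<open>\<open>modulus_const\<close> times the sum of the geometric series of ratio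
  \<open>exp (- 1 / 4)\<close> that arises when the tail recursion is iterated.\<close>

definition q1_const :: real where
  "q1_const = modulus_const / (1 - exp (- 1 / 4))"

lemma modulus_const_pos: "0 < modulus_const"
  unfolding modulus_const_def using summable_chaining[of 1] by (intro suminf_pos) (auto intro!: mult_pos_pos add_pos_nonneg)

lemma q1_const_pos: "0 < q1_const"
  unfolding q1_const_def using modulus_const_pos by simp

text \<open>The constants come from \<open>9 sqrt 2 \<le> 13\<close>, \<open>104 = 8 * 13\<close> and \<open>43264 = 4 * 104^2\<close>.\<close>

lemma stationary_q1_recursion:
  assumes st: "stationary_dist \<beta> \<pi>" and \<beta>: "0 < \<beta>" and x: "104 \<le> x" "8 * \<beta> \<le> x"
  shows "measure \<pi> {z. fst z < - x} \<le> measure \<pi> {z. fst z < - (3 / 2 * x)} + modulus_const * exp (- x\<^sup>2 / 43264)"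
proof -
  note BM = brownian_motion_exists
  interpret P: prob_space \<pi> using st by (simp add: stationary_dist_def)
  have sets_\<pi>: "sets \<pi> = sets borel" using st by (simp add: stationary_dist_def)
  obtain H where H [measurable]: "H \<in> borel_measurable dyadic_law"
    and tail: "\<And>A. 1 \<le> A \<Longrightarrow> measure dyadic_law {\<omega>\<in>space dyadic_law. A < H \<omega>} \<le> modulus_const * exp (- A\<^sup>2 / 4)"
    and mod: "AE \<omega> in dyadic_law. path_modulus (limit_path \<omega>) (H \<omega>)"
    using brownian_modulus[OF BM] by blast
  define r where "r = modulus_const * exp (- x\<^sup>2 / 43264)"
  define G where "G = {\<omega>\<in>space dyadic_law. x / 104 < H \<omega>}"
  have G: "G \<in> sets dyadic_law" unfolding G_def by measurable
  have Gr: "measure dyadic_law G \<le> r"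
    using tail[of "x / 104"] x by (simp add: G_def r_def power_divide)
  have r: "0 \<le> r" using modulus_const_pos by (simp add: r_def)
  have "emeasure \<pi> {z. fst z < - x} \<le> (\<integral>\<^sup>+ z. indicator {z. fst z < - (3 / 2 * x)} z + ennreal r \<partial>\<pi>)"
  proof (rule stationary_measure_le[OF st BM, of 1])
    show "AE z in \<pi>. \<exists>G\<in>sets dyadic_law. ennreal (measure dyadic_law G) \<le> indicator {z. fst z < - (3 / 2 * x)} z + ennreal r \<and>
      (AE \<omega> in dyadic_law. \<forall>q1 q2 L. reflected_solution \<beta> (limit_path \<omega>) (fst z) (snd z) q1 q2 L \<longrightarrow>
        (q1 1, q2 1) \<in> {z. fst z < - x} \<longrightarrow> \<omega> \<in> G)"
      using stationary_support[OF st]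
    proof eventually_elim
      case (elim z)
      show ?case
      proof (cases "fst z < - (3 / 2 * x)")
        case True
        have "AE \<omega> in dyadic_law. \<omega> \<in> space dyadic_law" by (rule AE_space)
        moreover have "ennreal (measure dyadic_law (space dyadic_law)) \<le> indicator {z. fst z < - (3 / 2 * x)} z + ennreal r"
          unfolding walk_limit.P.prob_space using True by (simp add: add_increasing2)
        ultimately show ?thesis
          by (intro bexI[of _ "space dyadic_law"] conjI) (auto elim!: eventually_mono)
      next
        case False
        have "AE \<omega> in dyadic_law. \<forall>q1 q2 L. reflected_solution \<beta> (limit_path \<omega>) (fst z) (snd z) q1 q2 L \<longrightarrow>
          (q1 1, q2 1) \<in> {z. fst z < - x} \<longrightarrow> \<omega> \<in> G"
          using mod AE_space
        proof eventually_elim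
          case (elim \<omega>)
          note \<omega> = this
          show ?case
          proof (intro allI impI)
            fix q1 q2 L
            assume sol: "reflected_solution \<beta> (limit_path \<omega>) (fst z) (snd z) q1 q2 L" and "(q1 1, q2 1) \<in> {z. fst z < - x}"
            then have x1: "x < - q1 1" by simp
            have h: "0 \<le> H \<omega>" using \<omega> by (simp add: path_modulus_def)
            have "- q1 1 \<le> - fst z / 2 + (9 * sqrt 2 * H \<omega> * (4/5) ^ 0 + \<beta>)"
            proof (rule sol_q1_contraction[OF sol limit_path_zero, where m = 0 and T = 1])
              fix u :: real assume "0 \<le> u"
              have "0 \<le> exp (- u) * snd z" using \<open>fst z \<le> 0 \<and> 0 \<le> snd z\<close> by simp
              also have "\<dots> \<le> q2 u" by (rule sol_q2_lower[OF sol limit_path_zero \<open>0 \<le> u\<close>])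
              finally show "0 \<le> q2 u" .
            next
              fix s t :: real assume "0 \<le> s" "s \<le> t" "t \<le> 1"
              then show "sqrt 2 * \<bar>limit_path \<omega> t - limit_path \<omega> s\<bar> - (0 - \<beta>) * (t - s) \<le> 9 * sqrt 2 * H \<omega> * (4/5) ^ 0 + \<beta>"
                using \<omega> \<beta> by (intro path_modulus_noise) auto
            qed auto
            moreover have "9 * sqrt 2 * H \<omega> \<le> 13 * H \<omega>"
              using sqrt_2_bounds h by (intro mult_right_mono) auto
            \<comment> \<open>Half of a start of size at most \<open>3/2 * x\<close> is
              \<open>3/4 * x\<close>, and \<open>\<beta> \<le> x / 8\<close>; hence
              \<open>13 * H\<close> must exceed the missing \<open>x / 8\<close>.\<close>
            ultimately have "x < 3 / 4 * x + 13 * H \<omega> + \<beta>"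
              using x1 False by simp
            then have "x / 104 < H \<omega>" using x by simp
            then show "\<omega> \<in> G" using \<omega> by (simp add: G_def)
          qed
        qed
        then show ?thesis using G Gr False
          by (intro bexI[of _ G] conjI) (auto intro: ennreal_leI)
      qed
    qed
  qed auto
  also have "\<dots> = emeasure \<pi> {z. fst z < - (3 / 2 * x)} + ennreal r"
    by (subst nn_integral_add) (auto simp: sets_\<pi> P.emeasure_space_1 intro!: borel_measurable_indicator)
  finally show ?thesis
    unfolding r_def[symmetric] using r
    by (simp add: P.emeasure_eq_measure ennreal_plus[symmetric] del: ennreal_plus)
qed

text \<open>The recursion is iterated along \<open>(3/2) ^ k * x\<close>. Its errors are dominated
  by a geometric series, and the remaining tail vanishes as \<open>k\<close> grows simply because
  \<open>\<pi>\<close> is a finite measure.\<close>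

lemma stationary_q1_upper:
  assumes st: "stationary_dist \<beta> \<pi>" and \<beta>: "0 < \<beta>" and x: "104 \<le> x" "8 * \<beta> \<le> x"
  shows "measure \<pi> {z. fst z < - x} \<le> q1_const * exp (- x\<^sup>2 / 43264)"
proof -
  interpret P: prob_space \<pi> using st by (simp add: stationary_dist_def)
  have sets_\<pi>: "sets \<pi> = sets borel" using st by (simp add: stationary_dist_def)
  have sp: "space \<pi> = UNIV" using sets_eq_imp_space_eq[OF sets_\<pi>] by simp
  note [measurable] = borel_measurable_coordinates[OF sets_\<pi>]
  define F where "F u = measure \<pi> {z. fst z < - u}" for u
  define c where "c = modulus_const * exp (- x\<^sup>2 / 43264)"
  have c: "0 \<le> c" using modulus_const_pos by (simp add: c_def)
  have xk: "x \<le> (3/2) ^ k * x" for k using x by (simp add: one_le_power)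
  have it: "F x \<le> F ((3/2) ^ k * x) + (\<Sum>i<k. c * exp (- 1 / 4) ^ i)" for k
  proof (induction k)
    case (Suc k)
    have "F ((3/2) ^ k * x) \<le> F ((3/2) ^ Suc k * x) + modulus_const * exp (- ((3/2) ^ k * x)\<^sup>2 / 43264)"
      using stationary_q1_recursion[OF st \<beta>, of "(3/2) ^ k * x"] x xk[of k] unfolding F_def
      by (simp add: mult.assoc)
    also have "modulus_const * exp (- ((3/2) ^ k * x)\<^sup>2 / 43264) \<le> c * exp (- 1 / 4) ^ k"
    proof -
      \<comment> \<open>Linear growth of \<open>(9/4) ^ k\<close> is enough: since
        \<open>x^2 \<ge> 104^2 = 43264 / 4\<close>, every unit of \<open>k\<close> gains a factor
        \<open>exp (- 1 / 4)\<close>.\<close>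
      have "real k + 1 \<le> (9/4) ^ k"
        using Bernoulli_inequality[of "5/4 :: real" k] by simp
      then have "(real k + 1) * x\<^sup>2 \<le> (9/4) ^ k * x\<^sup>2" by (intro mult_right_mono) auto
      also have "(9/4) ^ k * x\<^sup>2 = ((3/2) ^ k * x)\<^sup>2"
        by (simp add: power_mult_distrib power2_eq_square flip: power_mult_distrib)
      finally have 1: "(real k + 1) * x\<^sup>2 \<le> ((3/2) ^ k * x)\<^sup>2" .
      have "104\<^sup>2 \<le> x\<^sup>2" using x by (intro power_mono) auto
      then have "real k * 10816 \<le> real k * x\<^sup>2" by (intro mult_left_mono) auto
      with 1 have "- ((3/2) ^ k * x)\<^sup>2 / 43264 \<le> - x\<^sup>2 / 43264 + real k * (- 1 / 4)"
        by (simp add: algebra_simps)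
      then have "exp (- ((3/2) ^ k * x)\<^sup>2 / 43264) \<le> exp (- x\<^sup>2 / 43264) * exp (- 1 / 4) ^ k"
        by (simp only: exp_of_nat_mult[symmetric] exp_add[symmetric] exp_le_cancel_iff)
      then show ?thesis
        using modulus_const_pos unfolding c_def by (simp only: mult.assoc mult_le_cancel_left_pos)
    qed
    finally show ?case using Suc by simp
  qed simp
  have geo: "(\<Sum>i<k. c * exp (- 1 / 4) ^ i) \<le> c / (1 - exp (- 1 / 4))" for k
  proof -
    have "(\<Sum>i<k. c * exp (- 1 / 4) ^ i) \<le> (\<Sum>i. c * exp (- 1 / 4) ^ i)"
      using c by (intro sum_le_suminf summable_mult summable_geometric) auto
    also have "\<dots> = c / (1 - exp (- 1 / 4))"
      by (subst suminf_mult) (auto simp: suminf_geometric summable_geometric)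
    finally show ?thesis .
  qed
  have lim: "(\<lambda>n::nat. P.prob {z\<in>space \<pi>. real n < - fst z}) \<longlonglongrightarrow> 0"
    by (rule P.prob_tail_tendsto_0) measurable
  have "F x \<le> P.prob {z\<in>space \<pi>. real k < - fst z} + c / (1 - exp (- 1 / 4))" for k :: nat
  proof -
    have "real k \<le> (3/2) ^ k * x"
    proof -
      have "1 + real k * (1/2) \<le> (3/2) ^ k" using Bernoulli_inequality[of "1/2" k] by simp
      then have "(1 + real k * (1/2)) * 104 \<le> (3/2) ^ k * x" using x by (intro mult_mono) auto
      then show ?thesis by simp
    qed
    then have "F ((3/2) ^ k * x) \<le> P.prob {z\<in>space \<pi>. real k < - fst z}"
      unfolding F_def by (intro P.finite_measure_mono, force simp: sp, measurable)
    then show ?thesis using it[of k] geo[of k] by linarith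
  qed
  then have "F x \<le> 0 + c / (1 - exp (- 1 / 4))"
    by (intro LIMSEQ_le_const[OF tendsto_add[OF lim tendsto_const]]) blast
  then show ?thesis by (simp add: F_def c_def q1_const_def)
qed

section \<open>Upper tail of the second coordinate\<close>

text \<open>With a downward drift of rate at least \<open>4^n\<close>, increments of \<open>W\<close> over times below \<open>2^-n\<close> are small by the
  modulus of continuity, and over longer times the drift removes at least \<open>2^n\<close>.\<close>

definition noise_bound :: "real \<Rightarrow> nat \<Rightarrow> real" where
  "noise_bound h n = 9 * sqrt 2 * h * (4/5) ^ n + max 0 (9 * sqrt 2 * h - 2 ^ n)"

lemma noise_bound_le:
  assumes "0 \<le> h"
  shows "noise_bound h n \<le> 26 * h"
proof -
  have "9 * sqrt 2 * h \<le> 13 * h" using sqrt_2_bounds assms by (intro mult_right_mono) auto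
  moreover have "9 * sqrt 2 * h * (4/5) ^ n \<le> 9 * sqrt 2 * h * 1"
    using assms by (intro mult_left_mono power_le_one) auto
  moreover have "0 \<le> (2::real) ^ n" by simp
  ultimately show ?thesis using assms unfolding noise_bound_def max_def by (cases "0 \<le> 9 * sqrt 2 * h - 2 ^ n"; simp only: if_True if_False; linarith)
qed

lemma noise_bound_tendsto_0: "(\<lambda>n. noise_bound h n) \<longlonglongrightarrow> 0"
proof -
  obtain N :: nat where N: "9 * sqrt 2 * h < 2 ^ N" using real_arch_pow[of 2] by auto
  have "\<forall>\<^sub>F n in sequentially. max 0 (9 * sqrt 2 * h - 2 ^ n) = 0"
    using eventually_ge_at_top[of N]
  proof eventually_elim
    case (elim n)
    then have "(2::real) ^ N \<le> 2 ^ n" by (intro power_increasing) auto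
    then have "9 * sqrt 2 * h - 2 ^ n \<le> 0" using N by linarith
    then show ?case by (rule max_absorb1)
  qed
  then have "(\<lambda>n. max 0 (9 * sqrt 2 * h - 2 ^ n)) \<longlonglongrightarrow> 0" by (rule tendsto_eventually)
  moreover have "(\<lambda>n. 9 * sqrt 2 * h * (4/5) ^ n) \<longlonglongrightarrow> 9 * sqrt 2 * h * 0"
    by (intro tendsto_intros) auto
  ultimately have "(\<lambda>n. 9 * sqrt 2 * h * (4/5) ^ n + max 0 (9 * sqrt 2 * h - 2 ^ n)) \<longlonglongrightarrow> 9 * sqrt 2 * h * 0 + 0"
    by (rule tendsto_add[rotated])
  then show ?thesis by (simp add: noise_bound_def)
qed

lemma path_modulus_noise_bound:
  assumes w: "path_modulus w h" and st: "0 \<le> s" "s \<le> t" "t \<le> 1" and m: "4 ^ n \<le> m"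
  shows "sqrt 2 * \<bar>w t - w s\<bar> - m * (t - s) \<le> noise_bound h n"
proof -
  have h: "0 \<le> h" using w by (simp add: path_modulus_def)
  have mod: "sqrt 2 * \<bar>w t - w s\<bar> \<le> 9 * sqrt 2 * h * (4/5) ^ k" if "t - s \<le> 1 / 2 ^ k" for k
  proof -
    have "\<bar>w t - w s\<bar> \<le> 9 * h * (4/5) ^ k"
      using w st that unfolding path_modulus_def
      by (elim conjE allE[of _ k] allE[of _ s] allE[of _ t]) linarith
    then have "sqrt 2 * \<bar>w t - w s\<bar> \<le> sqrt 2 * (9 * h * (4/5) ^ k)" by (rule mult_left_mono) simp
    then show ?thesis by (simp only: mult_ac)
  qed
  have m0: "0 \<le> m" using m by (meson order.trans zero_le_numeral zero_le_power)
  show ?thesis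
  proof (cases "t - s \<le> 1 / 2 ^ n")
    case True
    have "0 \<le> m * (t - s)" using m0 st by simp
    moreover have "0 \<le> max 0 (9 * sqrt 2 * h - 2 ^ n)" by simp
    ultimately show ?thesis using mod[OF True] unfolding noise_bound_def by linarith
  next
    case False
    have "4 ^ n * (1 / 2 ^ n) \<le> m * (t - s)"
      using False m m0 by (intro mult_mono) auto
    moreover have "4 ^ n * (1 / 2 ^ n) = (2::real) ^ n"
      by (simp add: field_simps flip: power_mult_distrib)
    moreover have "0 \<le> 9 * sqrt 2 * h * (4/5) ^ n" using h by simp
    moreover have "9 * sqrt 2 * h - 2 ^ n \<le> max 0 (9 * sqrt 2 * h - 2 ^ n)" by simp
    moreover have "sqrt 2 * \<bar>w t - w s\<bar> \<le> 9 * sqrt 2 * h" using mod[of 0] st by simp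
    ultimately show ?thesis unfolding noise_bound_def by linarith
  qed
qed

context
  fixes \<beta> x y h :: real and w q1 q2 L :: "real \<Rightarrow> real"
  assumes sol: "reflected_solution \<beta> w x y q1 q2 L" and w0: "w 0 = 0"
    and mod: "path_modulus w h" and y: "0 \<le> y" and \<beta>: "0 < \<beta>"
begin

text \<open>On the unit interval \<open>q2 u \<ge> exp (- u) * y \<ge> y / 3\<close>, so
  \<open>m = y / 3\<close> is admissible and leaves a net drift
  \<open>m - \<beta> \<ge> 4 ^ n\<close>, the strength needed for
  \<open>noise_bound h n\<close>.\<close>

lemma sol_q2_high:
  assumes "3 * (4 ^ n + \<beta>) \<le> y"
  shows "q2 1 \<le> y + sqrt 2 * w 1 - \<beta> + 3 * noise_bound h n"
proof (rule sol_q2_bound[OF sol w0, where m = "y / 3" and T = 1])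
  fix u :: real assume u: "0 \<le> u" "u \<le> 1"
  have "exp 1 \<le> (3::real)" by (rule exp_le)
  then have "y / 3 \<le> y / exp 1" using y by (intro divide_left_mono) auto
  also have "y / exp 1 = exp (- 1) * y" by (simp add: exp_minus divide_inverse)
  also have "\<dots> \<le> exp (- u) * y" using u y by (intro mult_right_mono) auto
  also have "\<dots> \<le> q2 u" by (rule sol_q2_lower[OF sol w0 u(1)])
  finally show "y / 3 \<le> q2 u" .
next
  fix s t :: real assume "0 \<le> s" "s \<le> t" "t \<le> 1"
  then show "sqrt 2 * \<bar>w t - w s\<bar> - (y / 3 - \<beta>) * (t - s) \<le> noise_bound h n"
    using assms by (intro path_modulus_noise_bound mod) auto
qed auto

text \<open>Here \<open>m = 0\<close> and \<open>\<eta> \<le> 13 * h + \<beta>\<close>, while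
  \<open>sqrt 2 * w 1 \<le> 13 * h\<close>; hence \<open>52 = 13 + 3 * 13\<close> and
  \<open>2 * \<beta> = 3 * \<beta> - \<beta>\<close>.\<close>

lemma sol_q2_low: "q2 1 \<le> y + 52 * h + 2 * \<beta>"
proof -
  have h: "0 \<le> h" using mod by (simp add: path_modulus_def)
  have h13: "9 * sqrt 2 * h \<le> 13 * h" using sqrt_2_bounds h by (intro mult_right_mono) auto
  have "\<bar>w 1\<bar> \<le> 9 * h"
    using mod w0 unfolding path_modulus_def
    by (elim conjE allE[of _ 0] allE[of _ 0] allE[of _ 1]) simp
  then have "sqrt 2 * w 1 \<le> sqrt 2 * (9 * h)" by (intro mult_left_mono) auto
  then have w1: "sqrt 2 * w 1 \<le> 13 * h" using h13 by linarith
  have "q2 1 \<le> y + sqrt 2 * w 1 - \<beta> + 3 * (9 * sqrt 2 * h * (4/5) ^ 0 + \<beta>)"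
  proof (rule sol_q2_bound[OF sol w0, where m = 0 and T = 1])
    fix u :: real assume u: "0 \<le> u" "u \<le> 1"
    have "0 \<le> exp (- u) * y" using y by simp
    also have "\<dots> \<le> q2 u" by (rule sol_q2_lower[OF sol w0 u(1)])
    finally show "0 \<le> q2 u" .
  next
    fix s t :: real assume "0 \<le> s" "s \<le> t" "t \<le> 1"
    then show "sqrt 2 * \<bar>w t - w s\<bar> - (0 - \<beta>) * (t - s) \<le> 9 * sqrt 2 * h * (4/5) ^ 0 + \<beta>"
      using \<beta> by (intro path_modulus_noise mod) auto
  qed auto
  moreover obtain g where g: "g = 9 * sqrt 2 * h" by blast
  ultimately show ?thesis using w1 h13 unfolding power_0 mult_1_right g[symmetric] by (simp add: algebra_simps)
qed

end

section \<open>Exponential Lyapunov function for the second coordinate\<close>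

text \<open>Without the noise bound the mean is \<open>exp (- \<beta>^2 / 4) < 1\<close>. The noise
  bound tends to 0 pointwise as \<open>n\<close> grows, so by dominated convergence some
  \<open>n\<close> keeps the mean below 1.\<close>

lemma exponential_drift:
  assumes BM: "brownian_motion M W" and \<beta>: "0 < \<beta>"
    and H [measurable]: "H \<in> borel_measurable M"
    and tail: "\<And>A. 1 \<le> A \<Longrightarrow> measure M {\<omega>\<in>space M. A < H \<omega>} \<le> C * exp (- A\<^sup>2 / 4)"
    and mod: "AE \<omega> in M. path_modulus (W \<omega>) (H \<omega>)"
  obtains \<rho> n where "0 \<le> \<rho>" "\<rho> < 1"
    "(\<integral>\<^sup>+ \<omega>. ennreal (exp (\<beta> / 2 * (sqrt 2 * W \<omega> 1 - \<beta> + 3 * noise_bound (H \<omega>) n))) \<partial>M) \<le> ennreal \<rho>"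
proof -
  interpret prob_space M using BM by (simp add: brownian_motion_def)
  have [measurable]: "(\<lambda>\<omega>. W \<omega> t) \<in> borel_measurable M" for t
    using BM by (simp add: brownian_motion_def)
  have W0: "W \<omega> 0 = 0" if "\<omega> \<in> space M" for \<omega>
    using BM that by (simp add: brownian_motion_def)
  let ?f = "\<lambda>n \<omega>. exp (\<beta> / 2 * (sqrt 2 * W \<omega> 1 - \<beta> + 3 * noise_bound (H \<omega>) n))"
  let ?g = "\<lambda>\<omega>. exp (\<beta> / 2 * (sqrt 2 * W \<omega> 1 - \<beta> + 3 * 0))"
  \<comment> \<open>\<open>91 = 13 + 3 * 26\<close>: \<open>sqrt 2 * W 1 \<le> 13 * H\<close>, and
    \<open>noise_bound\<close> is at most \<open>26 * H\<close> whatever \<open>n\<close>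
    is.\<close>
  let ?w = "\<lambda>\<omega>. exp (\<beta> / 2 * 91 * H \<omega>)"
  have [measurable]: "(\<lambda>\<omega>. noise_bound (H \<omega>) n) \<in> borel_measurable M" for n
    unfolding noise_bound_def by measurable
  have int_w: "integrable M ?w"
    using integrable_exp_gaussian_tail[OF H tail, of "\<beta> / 2 * 91"] \<beta> by simp
  have dom: "AE \<omega> in M. norm (?f n \<omega>) \<le> ?w \<omega>" for n
    using mod AE_space
  proof eventually_elim
    case (elim \<omega>)
    have h: "0 \<le> H \<omega>" using elim by (simp add: path_modulus_def)
    have h13: "9 * sqrt 2 * H \<omega> \<le> 13 * H \<omega>" using sqrt_2_bounds h by (intro mult_right_mono) auto
    have "\<bar>W \<omega> 1\<bar> \<le> 9 * H \<omega>"
      using elim W0 unfolding path_modulus_def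
      by (elim conjE allE[of _ 0] allE[of _ 0] allE[of _ 1]) simp
    then have "sqrt 2 * W \<omega> 1 \<le> sqrt 2 * (9 * H \<omega>)" by (intro mult_left_mono) auto
    then have "sqrt 2 * W \<omega> 1 - \<beta> + 3 * noise_bound (H \<omega>) n \<le> 91 * H \<omega>"
      using h13 noise_bound_le[OF h, of n] \<beta> by linarith
    then have "\<beta> / 2 * (sqrt 2 * W \<omega> 1 - \<beta> + 3 * noise_bound (H \<omega>) n) \<le> \<beta> / 2 * (91 * H \<omega>)"
      using \<beta> by (intro mult_left_mono) auto
    then show ?case by simp
  qed
  have lim: "(\<lambda>n. \<integral>\<omega>. ?f n \<omega> \<partial>M) \<longlonglongrightarrow> (\<integral>\<omega>. ?g \<omega> \<partial>M)"
  proof (rule integral_dominated_convergence[OF _ _ int_w _ dom])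
    show "AE \<omega> in M. (\<lambda>n. ?f n \<omega>) \<longlonglongrightarrow> ?g \<omega>"
      by (intro AE_I2 tendsto_intros noise_bound_tendsto_0)
  qed measurable
  have int_f: "integrable M (?f n)" for n
    by (rule Bochner_Integration.integrable_bound[OF int_w]) (use dom[of n] in \<open>auto elim!: eventually_mono\<close>)
  have "(\<integral>\<omega>. ?g \<omega> \<partial>M) = exp (- \<beta>\<^sup>2 / 4)"
  proof -
    have "distributed M lborel (\<lambda>\<omega>. W \<omega> 1 - W \<omega> 0) (normal_density 0 (sqrt (1 - 0)))"
      by (rule brownian_increment[OF BM]) auto
    then have D: "distributed M lborel (\<lambda>\<omega>. W \<omega> 1 - W \<omega> 0) (normal_density 0 1)" by simp
    have "(\<integral>\<^sup>+\<omega>. ennreal (?g \<omega>) \<partial>M) = (\<integral>\<^sup>+\<omega>. ennreal (exp (- \<beta>\<^sup>2 / 2)) * ennreal (exp ((\<beta> / 2 * sqrt 2) * (W \<omega> 1 - W \<omega> 0))) \<partial>M)"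
    proof (rule nn_integral_cong)
      fix \<omega> assume \<omega>: "\<omega> \<in> space M"
      have "\<beta> / 2 * (sqrt 2 * W \<omega> 1 - \<beta> + 3 * 0) = - \<beta>\<^sup>2 / 2 + (\<beta> / 2 * sqrt 2) * (W \<omega> 1 - W \<omega> 0)"
        using W0[OF \<omega>] by (simp add: algebra_simps power2_eq_square)
      then show "ennreal (?g \<omega>) = ennreal (exp (- \<beta>\<^sup>2 / 2)) * ennreal (exp ((\<beta> / 2 * sqrt 2) * (W \<omega> 1 - W \<omega> 0)))"
        by (simp only: exp_add ennreal_mult'[OF exp_ge_zero])
    qed
    also have "\<dots> = ennreal (exp (- \<beta>\<^sup>2 / 2)) * ennreal (exp ((\<beta> / 2 * sqrt 2)\<^sup>2 * 1\<^sup>2 / 2))"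
      unfolding normal_exp_integral[OF D zero_less_one, symmetric] by (rule nn_integral_cmult) measurable
    also have "\<dots> = ennreal (exp (- \<beta>\<^sup>2 / 4))"
      by (simp add: power_mult_distrib power_divide flip: ennreal_mult exp_add)
    finally show ?thesis
      by (subst integral_eq_nn_integral) auto
  qed
  also have "exp (- \<beta>\<^sup>2 / 4) < 1" using \<beta> by simp
  finally have lt: "(\<integral>\<omega>. ?g \<omega> \<partial>M) < 1" .
  from order_tendstoD(2)[OF lim this] obtain n where n: "(\<integral>\<omega>. ?f n \<omega> \<partial>M) < 1"
    by (auto simp: eventually_sequentially)
  show ?thesis
  proof (rule that[of "\<integral>\<omega>. ?f n \<omega> \<partial>M" n])
    show "(\<integral>\<^sup>+ \<omega>. ennreal (?f n \<omega>) \<partial>M) \<le> ennreal (\<integral>\<omega>. ?f n \<omega> \<partial>M)"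
      by (subst nn_integral_eq_integral[OF int_f]) auto
  qed (use n in \<open>auto intro!: Bochner_Integration.integral_nonneg\<close>)
qed

text \<open>The test function is \<open>exp (l * min q2 N)\<close>: it contracts by
  \<open>\<rho>\<close> from starts in \<open>S\<close>, is bounded by \<open>K\<close> in mean from
  starts below \<open>y0\<close>, and is trivially at most \<open>exp (l * N)\<close> from starts in
  \<open>U\<close>. Balancing its stationary mean bounds the part over \<open>S\<close> uniformly in
  \<open>N\<close>; Markov's inequality and large \<open>N\<close> give the tail.\<close>

lemma stationary_q2_upper:
  assumes \<beta>: "0 < \<beta>"
  obtains D y0 where "0 < D" "0 < y0"
    "\<And>\<pi> y. stationary_dist \<beta> \<pi> \<Longrightarrow> y0 \<le> y \<Longrightarrow> measure \<pi> {z. snd z > y} \<le> D * exp (- (\<beta> / 2 * y))"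
proof -
  note BM = brownian_motion_exists
  obtain H where H [measurable]: "H \<in> borel_measurable dyadic_law"
    and tail: "\<And>A. 1 \<le> A \<Longrightarrow> measure dyadic_law {\<omega>\<in>space dyadic_law. A < H \<omega>} \<le> modulus_const * exp (- A\<^sup>2 / 4)"
    and mod: "AE \<omega> in dyadic_law. path_modulus (limit_path \<omega>) (H \<omega>)"
    using brownian_modulus[OF BM] by blast
  obtain \<rho> n where \<rho>: "0 \<le> \<rho>" "\<rho> < 1" and drift:
    "(\<integral>\<^sup>+ \<omega>. ennreal (exp (\<beta> / 2 * (sqrt 2 * limit_path \<omega> 1 - \<beta> + 3 * noise_bound (H \<omega>) n))) \<partial>dyadic_law) \<le> ennreal \<rho>"
    using exponential_drift[OF BM \<beta> H tail mod] by blast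
  have [measurable]: "(\<lambda>\<omega>. noise_bound (H \<omega>) n) \<in> borel_measurable dyadic_law"
    unfolding noise_bound_def by measurable
  define l where "l = \<beta> / 2"
  have l: "0 < l" using \<beta> by (simp add: l_def)
  define y0 where "y0 = 3 * (4 ^ n + \<beta>)"
  have y0: "0 < y0" using \<beta> by (simp add: y0_def add_pos_pos)
  define K where "K = (\<integral>\<omega>. exp (l * (y0 + 52 * H \<omega> + 2 * \<beta>)) \<partial>dyadic_law)"
  have int_K: "integrable dyadic_law (\<lambda>\<omega>. exp (l * (y0 + 52 * H \<omega> + 2 * \<beta>)))"
  proof -
    have "integrable dyadic_law (\<lambda>\<omega>. exp (l * (y0 + 2 * \<beta>)) * exp ((l * 52) * H \<omega>))"
      using walk_limit.P.integrable_exp_gaussian_tail[OF H tail, of "l * 52"] l by simp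
    then show ?thesis by (simp add: exp_add[symmetric] algebra_simps)
  qed
  have K0: "0 \<le> K" unfolding K_def by (intro Bochner_Integration.integral_nonneg) auto
  have main: "measure \<pi> {z. y < snd z \<and> snd z < N} \<le> (K + 1) / (1 - \<rho>) * exp (- (\<beta> / 2 * y))"
    if st: "stationary_dist \<beta> \<pi>" and y: "y0 \<le> y" "y < N" for \<pi> y N
  proof -
    interpret P: prob_space \<pi> using st by (simp add: stationary_dist_def)
    have sets_\<pi>: "sets \<pi> = sets borel" using st by (simp add: stationary_dist_def)
    have sp: "space \<pi> = UNIV" using sets_eq_imp_space_eq[OF sets_\<pi>] by simp
    note [measurable] = borel_measurable_coordinates[OF sets_\<pi>]
    define S where "S = {z::real \<times> real. y0 \<le> snd z \<and> snd z < N}"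
    have "S = {z\<in>space \<pi>. y0 \<le> snd z \<and> snd z < N}" by (simp add: S_def sp)
    then have S [measurable]: "S \<in> sets \<pi>" by simp
    \<comment> \<open>On \<open>U\<close> the truncated function already has its maximal value
      \<open>exp (l * N)\<close>, so its contribution \<open>a\<close> is the same on both sides of
      the balance and cancels.\<close>
    define U where "U = {z::real \<times> real. N \<le> snd z}"
    have "U = {z\<in>space \<pi>. N \<le> snd z}" by (simp add: U_def sp)
    then have U [measurable]: "U \<in> sets \<pi>" by simp
    define a where "a = exp (l * N) * measure \<pi> U"
    define b where "b = (\<integral>z. exp (l * snd z) * indicator S z \<partial>\<pi>)"
    have int_b: "integrable \<pi> (\<lambda>z. exp (l * snd z) * indicator S z)"
      using l by (intro P.integrable_const_bound[where B = "exp (l * N)"])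
         (auto simp: S_def indicator_def abs_mult)
    have int_a: "integrable \<pi> (\<lambda>z. exp (l * N) * indicator U z)"
      by (intro integrable_mult_right) (simp add: P.emeasure_eq_measure)
    have eq_a: "(\<integral>z. exp (l * N) * indicator U z \<partial>\<pi>) = a"
      by (simp add: a_def)
    let ?g = "\<lambda>z. exp (l * N) * indicator U z + \<rho> * (exp (l * snd z) * indicator S z) + K"
    have "(\<integral>\<^sup>+ z. ennreal (exp (l * min (snd z) N)) \<partial>\<pi>) \<le> (\<integral>\<^sup>+ z. ennreal (?g z) \<partial>\<pi>)"
    proof (rule stationary_integral_le[OF st BM, where t = 1 and B = "exp (l * N)"])
      show "(\<lambda>z. exp (l * min (snd z) N)) \<in> borel_measurable borel"
        by (intro borel_measurable_continuous_onI continuous_intros)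
      show "exp (l * min (snd z) N) \<le> exp (l * N)" for z :: "real \<times> real" using l by simp
      show "AE z in \<pi>. \<exists>F\<in>borel_measurable dyadic_law.
       (AE \<omega> in dyadic_law. 0 \<le> F \<omega> \<and> (\<forall>q1 q2 L. reflected_solution \<beta> (limit_path \<omega>) (fst z) (snd z) q1 q2 L \<longrightarrow>
          exp (l * min (snd (q1 1, q2 1)) N) \<le> F \<omega>)) \<and>
       (\<integral>\<^sup>+ \<omega>. ennreal (F \<omega>) \<partial>dyadic_law) \<le> ennreal (?g z)"
        using stationary_support[OF st]
      proof eventually_elim
        case (elim z)
        then have z: "0 \<le> snd z" by simp
        consider "N \<le> snd z" | "y0 \<le> snd z" "snd z < N" | "snd z < y0" using y by linarith
        then show ?case
        proof cases
          case 1
          show ?thesis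
          proof (intro bexI[of _ "\<lambda>_. exp (l * N)"] conjI)
            show "(\<integral>\<^sup>+ \<omega>. ennreal (exp (l * N)) \<partial>dyadic_law) \<le> ennreal (?g z)"
              using 1 K0 \<rho> by (simp only: nn_integral_const walk_limit.P.emeasure_space_1 mult_1_right)
                (auto simp: U_def indicator_def intro!: ennreal_leI)
          qed (use l in auto)
        next
          case 2
          let ?F = "\<lambda>\<omega>. exp (l * snd z) * exp (\<beta> / 2 * (sqrt 2 * limit_path \<omega> 1 - \<beta> + 3 * noise_bound (H \<omega>) n))"
          have "AE \<omega> in dyadic_law. 0 \<le> ?F \<omega> \<and> (\<forall>q1 q2 L. reflected_solution \<beta> (limit_path \<omega>) (fst z) (snd z) q1 q2 L \<longrightarrow>
            exp (l * min (snd (q1 1, q2 1)) N) \<le> ?F \<omega>)"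
            using mod
          proof eventually_elim
            case (elim \<omega>)
            show ?case
            proof (intro conjI allI impI)
              fix q1 q2 L assume sol: "reflected_solution \<beta> (limit_path \<omega>) (fst z) (snd z) q1 q2 L"
              have "min (q2 1) N \<le> snd z + (sqrt 2 * limit_path \<omega> 1 - \<beta> + 3 * noise_bound (H \<omega>) n)"
                using sol_q2_high[OF sol limit_path_zero elim z \<beta>, of n] 2 by (simp add: y0_def)
              then have "l * min (q2 1) N \<le> l * (snd z + (sqrt 2 * limit_path \<omega> 1 - \<beta> + 3 * noise_bound (H \<omega>) n))"
                using l by (intro mult_left_mono) auto
              then show "exp (l * min (snd (q1 1, q2 1)) N) \<le> ?F \<omega>"
                by (simp add: exp_add[symmetric] l_def distrib_left)
            qed simp
          qed
          moreover have "(\<integral>\<^sup>+ \<omega>. ennreal (?F \<omega>) \<partial>dyadic_law) \<le> ennreal (?g z)"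
          proof -
            have "(\<integral>\<^sup>+ \<omega>. ennreal (?F \<omega>) \<partial>dyadic_law) = ennreal (exp (l * snd z)) *
              (\<integral>\<^sup>+ \<omega>. ennreal (exp (\<beta> / 2 * (sqrt 2 * limit_path \<omega> 1 - \<beta> + 3 * noise_bound (H \<omega>) n))) \<partial>dyadic_law)"
              by (simp only: ennreal_mult'[OF exp_ge_zero], rule nn_integral_cmult) measurable
            also have "\<dots> \<le> ennreal (exp (l * snd z)) * ennreal \<rho>"
              by (intro mult_left_mono drift) simp
            also have "\<dots> = ennreal (\<rho> * exp (l * snd z))"
              using \<rho> by (simp add: ennreal_mult'[symmetric] mult.commute)
            also have "\<dots> \<le> ennreal (?g z)"
              using 2 K0 by (intro ennreal_leI) (auto simp: U_def S_def indicator_def)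
            finally show ?thesis .
          qed
          ultimately show ?thesis by (intro bexI[of _ ?F] conjI) measurable
        next
          case 3
          let ?F = "\<lambda>\<omega>. exp (l * (y0 + 52 * H \<omega> + 2 * \<beta>))"
          have "AE \<omega> in dyadic_law. 0 \<le> ?F \<omega> \<and> (\<forall>q1 q2 L. reflected_solution \<beta> (limit_path \<omega>) (fst z) (snd z) q1 q2 L \<longrightarrow>
            exp (l * min (snd (q1 1, q2 1)) N) \<le> ?F \<omega>)"
            using mod
          proof eventually_elim
            case (elim \<omega>)
            show ?case
            proof (intro conjI allI impI)
              fix q1 q2 L assume sol: "reflected_solution \<beta> (limit_path \<omega>) (fst z) (snd z) q1 q2 L"
              have "min (q2 1) N \<le> y0 + 52 * H \<omega> + 2 * \<beta>"
                using sol_q2_low[OF sol limit_path_zero elim z \<beta>] 3 by simp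
              then show "exp (l * min (snd (q1 1, q2 1)) N) \<le> ?F \<omega>"
                using l by simp
            qed simp
          qed
          moreover have "(\<integral>\<^sup>+ \<omega>. ennreal (?F \<omega>) \<partial>dyadic_law) \<le> ennreal (?g z)"
          proof -
            have "(\<integral>\<^sup>+ \<omega>. ennreal (?F \<omega>) \<partial>dyadic_law) = ennreal K"
              unfolding K_def by (rule nn_integral_eq_integral[OF int_K]) simp
            also have "\<dots> \<le> ennreal (?g z)"
              using \<rho> by (intro ennreal_leI) simp
            finally show ?thesis .
          qed
          ultimately show ?thesis by (intro bexI[of _ ?F] conjI) measurable
        qed
      qed
    qed auto
    also have "\<dots> = ennreal (a + \<rho> * b + K)"
    proof -
      have "(\<integral>\<^sup>+ z. ennreal (?g z) \<partial>\<pi>) = ennreal (\<integral>z. ?g z \<partial>\<pi>)"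
        using K0 \<rho> int_a int_b by (intro nn_integral_eq_integral) auto
      also have "(\<integral>z. ?g z \<partial>\<pi>) = a + \<rho> * b + K"
        using int_a int_b eq_a by (simp add: b_def P.prob_space)
      finally show ?thesis .
    qed
    finally have up: "(\<integral>\<^sup>+ z. ennreal (exp (l * min (snd z) N)) \<partial>\<pi>) \<le> ennreal (a + \<rho> * b + K)" .
    have "ennreal (a + b) = (\<integral>\<^sup>+ z. ennreal (exp (l * N) * indicator U z + exp (l * snd z) * indicator S z) \<partial>\<pi>)"
      using int_a int_b eq_a by (subst nn_integral_eq_integral) (auto simp: b_def)
    also have "\<dots> \<le> (\<integral>\<^sup>+ z. ennreal (exp (l * min (snd z) N)) \<partial>\<pi>)"
      by (intro nn_integral_mono ennreal_leI) (auto simp: U_def S_def indicator_def min_def)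
    finally have "ennreal (a + b) \<le> ennreal (a + \<rho> * b + K)" using up by (rule order_trans)
    moreover have "0 \<le> a" "0 \<le> b"
      by (auto simp: a_def b_def intro!: Bochner_Integration.integral_nonneg)
    ultimately have "a + b \<le> a + \<rho> * b + K"
      using K0 \<rho> by (subst (asm) ennreal_le_iff) auto
    \<comment> \<open>The balance gives \<open>b * (1 - \<rho>) \<le> K\<close>; since
      \<open>K\<close> is only known to be nonnegative, \<open>K + 1\<close> is used to have a
      positive constant.\<close>
    then have b: "b \<le> (K + 1) / (1 - \<rho>)"
      using \<rho> by (simp add: pos_le_divide_eq algebra_simps)
    have m: "{z. y < snd z \<and> snd z < N} \<in> sets \<pi>"
    proof -
      have "{z. y < snd z \<and> snd z < N} = {z\<in>space \<pi>. y < snd z \<and> snd z < N}" by (simp add: sp)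
      then show ?thesis by simp
    qed
    have "exp (l * y) * measure \<pi> {z. y < snd z \<and> snd z < N} = (\<integral>z. exp (l * y) * indicator {z. y < snd z \<and> snd z < N} z \<partial>\<pi>)"
      using m by simp
    also have "\<dots> \<le> b"
      unfolding b_def
    proof (rule integral_mono)
      show "integrable \<pi> (\<lambda>z. exp (l * y) * indicator {z. y < snd z \<and> snd z < N} z)"
        using m by (intro integrable_mult_right) (simp add: P.emeasure_eq_measure)
    qed (use l y int_b in \<open>auto simp: S_def indicator_def\<close>)
    finally have "measure \<pi> {z. y < snd z \<and> snd z < N} \<le> b / exp (l * y)"
      by (simp add: pos_le_divide_eq mult.commute)
    also have "\<dots> \<le> (K + 1) / (1 - \<rho>) / exp (l * y)"
      using b by (intro divide_right_mono) auto
    also have "\<dots> = (K + 1) / (1 - \<rho>) * exp (- (\<beta> / 2 * y))"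
      unfolding l_def exp_minus divide_inverse[of _ "exp _"] ..
    finally show ?thesis .
  qed
  show ?thesis
  proof (rule that[of "(K + 1) / (1 - \<rho>)" y0])
    fix \<pi> y assume st: "stationary_dist \<beta> \<pi>" and y: "y0 \<le> y"
    interpret P: prob_space \<pi> using st by (simp add: stationary_dist_def)
    have sets_\<pi>: "sets \<pi> = sets borel" using st by (simp add: stationary_dist_def)
    have sp: "space \<pi> = UNIV" using sets_eq_imp_space_eq[OF sets_\<pi>] by simp
    note [measurable] = borel_measurable_coordinates[OF sets_\<pi>]
    let ?B = "(K + 1) / (1 - \<rho>) * exp (- (\<beta> / 2 * y))"
    have lim: "(\<lambda>k::nat. P.prob {z\<in>space \<pi>. real k < snd z} + ?B) \<longlonglongrightarrow> 0 + ?B"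
      by (intro tendsto_intros P.prob_tail_tendsto_0) measurable
    have "P.prob {z. y < snd z} \<le> P.prob {z\<in>space \<pi>. real k < snd z} + ?B" if "y \<le> real k" for k :: nat
    proof -
      have sets: "{z\<in>space \<pi>. real k < snd z} \<in> sets \<pi>" "{z\<in>space \<pi>. y < snd z \<and> snd z < real k + 1} \<in> sets \<pi>"
        by measurable
      have "P.prob {z. y < snd z} \<le> P.prob ({z\<in>space \<pi>. real k < snd z} \<union> {z\<in>space \<pi>. y < snd z \<and> snd z < real k + 1})"
        by (rule P.finite_measure_mono) (use sets in \<open>auto simp: sp\<close>)
      also have "\<dots> \<le> P.prob {z\<in>space \<pi>. real k < snd z} + P.prob {z\<in>space \<pi>. y < snd z \<and> snd z < real k + 1}"
        using sets by (rule measure_Un_le)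
      also have "P.prob {z\<in>space \<pi>. y < snd z \<and> snd z < real k + 1} \<le> ?B"
        using main[OF st y, of "real k + 1"] that by (simp add: sp)
      finally show ?thesis by simp
    qed
    moreover obtain k0 :: nat where "y \<le> real k0" using real_arch_simple by blast
    ultimately have "P.prob {z. y < snd z} \<le> 0 + ?B"
      by (intro LIMSEQ_le_const[OF lim] exI[of _ k0]) (meson of_nat_le_iff order_trans)
    then show "P.prob {z. snd z > y} \<le> ?B" by simp
  qed (use K0 \<rho> y0 in \<open>auto intro!: divide_pos_pos\<close>)
qed

section \<open>Lower tails\<close>

text \<open>Each of the two upper tails is made smaller than \<open>1 / 4\<close>. The box is fixed
  before \<open>\<pi>\<close>, so constants derived from it serve all stationary distributions for
  this \<open>\<beta>\<close>.\<close>

lemma stationary_compact: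
  assumes \<beta>: "0 < \<beta>"
  obtains K1 K2 where "0 \<le> K1" "0 \<le> K2"
    "\<And>\<pi>. stationary_dist \<beta> \<pi> \<Longrightarrow> 1 / 2 \<le> measure \<pi> {z. - K1 \<le> fst z \<and> fst z \<le> 0 \<and> 0 \<le> snd z \<and> snd z \<le> K2}"
proof -
  obtain D y0 where D: "0 < D" "0 < y0" and
    q2: "\<And>\<pi> y. stationary_dist \<beta> \<pi> \<Longrightarrow> y0 \<le> y \<Longrightarrow> measure \<pi> {z. snd z > y} \<le> D * exp (- (\<beta> / 2 * y))"
    using stationary_q2_upper[OF \<beta>] by blast
  have "((\<lambda>x. q1_const * exp (- x\<^sup>2 / 43264)) \<longlongrightarrow> 0) at_top" by real_asymp
  then have "\<forall>\<^sub>F x in at_top. q1_const * exp (- x\<^sup>2 / 43264) < 1 / 4"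
    by (rule order_tendstoD) simp
  then have "\<forall>\<^sub>F x in at_top. q1_const * exp (- x\<^sup>2 / 43264) < 1 / 4 \<and> 104 \<le> x \<and> 8 * \<beta> \<le> x"
    using eventually_ge_at_top[of 104] eventually_ge_at_top[of "8 * \<beta>"] by eventually_elim auto
  then obtain K1 where K1: "q1_const * exp (- K1\<^sup>2 / 43264) < 1 / 4" "104 \<le> K1" "8 * \<beta> \<le> K1"
    by (auto dest: eventually_happens)
  have "((\<lambda>y. D * exp (- (\<beta> / 2 * y))) \<longlongrightarrow> 0) at_top" using \<beta> by real_asymp
  then have "\<forall>\<^sub>F y in at_top. D * exp (- (\<beta> / 2 * y)) < 1 / 4"
    by (rule order_tendstoD) simp
  then have "\<forall>\<^sub>F y in at_top. D * exp (- (\<beta> / 2 * y)) < 1 / 4 \<and> y0 \<le> y"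
    using eventually_ge_at_top[of y0] by eventually_elim auto
  then obtain K2 where K2: "D * exp (- (\<beta> / 2 * K2)) < 1 / 4" "y0 \<le> K2"
    by (auto dest: eventually_happens)
  show ?thesis
  proof (rule that[of K1 K2])
    fix \<pi> assume st: "stationary_dist \<beta> \<pi>"
    interpret P: prob_space \<pi> using st by (simp add: stationary_dist_def)
    have sets_\<pi>: "sets \<pi> = sets borel" using st by (simp add: stationary_dist_def)
    have sp: "space \<pi> = UNIV" using sets_eq_imp_space_eq[OF sets_\<pi>] by simp
    note [measurable] = borel_measurable_coordinates[OF sets_\<pi>]
    let ?K = "{z. - K1 \<le> fst z \<and> fst z \<le> 0 \<and> 0 \<le> snd z \<and> snd z \<le> K2}"
    have m: "{z\<in>space \<pi>. - K1 \<le> fst z \<and> fst z \<le> 0 \<and> 0 \<le> snd z \<and> snd z \<le> K2} \<in> sets \<pi>"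
      by measurable
    have "measure \<pi> (- ?K) \<le> measure \<pi> ({z. fst z < - K1} \<union> {z. snd z > K2})"
    proof (rule P.finite_measure_mono_AE)
      show "AE z in \<pi>. z \<in> - ?K \<longrightarrow> z \<in> {z. fst z < - K1} \<union> {z. snd z > K2}"
        using stationary_support[OF st] by eventually_elim auto
    qed (simp add: sets_\<pi> sets.Un)
    also have "\<dots> \<le> measure \<pi> {z. fst z < - K1} + measure \<pi> {z. snd z > K2}"
      by (rule measure_Un_le) (simp_all add: sets_\<pi>)
    also have "\<dots> \<le> 1 / 4 + 1 / 4"
      using stationary_q1_upper[OF st \<beta> K1(2,3)] q2[OF st K2(2)] K1 K2 by linarith
    finally have "measure \<pi> (- ?K) \<le> 1 / 2" by simp
    moreover have "measure \<pi> (- ?K) = 1 - measure \<pi> ?K"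
      using P.prob_compl[of ?K] m by (simp add: sp Compl_eq_Diff_UNIV)
    ultimately show "1 / 2 \<le> measure \<pi> ?K" by simp
  qed (use K1 K2 D in auto)
qed

lemma borel_box: "{z::real \<times> real. - K1 \<le> fst z \<and> fst z \<le> 0 \<and> 0 \<le> snd z \<and> snd z \<le> K2} \<in> sets borel"
  by (intro borel_closed closed_Collect_conj closed_Collect_le continuous_intros)

text \<open>As \<open>q2 \<ge> 0\<close>, it suffices to make \<open>q1 + q2\<close> very negative
  at a short time \<open>h\<close>. The fall of \<open>sqrt 2 * W\<close> below
  \<open>- 7/5 * a\<close> competes with the integral of \<open>- q1\<close>, which is at most
  \<open>2/5 * a + K1 + \<beta>\<close> because \<open>h\<close> is small and \<open>H\<close> is at
  most \<open>238 * a\<close>; a net fall of \<open>a\<close> up to constants remains.\<close>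

lemma stationary_q1_lower:
  assumes \<beta>: "0 < \<beta>"
  obtains x0 where "0 < x0"
    "\<And>\<pi> x. stationary_dist \<beta> \<pi> \<Longrightarrow> x0 \<le> x \<Longrightarrow> 1 / 12 * exp (- 2180 * x\<^sup>2) \<le> measure \<pi> {z. fst z < - x}"
proof -
  note BM = brownian_motion_exists
  obtain K1 K2 where K: "0 \<le> K1" "0 \<le> K2" and half:
    "\<And>\<pi>. stationary_dist \<beta> \<pi> \<Longrightarrow> 1 / 2 \<le> measure \<pi> {z. - K1 \<le> fst z \<and> fst z \<le> 0 \<and> 0 \<le> snd z \<and> snd z \<le> K2}"
    using stationary_compact[OF \<beta>] by blast
  obtain H where H [measurable]: "H \<in> borel_measurable dyadic_law"
    and tail: "\<And>A. 1 \<le> A \<Longrightarrow> measure dyadic_law {\<omega>\<in>space dyadic_law. A < H \<omega>} \<le> modulus_const * exp (- A\<^sup>2 / 4)"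
    and mod: "AE \<omega> in dyadic_law. path_modulus (limit_path \<omega>) (H \<omega>)"
    using brownian_modulus[OF BM] by blast
  define K' where "K' = K1 + K2 + \<beta> + 1"
  \<comment> \<open>The summand \<open>6 * modulus_const\<close> lets \<open>exp a\<close> absorb
    the constant in the tail of \<open>H\<close>; the summand \<open>K'\<close> ensures
    \<open>a \<le> 2 * x\<close>.\<close>
  define x0 where "x0 = K' + 6 * modulus_const"
  have x0: "1 \<le> x0" "K' \<le> x0" using K \<beta> modulus_const_pos by (auto simp: x0_def K'_def)
  define h :: real where "h = 1 / 2 ^ 10"
  have h: "0 < h" "h \<le> 1" by (auto simp: h_def)
  \<comment> \<open>Since \<open>sqrt h = 1 / 32\<close> and \<open>32 * a + 1 \<le> 33 * a\<close>,
    the Gaussian exponent is at most \<open>33^2 / 2 < 545\<close> times \<open>a^2\<close>. The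
    multiple 238 is large enough for the tail of \<open>H\<close> to take at most half of that
    probability, and small enough for \<open>13 * 238 * (4/5)^10 / 2^10 \<le> 2/5\<close>.\<close>
  have prob: "exp (- 545 * a\<^sup>2) / 6 \<le> measure dyadic_law {\<omega>\<in>space dyadic_law. limit_path \<omega> h < - a \<and> H \<omega> \<le> 238 * a}"
    if a: "1 \<le> a" "6 * modulus_const \<le> a" for a
  proof -
    let ?X = "\<lambda>\<omega>. 0 + (- 1) * (limit_path \<omega> h - limit_path \<omega> 0)"
    have "distributed dyadic_law lborel (\<lambda>\<omega>. limit_path \<omega> h - limit_path \<omega> 0) (normal_density 0 (sqrt (h - 0)))"
      by (rule brownian_increment[OF BM]) (use h in auto)
    moreover have "sqrt (h - 0) = 1 / 32"
      by (rule real_sqrt_unique) (auto simp: h_def power2_eq_square)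
    ultimately have "distributed dyadic_law lborel (\<lambda>\<omega>. limit_path \<omega> h - limit_path \<omega> 0) (normal_density 0 (1 / 32))"
      by (simp only:)
    then have "distributed dyadic_law lborel ?X (normal_density (0 + (- 1) * 0) (\<bar>- 1\<bar> * (1 / 32)))"
      by (rule walk_limit.P.normal_density_affine) auto
    then have X: "distributed dyadic_law lborel ?X (normal_density 0 (1 / 32))" by simp
    have "exp (- (a / (1 / 32) + 1)\<^sup>2 / 2) / 3 \<le> measure dyadic_law {\<omega>\<in>space dyadic_law. a < ?X \<omega>}"
      using a by (intro prob_space.normal_lower_tail[OF walk_limit.P.prob_space_axioms X]) auto
    moreover have "exp (- 545 * a\<^sup>2) \<le> exp (- (a / (1 / 32) + 1)\<^sup>2 / 2)"
    proof -
      have "(32 * a + 1)\<^sup>2 \<le> (33 * a)\<^sup>2" using a by (intro power_mono) auto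
      then have "(32 * a + 1)\<^sup>2 \<le> 1089 * a\<^sup>2" by (simp add: power_mult_distrib)
      then have "- 545 * a\<^sup>2 \<le> - (32 * a + 1)\<^sup>2 / 2" using zero_le_power2[of a] by linarith
      then show ?thesis by (simp add: mult.commute)
    qed
    ultimately have 1: "exp (- 545 * a\<^sup>2) / 3 \<le> measure dyadic_law {\<omega>\<in>space dyadic_law. a < ?X \<omega>}"
      by linarith
    have "measure dyadic_law {\<omega>\<in>space dyadic_law. 238 * a < H \<omega>} \<le> modulus_const * exp (- (238 * a)\<^sup>2 / 4)"
      using a by (intro tail) auto
    also have "\<dots> \<le> exp (- 545 * a\<^sup>2) / 6"
    proof -
      have "6 * modulus_const \<le> exp a" using a exp_ge_add_one_self[of a] by linarith
      then have "modulus_const * exp (- (238 * a)\<^sup>2 / 4) \<le> exp a / 6 * exp (- (238 * a)\<^sup>2 / 4)"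
        by (intro mult_right_mono) auto
      also have "\<dots> = exp (a - (238 * a)\<^sup>2 / 4) / 6"
        by (simp add: exp_add[symmetric] algebra_simps)
      also have "a - (238 * a)\<^sup>2 / 4 \<le> - 545 * a\<^sup>2"
      proof -
        have "a * 1 \<le> a * a" using a by (intro mult_left_mono) auto
        moreover have "0 \<le> a * a" by simp
        moreover have "a - (238 * a)\<^sup>2 / 4 = a - 14161 * (a * a)" by (simp add: power2_eq_square)
        ultimately show ?thesis unfolding power2_eq_square[of a] by linarith
      qed
      finally show ?thesis by simp
    qed
    finally have 2: "measure dyadic_law {\<omega>\<in>space dyadic_law. 238 * a < H \<omega>} \<le> exp (- 545 * a\<^sup>2) / 6" .
    have "measure dyadic_law {\<omega>\<in>space dyadic_law. a < ?X \<omega>} \<le>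
      measure dyadic_law ({\<omega>\<in>space dyadic_law. limit_path \<omega> h < - a \<and> H \<omega> \<le> 238 * a} \<union> {\<omega>\<in>space dyadic_law. 238 * a < H \<omega>})"
    proof (rule walk_limit.P.finite_measure_mono)
      show "{\<omega>\<in>space dyadic_law. a < ?X \<omega>} \<subseteq> {\<omega>\<in>space dyadic_law. limit_path \<omega> h < - a \<and> H \<omega> \<le> 238 * a} \<union> {\<omega>\<in>space dyadic_law. 238 * a < H \<omega>}"
        by (auto simp: limit_path_zero)
    qed measurable
    also have "\<dots> \<le> measure dyadic_law {\<omega>\<in>space dyadic_law. limit_path \<omega> h < - a \<and> H \<omega> \<le> 238 * a} + measure dyadic_law {\<omega>\<in>space dyadic_law. 238 * a < H \<omega>}"
      by (rule measure_Un_le) measurable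
    finally show ?thesis using 1 2 by linarith
  qed
  show ?thesis
  proof (rule that[of x0])
    fix \<pi> x assume st: "stationary_dist \<beta> \<pi>" and x: "x0 \<le> x"
    define a where "a = x + K'"
    have a: "1 \<le> a" "6 * modulus_const \<le> a"
      using x x0 K \<beta> modulus_const_pos by (auto simp: a_def x0_def K'_def)
    define E where "E = {\<omega>\<in>space dyadic_law. limit_path \<omega> h < - a \<and> H \<omega> \<le> 238 * a}"
    have E: "E \<in> sets dyadic_law" unfolding E_def by measurable
    have "exp (- 545 * a\<^sup>2) / 6 / 2 \<le> measure \<pi> {z. fst z < - x}"
    proof (rule stationary_measure_ge[OF st BM, of h, OF _ _ borel_box half[OF st]])
      have "exp (- 545 * a\<^sup>2) \<le> 1" by (subst exp_le_one_iff) simp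
      then show "exp (- 545 * a\<^sup>2) / 6 \<le> 1" by linarith
      fix z assume "z \<in> {z. - K1 \<le> fst z \<and> fst z \<le> 0 \<and> 0 \<le> snd z \<and> snd z \<le> K2}"
      then have z: "- K1 \<le> fst z" "fst z \<le> 0" "0 \<le> snd z" "snd z \<le> K2" by auto
      show "\<exists>E\<in>sets dyadic_law. exp (- 545 * a\<^sup>2) / 6 \<le> measure dyadic_law E \<and>
        (AE \<omega> in dyadic_law. \<omega> \<in> E \<longrightarrow> (\<forall>q1 q2 L. reflected_solution \<beta> (limit_path \<omega>) (fst z) (snd z) q1 q2 L \<longrightarrow>
          (q1 h, q2 h) \<in> {z. fst z < - x}))"
      proof (intro bexI[OF _ E] conjI)
        show "exp (- 545 * a\<^sup>2) / 6 \<le> measure dyadic_law E"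
          unfolding E_def by (rule prob[OF a])
        show "AE \<omega> in dyadic_law. \<omega> \<in> E \<longrightarrow> (\<forall>q1 q2 L. reflected_solution \<beta> (limit_path \<omega>) (fst z) (snd z) q1 q2 L \<longrightarrow>
          (q1 h, q2 h) \<in> {z. fst z < - x})"
          using mod
        proof eventually_elim
          case (elim \<omega>)
          show ?case
          proof (intro impI allI)
            fix q1 q2 L assume \<omega>: "\<omega> \<in> E" and sol: "reflected_solution \<beta> (limit_path \<omega>) (fst z) (snd z) q1 q2 L"
            have H0: "0 \<le> H \<omega>" "H \<omega> \<le> 238 * a" "limit_path \<omega> h < - a"
              using elim \<omega> by (auto simp: path_modulus_def E_def)
            have q2_nonneg: "0 \<le> q2 u" if "0 \<le> u" for u
            proof -
              have "0 \<le> exp (- u) * snd z" using z by simp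
              also have "\<dots> \<le> q2 u" by (rule sol_q2_lower[OF sol limit_path_zero that])
              finally show ?thesis .
            qed
            define \<eta> where "\<eta> = 9 * sqrt 2 * H \<omega> * (4/5) ^ 10 + \<beta>"
            have "- integral {0..h} q1 \<le> h * (- fst z + \<eta>)"
            proof (rule sol_q1_integral_bound[OF sol limit_path_zero, where m = 0])
              fix s t :: real assume "0 \<le> s" "s \<le> t" "t \<le> h"
              then show "sqrt 2 * \<bar>limit_path \<omega> t - limit_path \<omega> s\<bar> - (0 - \<beta>) * (t - s) \<le> \<eta>"
                unfolding \<eta>_def using elim \<beta> by (intro path_modulus_noise) (auto simp: h_def)
            qed (use q2_nonneg h in auto)
            also have "\<dots> \<le> 2 / 5 * a + K1 + \<beta>"
            proof -
              have "9 * sqrt 2 * H \<omega> \<le> 13 * (238 * a)"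
                using sqrt_2_bounds H0 by (intro mult_mono) auto
              then have "9 * sqrt 2 * H \<omega> * ((4/5) ^ 10 * h) \<le> 13 * (238 * a) * ((4/5) ^ 10 * h)"
                by (rule mult_right_mono) (auto simp: h_def)
              also have "\<dots> \<le> 2 / 5 * a" using a by (simp add: h_def power_divide)
              finally have "9 * sqrt 2 * H \<omega> * ((4/5) ^ 10 * h) \<le> 2 / 5 * a" .
              moreover have "h * (- fst z) \<le> 1 * K1" using h z K by (intro mult_mono) auto
              moreover have "h * \<beta> \<le> 1 * \<beta>" using h \<beta> by (intro mult_right_mono) auto
              ultimately show ?thesis by (simp add: \<eta>_def algebra_simps)
            qed
            finally have int: "- integral {0..h} q1 \<le> 2 / 5 * a + K1 + \<beta>" .
            have "q1 h + q2 h = fst z + snd z + sqrt 2 * limit_path \<omega> h - \<beta> * h - integral {0..h} q1"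
              using h by (intro sol_sum[OF sol limit_path_zero]) auto
            moreover have "0 \<le> \<beta> * h" using \<beta> h by simp
            moreover have "sqrt 2 * limit_path \<omega> h \<le> - (7 / 5 * a)"
            proof -
              have "sqrt 2 * limit_path \<omega> h \<le> sqrt 2 * (- a)" using H0 by (intro mult_left_mono) auto
              moreover have "7 / 5 * a \<le> sqrt 2 * a" using a sqrt_2_bounds by (intro mult_right_mono) auto
              ultimately show ?thesis by simp
            qed
            ultimately have "q1 h \<le> K1 + K2 + \<beta> - a"
              using int z q2_nonneg[of h] h by linarith
            then show "(q1 h, q2 h) \<in> {z. fst z < - x}"
              by (simp add: a_def K'_def)
          qed
        qed
      qed
    qed (use h in auto)
    \<comment> \<open>\<open>2180 = 4 * 545\<close>, because
      \<open>a = x + K' \<le> 2 * x\<close>.\<close>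
    moreover have "exp (- 2180 * x\<^sup>2) \<le> exp (- 545 * a\<^sup>2)"
    proof -
      have "a\<^sup>2 \<le> (2 * x)\<^sup>2" using x x0 a by (intro power_mono) (auto simp: a_def)
      then show ?thesis by (simp add: power_mult_distrib)
    qed
    ultimately show "1 / 12 * exp (- 2180 * x\<^sup>2) \<le> measure \<pi> {z. fst z < - x}" by linarith
  qed (use x0 in auto)
qed

text \<open>To end above \<open>y\<close> at time \<open>T\<close>, the noise has to supply about
  \<open>y + \<beta> * T\<close>, at Gaussian cost \<open>(y + \<beta> * T)^2 / (4 * T)\<close>.
  This is minimal at \<open>T = y / \<beta>\<close>, with value \<open>\<beta> * y\<close>; hence a
  rate linear in \<open>\<beta> * y\<close>.\<close>

lemma stationary_q2_lower:
  assumes \<beta>: "0 < \<beta>"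
  obtains D where "0 < D"
    "\<And>\<pi> y. stationary_dist \<beta> \<pi> \<Longrightarrow> 1 \<le> y \<Longrightarrow> D * exp (- 2 * \<beta> * y) \<le> measure \<pi> {z. snd z > y}"
proof -
  note BM = brownian_motion_exists
  obtain K1 K2 where K: "0 \<le> K1" "0 \<le> K2" and half:
    "\<And>\<pi>. stationary_dist \<beta> \<pi> \<Longrightarrow> 1 / 2 \<le> measure \<pi> {z. - K1 \<le> fst z \<and> fst z \<le> 0 \<and> 0 \<le> snd z \<and> snd z \<le> K2}"
    using stationary_compact[OF \<beta>] by blast
  define D where "D = exp (- (\<beta> * (2 * K1 + K1\<^sup>2)) - 1) / 6"
  show ?thesis
  proof (rule that[of D])
    fix \<pi> and y :: real assume st: "stationary_dist \<beta> \<pi>" and y: "1 \<le> y"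
    define T where "T = y / \<beta>"
    have T: "0 < T" using y \<beta> by (simp add: T_def)
    \<comment> \<open>The noise must exceed \<open>2 * y + K1\<close>: \<open>y\<close> to be
      reached, \<open>\<beta> * T = y\<close> lost to the drift, and \<open>K1\<close> for the worst
      start in the box.\<close>
    define a where "a = (2 * y + K1) / sqrt 2"
    have a: "0 \<le> a" using y K by (simp add: a_def)
    define p where "p = exp (- (a / sqrt T + 1)\<^sup>2 / 2) / 3"
    define E where "E = {\<omega>\<in>space dyadic_law. a < limit_path \<omega> T - limit_path \<omega> 0}"
    have E: "E \<in> sets dyadic_law" unfolding E_def by measurable
    have "distributed dyadic_law lborel (\<lambda>\<omega>. limit_path \<omega> T - limit_path \<omega> 0) (normal_density 0 (sqrt (T - 0)))"
      using T by (intro brownian_increment[OF BM]) auto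
    then have "distributed dyadic_law lborel (\<lambda>\<omega>. limit_path \<omega> T - limit_path \<omega> 0) (normal_density 0 (sqrt T))" by simp
    from prob_space.normal_lower_tail[OF walk_limit.P.prob_space_axioms this _ a] have pE: "p \<le> measure dyadic_law E"
      using T by (simp add: p_def E_def)
    have "p / 2 \<le> measure \<pi> {z. snd z > y}"
    proof (rule stationary_measure_ge[OF st BM, of T, OF _ _ borel_box half[OF st]])
      show "0 \<le> p" by (simp add: p_def)
      show "p \<le> 1" using pE by (rule order_trans) (rule walk_limit.P.prob_le_1)
      fix z assume "z \<in> {z. - K1 \<le> fst z \<and> fst z \<le> 0 \<and> 0 \<le> snd z \<and> snd z \<le> K2}"
      then have z: "- K1 \<le> fst z" "fst z \<le> 0" "0 \<le> snd z" "snd z \<le> K2" by auto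
      show "\<exists>E\<in>sets dyadic_law. p \<le> measure dyadic_law E \<and>
        (AE \<omega> in dyadic_law. \<omega> \<in> E \<longrightarrow> (\<forall>q1 q2 L. reflected_solution \<beta> (limit_path \<omega>) (fst z) (snd z) q1 q2 L \<longrightarrow>
          (q1 T, q2 T) \<in> {z. snd z > y}))"
      proof (intro bexI[OF _ E] conjI pE AE_I2 impI allI)
        fix \<omega> q1 q2 L assume \<omega>: "\<omega> \<in> E" and sol: "reflected_solution \<beta> (limit_path \<omega>) (fst z) (snd z) q1 q2 L"
        have "q1 T + q2 T = fst z + snd z + sqrt 2 * limit_path \<omega> T - \<beta> * T - integral {0..T} q1"
          using T by (intro sol_sum[OF sol limit_path_zero]) auto
        moreover have "q1 T \<le> 0" "integral {0..T} q1 \<le> 0"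
          using T sol_q1_nonpos[OF sol limit_path_zero, of T] sol_integral_q1_nonpos[OF sol limit_path_zero, of T] by auto
        moreover have "\<beta> * T = y" using \<beta> by (simp add: T_def)
        moreover have "2 * y + K1 < sqrt 2 * limit_path \<omega> T"
        proof -
          have "sqrt 2 * a < sqrt 2 * limit_path \<omega> T"
            using \<omega> by (simp add: E_def limit_path_zero)
          then show ?thesis by (simp add: a_def)
        qed
        ultimately have "y < q2 T" using z by linarith
        then show "(q1 T, q2 T) \<in> {z. snd z > y}" by simp
      qed
    qed (use T in auto)
    moreover have "D * exp (- 2 * \<beta> * y) \<le> p / 2"
    proof -
      define b where "b = a / sqrt T"
      have b2: "b\<^sup>2 = \<beta> * (2 * y + 2 * K1 + K1\<^sup>2 / (2 * y))"
      proof -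
        have "b\<^sup>2 = (2 * y + K1)\<^sup>2 / 2 / T" using T by (simp add: b_def a_def power_divide power_mult_distrib)
        also have "\<dots> = \<beta> * (2 * y + 2 * K1 + K1\<^sup>2 / (2 * y))"
          using y \<beta> by (simp add: T_def field_simps power2_eq_square)
        finally show ?thesis .
      qed
      have "K1\<^sup>2 / (2 * y) \<le> K1\<^sup>2 / 1" using y by (intro divide_left_mono) auto
      then have "\<beta> * (2 * y + 2 * K1 + K1\<^sup>2 / (2 * y)) \<le> \<beta> * (2 * y + 2 * K1 + K1\<^sup>2)"
        using \<beta> by (intro mult_left_mono) auto
      then have "b\<^sup>2 \<le> 2 * \<beta> * y + \<beta> * (2 * K1 + K1\<^sup>2)" unfolding b2 by (simp add: algebra_simps)
      \<comment> \<open>Here \<open>b^2\<close> is about \<open>2 * \<beta> * y\<close>; this crude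
        splitting doubles the optimal rate to \<open>2 * \<beta>\<close> and contributes the
        \<open>- 1\<close> in \<open>D\<close>.\<close>
      moreover have "(b + 1)\<^sup>2 \<le> 2 * b\<^sup>2 + 2"
        using zero_le_power2[of "b - 1"] by (simp add: power2_eq_square algebra_simps)
      ultimately have "- (\<beta> * (2 * K1 + K1\<^sup>2)) - 1 + - 2 * \<beta> * y \<le> - (b + 1)\<^sup>2 / 2"
        by simp
      then have "exp (- (\<beta> * (2 * K1 + K1\<^sup>2)) - 1) * exp (- 2 * \<beta> * y) \<le> exp (- (b + 1)\<^sup>2 / 2)"
        by (simp only: exp_add[symmetric] exp_le_cancel_iff)
      then show ?thesis by (simp add: D_def p_def flip: b_def)
    qed
    ultimately show "D * exp (- 2 * \<beta> * y) \<le> measure \<pi> {z. snd z > y}" by linarith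
  qed (simp add: D_def)
qed

theorem theorem2p1:
  shows "\<exists>C1 C2 D1 D2 :: real. C1 > 0 \<and> C2 > 0 \<and> D1 > 0 \<and> D2 > 0 \<and>
    (\<forall>\<beta>::real. \<beta> > 0 \<longrightarrow>
      (\<exists>Cl Cu Dl Du CR DR :: real.
         Cl > 0 \<and> Cu > 0 \<and> Dl > 0 \<and> Du > 0 \<and> CR > 0 \<and> DR > 0 \<and>
         (\<forall>\<pi>. stationary_dist \<beta> \<pi> \<longrightarrow>
            (\<forall>x\<ge>CR. Cl * exp (- C1 * x\<^sup>2) \<le> measure \<pi> {z. fst z < - x} \<and>
                      measure \<pi> {z. fst z < - x} \<le> Cu * exp (- C2 * x\<^sup>2)) \<and>
            (\<forall>y\<ge>DR. Dl * exp (- D1 * \<beta> * y) \<le> measure \<pi> {z. snd z > y} \<and>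
                      measure \<pi> {z. snd z > y} \<le> Du * exp (- D2 * \<beta> * y)))))"
proof (rule exI[of _ 2180], rule exI[of _ "1 / 43264"], rule exI[of _ 2], rule exI[of _ "1 / 2"], intro conjI allI impI)
  fix \<beta> :: real assume \<beta>: "0 < \<beta>"
  obtain x0 where x0: "0 < x0" and q1l:
    "\<And>\<pi> x. stationary_dist \<beta> \<pi> \<Longrightarrow> x0 \<le> x \<Longrightarrow> 1 / 12 * exp (- 2180 * x\<^sup>2) \<le> measure \<pi> {z. fst z < - x}"
    using stationary_q1_lower[OF \<beta>] by blast
  obtain Du y0 where Du: "0 < Du" "0 < y0" and q2u:
    "\<And>\<pi> y. stationary_dist \<beta> \<pi> \<Longrightarrow> y0 \<le> y \<Longrightarrow> measure \<pi> {z. snd z > y} \<le> Du * exp (- (\<beta> / 2 * y))"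
    using stationary_q2_upper[OF \<beta>] by blast
  obtain Dl where Dl: "0 < Dl" and q2l:
    "\<And>\<pi> y. stationary_dist \<beta> \<pi> \<Longrightarrow> 1 \<le> y \<Longrightarrow> Dl * exp (- 2 * \<beta> * y) \<le> measure \<pi> {z. snd z > y}"
    using stationary_q2_lower[OF \<beta>] by blast
  show "\<exists>Cl Cu Dl Du CR DR :: real.
         Cl > 0 \<and> Cu > 0 \<and> Dl > 0 \<and> Du > 0 \<and> CR > 0 \<and> DR > 0 \<and>
         (\<forall>\<pi>. stationary_dist \<beta> \<pi> \<longrightarrow>
            (\<forall>x\<ge>CR. Cl * exp (- 2180 * x\<^sup>2) \<le> measure \<pi> {z. fst z < - x} \<and>
                      measure \<pi> {z. fst z < - x} \<le> Cu * exp (- (1 / 43264) * x\<^sup>2)) \<and>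
            (\<forall>y\<ge>DR. Dl * exp (- 2 * \<beta> * y) \<le> measure \<pi> {z. snd z > y} \<and>
                      measure \<pi> {z. snd z > y} \<le> Du * exp (- (1 / 2) * \<beta> * y)))"
  \<comment> \<open>For the first coordinate even the prefactors \<open>1 / 12\<close> and
    \<open>q1_const\<close> are absolute; \<open>\<beta>\<close> enters only through the
    threshold.\<close>
  proof (rule exI[of _ "1 / 12"], rule exI[of _ q1_const], rule exI[of _ Dl], rule exI[of _ Du],
      rule exI[of _ "max x0 (max 104 (8 * \<beta>))"], rule exI[of _ "max y0 1"], intro conjI allI impI)
    fix \<pi> x assume st: "stationary_dist \<beta> \<pi>" and x: "max x0 (max 104 (8 * \<beta>)) \<le> x"
    show "1 / 12 * exp (- 2180 * x\<^sup>2) \<le> measure \<pi> {z. fst z < - x}"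
      using q1l[OF st] x by simp
    show "measure \<pi> {z. fst z < - x} \<le> q1_const * exp (- (1 / 43264) * x\<^sup>2)"
      using stationary_q1_upper[OF st \<beta>, of x] x by simp
  next
    fix \<pi> y assume st: "stationary_dist \<beta> \<pi>" and y: "max y0 1 \<le> y"
    show "Dl * exp (- 2 * \<beta> * y) \<le> measure \<pi> {z. snd z > y}"
      using q2l[OF st] y by simp
    show "measure \<pi> {z. snd z > y} \<le> Du * exp (- (1 / 2) * \<beta> * y)"
      using q2u[OF st, of y] y by simp
  qed (use \<beta> x0 Du Dl q1_const_pos in auto)
qed auto

end
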